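(* Let $k\ge1$ and $0<\epsilon<1$ be fixed. Let $G$ be a finite group of order $n>10^6\left(\frac{k}{\epsilon}\right)^8$, let $m=\left\lceil\frac{9k^2\log D(G)}{\epsilon^2}\right\rceil$ (natural logarithm), and let $A$ be a uniformly random $m$-element subset of $G$. Then \[ \Pr\big[\mu_{k-1}(Y_{A,k})<(1-\epsilon)m\big]<\frac{6}{n}. \]
   Context: $D(G)=\sum_{\rho}d_\rho$, the sum of the degrees of the (pairwise non-isomorphic) complex irreducible representations $\rho$ of $G$. Let $G$ be a finite group of order $n$ and $k\ge1$. For $1\le i\le k+1$ let $V_i=\{i\}\times G$, viewed as a $0$-dimensional complex. $Y_{G,k}$ denotes the simplicial join $V_1*\cdots*V_{k+1}$, i.e. the simplicial complex on vertex set $V_1\cup\cdots\cup V_{k+1}$ whose simplices are the sets containing at most one vertex from each $V_i$. For $A\subset G$, $Y_{A,k}$ is the subcomplex of $Y_{G,k}$ containing the full $(k-1)$-skeleton of $Y_{G,k}$ and whose $k$-simplices are the sets $\{(1,x_1),\ldots,(k+1,x_{k+1})\}$ with $x_1x_2\cdots x_{k+1}\in A$. For a simplicial complex $X$ and $j\ge0$, $C^j(X)$ is the real vector space of real-valued skew-symmetric functions on ordered $j$-simplices, $C^{-1}(X)=\mathbb R$; the coboundary $d_j:C^j\to C^{j+1}$ is $d_j\phi([v_0,\dots,v_{j+1}])=\sum_i(-1)^i\phi([v_0,\dots,\widehat{v_i},\dots,v_{j+1}])$, and $d_{-1}(a)(v)=a$. Each $C^j(X)$ has the standard inner product $(\phi,\psi)_X=\sum_{\sigma\in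 X(j)}\phi(\sigma)\psi(\sigma)$, and $d_j^*$ denotes the adjoint. The reduced $j$-th Laplacian is $L_j(X)=d_{j-1}d_{j-1}^*+d_j^*d_j$ on $C^j(X)$, and $\mu_j(X)$ denotes its minimal eigenvalue. *)

theory Defs
  imports "HOL-Algebra.Group" "HOL-Combinatorics.Permutations" "Jordan_Normal_Form.Matrix"
begin

definition is_rep :: "('a,'b) monoid_scheme \<Rightarrow> nat \<Rightarrow> ('a \<Rightarrow> complex mat) \<Rightarrow> bool" where
  "is_rep G d \<rho> \<longleftrightarrow>
     (\<forall>g\<in>carrier G. \<rho> g \<in> carrier_mat d d) \<and>
     \<rho> \<one>\<^bsub>G\<^esub> = 1\<^sub>m d \<and>
     (\<forall>g\<in>carrier G. \<forall>h\<in>carrier G. \<rho> (g \<otimes>\<^bsub>G\<^esub> h) = \<rho> g * \<rho> h)"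

definition is_subspace :: "nat \<Rightarrow> complex vec set \<Rightarrow> bool" where
  "is_subspace d W \<longleftrightarrow> W \<subseteq> carrier_vec d \<and> 0\<^sub>v d \<in> W \<and>
     (\<forall>v\<in>W. \<forall>w\<in>W. v + w \<in> W) \<and> (\<forall>c. \<forall>v\<in>W. c \<cdot>\<^sub>v v \<in> W)"

definition is_irrep :: "('a,'b) monoid_scheme \<Rightarrow> nat \<Rightarrow> ('a \<Rightarrow> complex mat) \<Rightarrow> bool" where
  "is_irrep G d \<rho> \<longleftrightarrow> is_rep G d \<rho> \<and> d > 0 \<and>
     (\<forall>W. is_subspace d W \<and> (\<forall>g\<in>carrier G. \<forall>w\<in>W. \<rho> g *\<^sub>v w \<in> W)
          \<longrightarrow> W = {0\<^sub>v d} \<or> W = carrier_vec d)"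

definition irreps :: "('a,'b) monoid_scheme \<Rightarrow> (nat \<times> ('a \<Rightarrow> complex mat)) set" where
  "irreps G = {(d,\<rho>). is_irrep G d \<rho>}"

definition rep_iso :: "('a,'b) monoid_scheme \<Rightarrow> (nat \<times> ('a \<Rightarrow> complex mat)) rel" where
  "rep_iso G = {((d,\<rho>),(d',\<sigma>)). d = d' \<and>
      (\<exists>P\<in>carrier_mat d d. invertible_mat P \<and> (\<forall>g\<in>carrier G. P * \<rho> g = \<sigma> g * P))}"

definition Dsum :: "('a,'b) monoid_scheme \<Rightarrow> nat" where
  "Dsum G = (\<Sum>C \<in> irreps G // (rep_iso G \<inter> (irreps G \<times> irreps G)). fst (SOME p. p \<in> C))"

text \<open>A simplicial complex is given by its set of faces (finite vertex sets), including
 the empty face.  Ordered j-simplices (j \<ge> -1) are distinct lists of length j+1 whose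
 underlying set is a face; the empty list is the unique (-1)-simplex, so that
 C^{-1} = functions on {[]} = R, and d_{-1} is given by the general coboundary formula.\<close>

definition ordsimp :: "'v set set \<Rightarrow> int \<Rightarrow> 'v list set" where
  "ordsimp X j = {xs. distinct xs \<and> int (length xs) = j + 1 \<and> set xs \<in> X}"

definition cochains :: "'v set set \<Rightarrow> int \<Rightarrow> ('v list \<Rightarrow> real) set" where
  "cochains X j = {\<phi>. (\<forall>xs. xs \<notin> ordsimp X j \<longrightarrow> \<phi> xs = 0) \<and>
     (\<forall>xs\<in>ordsimp X j. \<forall>p. p permutes {..<length xs} \<longrightarrow>
         \<phi> (permute_list p xs) = of_int (sign p) * \<phi> xs)}"

definition cobound :: "'v set set \<Rightarrow> int \<Rightarrow> ('v list \<Rightarrow> real) \<Rightarrow> ('v list \<Rightarrow> real)" where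
  "cobound X j \<phi> = (\<lambda>xs. if xs \<in> ordsimp X (j+1)
      then (\<Sum>i<length xs. (-1)^i * \<phi> (take i xs @ drop (Suc i) xs)) else 0)"

text \<open>Standard inner product: sum over unoriented j-simplices of \<phi>(\<sigma>)\<psi>(\<sigma>); each
 j-simplex has (j+1)! orderings, all giving the same product.\<close>
definition cinner :: "'v set set \<Rightarrow> int \<Rightarrow> ('v list \<Rightarrow> real) \<Rightarrow> ('v list \<Rightarrow> real) \<Rightarrow> real" where
  "cinner X j \<phi> \<psi> = (\<Sum>xs\<in>ordsimp X j. \<phi> xs * \<psi> xs) / fact (nat (j+1))"

definition coadj :: "'v set set \<Rightarrow> int \<Rightarrow> ('v list \<Rightarrow> real) \<Rightarrow> ('v list \<Rightarrow> real)" where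
  "coadj X j \<psi> = (THE \<chi>. \<chi> \<in> cochains X j \<and>
      (\<forall>\<phi>\<in>cochains X j. cinner X (j+1) (cobound X j \<phi>) \<psi> = cinner X j \<phi> \<chi>))"

definition laplacian :: "'v set set \<Rightarrow> int \<Rightarrow> ('v list \<Rightarrow> real) \<Rightarrow> ('v list \<Rightarrow> real)" where
  "laplacian X j \<phi> = (\<lambda>xs. cobound X (j-1) (coadj X (j-1) \<phi>) xs + coadj X j (cobound X j \<phi>) xs)"

definition min_eig :: "'v set set \<Rightarrow> int \<Rightarrow> real" where
  "min_eig X j = Min {e. \<exists>\<phi>\<in>cochains X j. \<phi> \<noteq> (\<lambda>_. 0) \<and> laplacian X j \<phi> = (\<lambda>xs. e * \<phi> xs)}"

definition YG :: "('a,'b) monoid_scheme \<Rightarrow> nat \<Rightarrow> (nat \<times> 'a) set set" where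
  "YG G k = {S. S \<subseteq> {1..k+1} \<times> carrier G \<and> (\<forall>i x y. (i,x) \<in> S \<longrightarrow> (i,y) \<in> S \<longrightarrow> x = y)}"

definition simp_prod :: "('a,'b) monoid_scheme \<Rightarrow> nat \<Rightarrow> (nat \<times> 'a) set \<Rightarrow> 'a" where
  "simp_prod G k S = foldr (\<lambda>i acc. (THE x. (i,x) \<in> S) \<otimes>\<^bsub>G\<^esub> acc) [1..<k+2] \<one>\<^bsub>G\<^esub>"

definition YA :: "('a,'b) monoid_scheme \<Rightarrow> nat \<Rightarrow> 'a set \<Rightarrow> (nat \<times> 'a) set set" where
  "YA G k A = {S \<in> YG G k. card S \<le> k \<or> (card S = k + 1 \<and> simp_prod G k S \<in> A)}"

end

theory Submission
  imports Defs "HOL-Library.Function_Algebras" "HOL-Analysis.Function_Topology" "HOL-Analysis.Convex"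
    "HOL-Combinatorics.Multiset_Permutations"
begin

text \<open>
  Write \<open>\<delta> = \<epsilon> / k\<close>.  Pairing an eigencochain \<open>\<phi>\<close> with its Laplacian and grouping the cross terms by the
  (k-2)-faces, each of which misses exactly two colours, reduces the spectral bound to a group
  statement: if convolution with the indicator of \<open>A\<close> has norm at most \<open>\<delta> m\<close> on functions of sum zero,
  then every eigenvalue is at least \<open>m - k \<delta> m\<close>; the mean parts of the cross terms are absorbed by
  the down-Laplacian.

  The norm is bounded by the moment method for \<open>m\<close> independent uniform elements
  \<open>a\<^sub>0, a\<^sub>1, \<dots>\<close>.  The trace of the q-th power of the centred operator counts pairs of words in the
  \<open>a\<^sub>i\<close> with equal product, minus the expected number.  A pair in which some index occurs exactly once
  contributes nothing on average, and the words without such an index have exponential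
  generating function \<open>(exp t - t) ^ m\<close>.  Since \<open>exp t - t \<le> exp (9 t\<^sup>2 / 16)\<close> for
  \<open>0 \<le> t \<le> 8/9\<close>, the choice \<open>t = 8 \<delta> / 9\<close> gives failure probability at most
  \<open>2 n exp (- 4/9 \<delta>\<^sup>2 m)\<close>.  This uses the regular representation rather than its irreducible
  constituents, so of \<open>D(G)\<close> only \<open>n \<le> D(G)\<^sup>2\<close> and \<open>D(G) \<le> n\<^sup>2\<close> are needed.  The second bound keeps
  \<open>m\<close> so small that \<open>m\<close> independent samples are distinct with probability at least 3/4.
\<close>

section \<open>Finite groups\<close>

text \<open>An index that occurs exactly once in a pair of words carries a uniform element
  independent of the others, so the two products agree with probability at most \<open>1/n\<close>,
  and this is what the centring removes. For a random subset such conditional uniformity fails; bad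
  subsets are therefore counted through their \<open>m!\<close> orderings among all sequences.

  The exponent 9/16 matches the 9 in \<open>m\<close>. A bound
  \<open>exp t - t \<le> exp (s * t\<^sup>2)\<close> gives failure probability
  \<open>2 n exp (m (s t\<^sup>2 - t \<delta>))\<close>, least at
  \<open>t = \<delta> / (2 s)\<close> with value
  \<open>2 n exp (- \<delta>\<^sup>2 m / (4 s))\<close>. As
  \<open>\<delta>\<^sup>2 m \<ge> 9 ln D(G)\<close>, the exponential is at most
  \<open>D(G) ^ (- 9 / (4 s))\<close>, and \<open>n \<le> D(G)\<^sup>2\<close> brings this below
  \<open>n ^ (- 2)\<close> as soon as \<open>s \<le> 9/16\<close>. The range
  \<open>t \<le> 8/9\<close> then corresponds to \<open>\<delta> \<le> 1\<close>. Dividing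
  \<open>2/n\<close> by 3/4 leaves \<open>8/(3n) < 6/n\<close>.\<close>

locale fin_group = group G for G (structure) +
  assumes fin: "finite (carrier G)"
begin

abbreviation (input) "n \<equiv> card (carrier G)"

lemma n_pos: "n > 0"
  using fin one_closed card_gt_0_iff by blast

lemma sum_translate_right:
  fixes f :: "'a \<Rightarrow> 'c::comm_monoid_add"
  assumes "h \<in> carrier G"
  shows "(\<Sum>g\<in>carrier G. f (g \<otimes> h)) = (\<Sum>g\<in>carrier G. f g)"
  by (rule sum.reindex_bij_witness[of _ "\<lambda>g. g \<otimes> inv h" "\<lambda>g. g \<otimes> h"])
     (use assms in \<open>auto simp: m_assoc\<close>)

lemma sum_translate_left:
  fixes f :: "'a \<Rightarrow> 'c::comm_monoid_add"
  assumes "h \<in> carrier G"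
  shows "(\<Sum>g\<in>carrier G. f (h \<otimes> g)) = (\<Sum>g\<in>carrier G. f g)"
  by (rule sum.reindex_bij_witness[of _ "\<lambda>g. inv h \<otimes> g" "\<lambda>g. h \<otimes> g"])
     (use assms in \<open>auto simp: m_assoc[symmetric]\<close>)

end

section \<open>Words without a letter of multiplicity one\<close>

abbreviation words :: "nat \<Rightarrow> 'i set \<Rightarrow> 'i list set" where
  "words q A \<equiv> {xs. set xs \<subseteq> A \<and> length xs = q}"

lemma sum_words_Suc:
  fixes f :: "'i list \<Rightarrow> 'c::comm_monoid_add"
  shows "(\<Sum>xs\<in>words (Suc q) A. f xs) = (\<Sum>i\<in>A. \<Sum>xs\<in>words q A. f (i # xs))"
proof -
  have "(\<Sum>xs\<in>words (Suc q) A. f xs) = (\<Sum>(xs,i)\<in>words q A \<times> A. f (i # xs))"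
    unfolding lists_length_Suc_eq
    by (subst sum.reindex) (auto simp: inj_on_def case_prod_unfold)
  also have "\<dots> = (\<Sum>xs\<in>words q A. \<Sum>i\<in>A. f (i # xs))" by (simp add: sum.cartesian_product)
  also have "\<dots> = (\<Sum>i\<in>A. \<Sum>xs\<in>words q A. f (i # xs))" by (rule sum.swap)
  finally show ?thesis .
qed

definition no_single_words :: "nat \<Rightarrow> nat \<Rightarrow> nat list set" where
  "no_single_words N m = {xs \<in> words N {..<m}. \<forall>i. count_list xs i \<noteq> 1}"

lemma finite_no_single_words: "finite (no_single_words N m)"
  unfolding no_single_words_def by (rule finite_subset[OF _ finite_lists_length_eq[of "{..<m}" N]]) auto

lemma count_list_conv_card: "count_list xs y = card {i. i < length xs \<and> xs ! i = y}"
  by (simp add: count_list_eq_length_filter length_filter_conv_card eq_commute)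

text \<open>A word is recovered from the set of positions of its largest letter \<open>m\<close> and
  the word left after deleting that letter. The position set has \<open>r \<noteq> 1\<close>
  elements and the rest is again a word of the same kind over one letter less.\<close>

lemma card_no_single_words_Suc:
  "card (no_single_words N (Suc m)) \<le> (\<Sum>r\<in>{..N} - {1}. (N choose r) * card (no_single_words (N - r) m))"
proof -
  define F where "F xs = ({i. i < N \<and> xs ! i = m}, filter (\<lambda>x. x \<noteq> m) xs)" for xs
  define S where "S = Sigma {R. R \<subseteq> {..<N} \<and> card R \<noteq> 1} (\<lambda>R. no_single_words (N - card R) m)"
  have finS: "finite S" unfolding S_def by (rule finite_SigmaI) (auto intro: finite_no_single_words)
  have inj: "inj_on F (no_single_words N (Suc m))"
  proof (rule inj_onI)
    fix xs ys assume xy: "xs \<in> no_single_words N (Suc m)" "ys \<in> no_single_words N (Suc m)" "F xs = F ys"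
    hence len: "length xs = length ys" "length xs = N" by (auto simp: no_single_words_def)
    have "{i. i < N \<and> xs ! i = m} = {i. i < N \<and> ys ! i = m}" using xy(3) by (simp add: F_def)
    hence e1: "map (\<lambda>x. x = m) xs = map (\<lambda>x. x = m) ys" using len by (intro nth_equalityI) auto
    have e2: "filter (\<lambda>x. x \<noteq> m) xs = filter (\<lambda>x. x \<noteq> m) ys" using xy(3) by (simp add: F_def)
    show "xs = ys" using len(1) e1 e2
      by (induction xs ys rule: list_induct2) (auto split: if_splits)
  qed
  have "F ` no_single_words N (Suc m) \<subseteq> S"
  proof
    fix p assume "p \<in> F ` no_single_words N (Suc m)"
    then obtain xs where xs: "xs \<in> no_single_words N (Suc m)" and p: "p = F xs" by auto
    let ?R = "{i. i < N \<and> xs ! i = m}" and ?ys = "filter (\<lambda>x. x \<noteq> m) xs"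
    have len: "length xs = N" and sub: "set xs \<subseteq> {..<Suc m}" and c: "\<And>i. count_list xs i \<noteq> 1"
      using xs by (auto simp: no_single_words_def)
    have cR: "card ?R = count_list xs m" using len by (simp add: count_list_conv_card)
    have "length ?ys = N - card ?R"
    proof -
      have "?ys = filter (\<lambda>x. \<not> m = x) xs" by (rule filter_cong) auto
      thus ?thesis using len sum_length_filter_compl[of "(=) m" xs]
        unfolding cR count_list_eq_length_filter by simp
    qed
    moreover have "count_list ?ys i \<noteq> 1" for i
    proof (cases "i = m")
      case True
      hence "count_list ?ys i = 0" by (simp add: count_list_0_iff)
      thus ?thesis by simp
    next
      case False
      hence "count_list ?ys i = count_list xs i"
        by (induction xs) auto
      thus ?thesis using c by simp
    qed
    ultimately have "?ys \<in> no_single_words (N - card ?R) m"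
      using sub by (auto simp: no_single_words_def less_Suc_eq)
    thus "p \<in> S" using cR c by (auto simp: S_def p F_def)
  qed
  hence "card (no_single_words N (Suc m)) \<le> card S" using inj finS by (metis card_image card_mono)
  also have "\<dots> = (\<Sum>R\<in>{R. R \<subseteq> {..<N} \<and> card R \<noteq> 1}. card (no_single_words (N - card R) m))"
    unfolding S_def by (rule card_SigmaI) (auto intro: finite_no_single_words)
  also have "\<dots> = (\<Sum>r\<in>{..N} - {1}. \<Sum>R\<in>{R\<in>{R. R \<subseteq> {..<N} \<and> card R \<noteq> 1}. card R = r}.
       card (no_single_words (N - card R) m))"
    by (rule sum.group[symmetric]) (auto simp: subset_eq_atLeast0_lessThan_card atLeast0LessThan[symmetric])
  also have "\<dots> = (\<Sum>r\<in>{..N} - {1}. (N choose r) * card (no_single_words (N - r) m))"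
  proof (rule sum.cong[OF refl])
    fix r assume r: "r \<in> {..N} - {1}"
    have "{R\<in>{R. R \<subseteq> {..<N} \<and> card R \<noteq> 1}. card R = r} = {R. R \<subseteq> {..<N} \<and> card R = r}" using r by auto
    moreover have "card {R. R \<subseteq> {..<N} \<and> card R = r} = N choose r" using n_subsets[of "{..<N}" r] by simp
    ultimately show "(\<Sum>R\<in>{R\<in>{R. R \<subseteq> {..<N} \<and> card R \<noteq> 1}. card R = r}. card (no_single_words (N - card R) m))
      = (N choose r) * card (no_single_words (N - r) m)" by simp
  qed
  finally show ?thesis .
qed

text \<open>The recursion is a binomial convolution, so one more letter multiplies the exponential
  generating function by that of the admissible multiplicities, which is \<open>exp t\<close>
  without its linear term. Truncation at \<open>K\<close> keeps all sums finite.\<close>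

lemma no_single_words_egf:
  fixes t :: real
  assumes t: "t \<ge> 0"
  shows "(\<Sum>N\<le>K. t ^ N / fact N * card (no_single_words N m)) \<le> (exp t - t) ^ m"
proof (induction m)
  case 0
  have "card (no_single_words N 0) = (if N = 0 then 1 else 0)" for N
  proof -
    have "no_single_words N 0 = (if N = 0 then {[]} else {})"
      by (auto simp: no_single_words_def)
    thus ?thesis by simp
  qed
  hence "(\<Sum>N\<le>K. t ^ N / fact N * card (no_single_words N 0)) = (\<Sum>N\<le>K. if N = 0 then 1 else 0)"
    by (intro sum.cong) auto
  thus ?case by simp
next
  case (Suc m)
  define b where "b N = t ^ N / fact N * card (no_single_words N m)" for N
  define w where "w r = (if r = 1 then 0 else t ^ r / fact r)" for r :: nat
  have b0: "b N \<ge> 0" and w0: "w N \<ge> 0" for N using t by (auto simp: b_def w_def)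
  have "t ^ N / fact N * card (no_single_words N (Suc m)) \<le> (\<Sum>r\<le>N. w r * b (N - r))" for N
  proof -
    have "t ^ N / fact N * card (no_single_words N (Suc m)) \<le>
      t ^ N / fact N * real (\<Sum>r\<in>{..N} - {1}. (N choose r) * card (no_single_words (N - r) m))"
      using card_no_single_words_Suc t by (intro mult_left_mono) (auto simp del: of_nat_sum)
    also have "\<dots> = (\<Sum>r\<in>{..N} - {1}. w r * b (N - r))"
      unfolding of_nat_sum sum_distrib_left
    proof (rule sum.cong[OF refl])
      fix r assume r: "r \<in> {..N} - {1}"
      have "t ^ N = t ^ r * t ^ (N - r)" using r by (simp add: power_add[symmetric])
      moreover have "real (N choose r) = fact N / (fact r * fact (N - r))"
        using r by (intro binomial_fact) auto
      ultimately show "t ^ N / fact N * real ((N choose r) * card (no_single_words (N - r) m)) = w r * b (N - r)"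
        using r by (simp add: w_def b_def)
    qed
    also have "\<dots> \<le> (\<Sum>r\<le>N. w r * b (N - r))"
      by (rule sum_mono2) (auto simp: b0 w0)
    finally show ?thesis .
  qed
  hence "(\<Sum>N\<le>K. t ^ N / fact N * card (no_single_words N (Suc m))) \<le> (\<Sum>N\<le>K. \<Sum>r\<le>N. w r * b (N - r))"
    by (rule sum_mono)
  also have "\<dots> = (\<Sum>(r,s)\<in>{(r,s). r + s \<le> K}. w r * b s)"
    by (rule sum.triangle_reindex_eq[symmetric])
  \<comment> \<open>Nonnegativity allows the triangle to be enlarged to a square, over which the sum
    factors.\<close>
  also have "\<dots> \<le> (\<Sum>(r,s)\<in>{..K} \<times> {..K}. w r * b s)"
    by (rule sum_mono2) (auto simp: b0 w0)
  also have "\<dots> = (\<Sum>r\<le>K. w r) * (\<Sum>s\<le>K. b s)"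
    by (simp add: sum_product sum.cartesian_product)
  also have "\<dots> \<le> (exp t - t) * (exp t - t) ^ m"
  proof (rule mult_mono)
    have sw: "(\<lambda>r. t ^ r / fact r - (if r = 1 then t else 0)) sums (exp t - t)"
    proof (rule sums_diff)
      show "(\<lambda>r. t ^ r / fact r) sums exp t"
        using exp_converges[of t] by (simp add: divide_inverse_commute)
      show "(\<lambda>r. if r = 1 then t else 0) sums t" using sums_single[of 1 "\<lambda>_. t"] by simp
    qed
    have "(\<lambda>r. t ^ r / fact r - (if r = 1 then t else 0)) = w" by (auto simp: w_def fun_eq_iff)
    with sw have "w sums (exp t - t)" by simp
    thus "(\<Sum>r\<le>K. w r) \<le> exp t - t"
      using sum_le_suminf[of w "{..K}"] w0 by (simp add: sums_iff)
    show "(\<Sum>s\<le>K. b s) \<le> (exp t - t) ^ m" using Suc.IH by (simp add: b_def)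
    show "0 \<le> exp t - t" using exp_ge_add_one_self[of t] by linarith
    show "0 \<le> (\<Sum>s\<le>K. b s)" by (simp add: sum_nonneg b0)
  qed
  finally show ?case by simp
qed

text \<open>Both sides are compared through Taylor polynomials: \<open>exp t\<close> to degree five
  with remainder from above, the right-hand side to degree three in its exponent from below.\<close>

lemma exp_minus_le:
  fixes t :: real
  assumes "0 \<le> t" "t \<le> 8 / 9"
  shows "exp t - t \<le> exp (9 * t\<^sup>2 / 16)"
proof -
  obtain x where x: "\<bar>x\<bar> \<le> \<bar>t\<bar>" "exp t = (\<Sum>m<6. t ^ m / fact m) + exp x / fact 6 * t ^ 6"
    using Maclaurin_exp_le[of t 6] by auto
  have "exp x \<le> exp (1::real)" using x(1) assms by simp
  \<comment> \<open>With this the remainder has coefficient 3/720 = 1/240.\<close>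
  hence "exp x \<le> 3" using exp_le by linarith
  hence "exp x * t ^ 6 \<le> 3 * t ^ 6" by (intro mult_right_mono) auto
  hence u: "exp t \<le> 1 + t + t^2/2 + t^3/6 + t^4/24 + t^5/120 + t^6/240"
  proof -
    have "(\<Sum>m<6. t ^ m / fact m) = 1 + t + t^2/2 + t^3/6 + t^4/24 + t^5/120"
      by (simp add: numeral_eq_Suc)
    moreover have "exp x / fact 6 * t ^ 6 = (exp x * t ^ 6) / 720" by (simp add: fact_numeral)
    ultimately show ?thesis using x(2) \<open>exp x * t ^ 6 \<le> 3 * t ^ 6\<close> by linarith
  qed
  define y where "y = 9 * t\<^sup>2 / 16"
  have y0: "y \<ge> 0" by (simp add: y_def)
  obtain z where z: "exp y = (\<Sum>m<4. y ^ m / fact m) + exp z / fact 4 * y ^ 4"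
    using Maclaurin_exp_le[of y 4] by auto
  have l: "exp y \<ge> 1 + y + y^2/2 + y^3/6"
    using z y0 by (simp add: numeral_eq_Suc)
  have "1 + y + y^2/2 + y^3/6 - (1 + t^2/2 + t^3/6 + t^4/24 + t^5/120 + t^6/240)
    = t^2 * (1/16 - t/6 + (81/512 - 1/24) * t^2 - t^3/120 + (243/8192 - 1/240) * t^4)"
    unfolding y_def by (simp add: field_simps power2_eq_square power3_eq_cube eval_nat_numeral)
  \<comment> \<open>The cubic term is traded for a quadratic one by \<open>t \<le> 8/9\<close>, and
    the quartic one for its tangent in \<open>t^2\<close> at 1/2. The number 5/8 lies near the
    minimiser of the quadratic that is left.\<close>
  moreover have "1/16 - t/6 + (81/512 - 1/24) * t^2 - t^3/120 + (243/8192 - 1/240) * t^4 \<ge> 0"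
  proof -
    have "t^3 \<le> 8/9 * t^2" using assms mult_right_mono[of t "8/9" "t^2"] by (simp add: eval_nat_numeral)
    moreover have "t^4 \<ge> t^2 - 1/4"
    proof -
      have "(t^2 - 1/2)^2 = t^4 - t^2 + 1/4" by (simp add: power2_diff power_divide)
      thus ?thesis using zero_le_power2[of "t^2 - 1/2"] by linarith
    qed
    moreover have "0 \<le> (t - 5/8)^2" by simp
    hence "t^2 - 5/4 * t + 25/64 \<ge> 0" by (simp add: power2_eq_square algebra_simps)
    ultimately show ?thesis using assms(1) by (simp add: algebra_simps)
  qed
  ultimately have "1 + y + y^2/2 + y^3/6 - (1 + t^2/2 + t^3/6 + t^4/24 + t^5/120 + t^6/240) \<ge> 0"
    by simp
  thus ?thesis using u l unfolding y_def[symmetric] by linarith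
qed


section \<open>Shift operators, words and the centred trace\<close>

context fin_group
begin

definition nrm2 :: "('a \<Rightarrow> real) \<Rightarrow> real" where
  "nrm2 f = (\<Sum>x\<in>carrier G. (f x)\<^sup>2)"

text \<open>The flag selects an operator or its adjoint: translation by \<open>inv g\<close> is the
  transpose of translation by \<open>g\<close>.\<close>

definition letter :: "bool \<Rightarrow> 'a \<Rightarrow> 'a" where
  "letter b g = (if b then g else inv g)"

definition shift_sum :: "'a list \<Rightarrow> bool \<Rightarrow> ('a \<Rightarrow> real) \<Rightarrow> 'a \<Rightarrow> real" where
  "shift_sum a b v = (\<lambda>x. \<Sum>i<length a. v (letter b (a ! i) \<otimes> x))"

text \<open>Alternating the shift operator \<open>M\<close> with its adjoint makes \<open>nrm2 (walk a v q)\<close> the quadratic form of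
  the q-th power of \<open>M\<^sup>* M\<close> at \<open>v\<close>, for odd \<open>q\<close> as well as for even \<open>q\<close>.\<close>

primrec walk :: "'a list \<Rightarrow> ('a \<Rightarrow> real) \<Rightarrow> nat \<Rightarrow> 'a \<Rightarrow> real" where
  "walk a v 0 = v"
| "walk a v (Suc q) = shift_sum a (even q) (walk a v q)"

text \<open>The head of the list belongs to the outermost shift of \<open>walk\<close> and stands
  next to the argument. The parity of the length of the tail tells whether that shift is the
  operator or its adjoint.\<close>

primrec word_prod :: "'a list \<Rightarrow> nat list \<Rightarrow> 'a" where
  "word_prod a [] = \<one>"
| "word_prod a (i # is) = word_prod a is \<otimes> letter (even (length is)) (a ! i)"

lemma letter_closed [simp]: "g \<in> carrier G \<Longrightarrow> letter b g \<in> carrier G"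
  by (simp add: letter_def)

lemma letter_inj: "letter b g = letter b h \<Longrightarrow> g \<in> carrier G \<Longrightarrow> h \<in> carrier G \<Longrightarrow> g = h"
  by (auto simp: letter_def split: if_splits)

lemma nrm2_nonneg: "nrm2 f \<ge> 0"
  by (simp add: nrm2_def sum_nonneg)

lemma shift_sum_adjoint:
  assumes "set a \<subseteq> carrier G"
  shows "(\<Sum>x\<in>carrier G. shift_sum a b v x * w x) = (\<Sum>x\<in>carrier G. v x * shift_sum a (\<not> b) w x)"
proof -
  have "(\<Sum>x\<in>carrier G. shift_sum a b v x * w x)
      = (\<Sum>i<length a. \<Sum>x\<in>carrier G. v (letter b (a ! i) \<otimes> x) * w x)"
    unfolding shift_sum_def sum_distrib_right by (rule sum.swap)
  also have "\<dots> = (\<Sum>i<length a. \<Sum>x\<in>carrier G. v x * w (letter (\<not> b) (a ! i) \<otimes> x))"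
  proof (rule sum.cong[OF refl])
    fix i assume "i \<in> {..<length a}"
    hence ai: "a ! i \<in> carrier G" using assms nth_mem by auto
    have "(\<Sum>x\<in>carrier G. v (letter b (a ! i) \<otimes> x) * w x)
       = (\<Sum>x\<in>carrier G. v (letter b (a ! i) \<otimes> (letter (\<not> b) (a ! i) \<otimes> x)) * w (letter (\<not> b) (a ! i) \<otimes> x))"
      by (rule sum_translate_left[symmetric]) (simp add: ai)
    also have "\<dots> = (\<Sum>x\<in>carrier G. v x * w (letter (\<not> b) (a ! i) \<otimes> x))"
      using ai by (intro sum.cong) (auto simp: letter_def m_assoc[symmetric])
    finally show "(\<Sum>x\<in>carrier G. v (letter b (a ! i) \<otimes> x) * w x)
      = (\<Sum>x\<in>carrier G. v x * w (letter (\<not> b) (a ! i) \<otimes> x))" .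
  qed
  also have "\<dots> = (\<Sum>x\<in>carrier G. v x * shift_sum a (\<not> b) w x)"
    unfolding shift_sum_def sum_distrib_left by (rule sum.swap)
  finally show ?thesis .
qed

text \<open>One shift moves across the inner product as its adjoint, which is exactly the next step
  of the walk because the flags alternate. Cauchy-Schwarz does the rest.\<close>

lemma nrm2_walk_log_convex:
  assumes "set a \<subseteq> carrier G"
  shows "(nrm2 (walk a v (Suc q)))\<^sup>2 \<le> nrm2 (walk a v q) * nrm2 (walk a v (Suc (Suc q)))"
proof -
  have "nrm2 (walk a v (Suc q)) = (\<Sum>x\<in>carrier G. walk a v q x * walk a v (Suc (Suc q)) x)"
    using shift_sum_adjoint[OF assms, of "even q" "walk a v q" "walk a v (Suc q)"]
    by (simp add: nrm2_def power2_eq_square)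
  thus ?thesis using Cauchy_Schwarz_ineq_sum by (simp only: nrm2_def)
qed

text \<open>Log-convexity makes the ratios of successive norms nondecreasing, so a lower bound on
  the first ratio persists. This takes the place of a spectral decomposition of
  \<open>M\<^sup>* M\<close>.\<close>

lemma nrm2_walk_ge_power:
  assumes a: "set a \<subseteq> carrier G" and l: "\<gamma> \<ge> 0" "\<gamma> * nrm2 v \<le> nrm2 (walk a v 1)"
  shows "\<gamma> ^ q * nrm2 v \<le> nrm2 (walk a v q)"
proof -
  have step: "\<gamma> * nrm2 (walk a v q) \<le> nrm2 (walk a v (Suc q))" for q
  proof (induction q)
    case 0
    thus ?case using l by simp
  next
    case (Suc q)
    define c0 c1 c2 where "c0 = nrm2 (walk a v q)" and "c1 = nrm2 (walk a v (Suc q))"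
      and "c2 = nrm2 (walk a v (Suc (Suc q)))"
    have c: "c0 \<ge> 0" "c1 \<ge> 0" "c2 \<ge> 0" "c1\<^sup>2 \<le> c0 * c2" "\<gamma> * c0 \<le> c1"
      using nrm2_nonneg nrm2_walk_log_convex[OF a] Suc by (auto simp: c0_def c1_def c2_def simp del: walk.simps)
    have "\<gamma> * c1 \<le> c2"
    proof (cases "c0 = 0")
      case True
      hence "c1 = 0" using c(4) by simp
      thus ?thesis using c by simp
    next
      case False
      hence c0: "c0 > 0" using c by simp
      have "(\<gamma> * c1) * c0 \<le> c1 * c1" using mult_right_mono[OF c(5,2)] by (simp add: mult_ac)
      also have "\<dots> \<le> c2 * c0" using c(4) by (simp add: power2_eq_square mult_ac)
      finally show ?thesis using c0 by simp
    qed
    thus ?case by (simp only: c1_def c2_def)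
  qed
  show ?thesis
  proof (induction q)
    case (Suc q)
    have "\<gamma> ^ Suc q * nrm2 v \<le> \<gamma> * nrm2 (walk a v q)"
      using mult_left_mono[OF Suc l(1)] by (simp add: mult_ac)
    thus ?case using step[of q] by linarith
  qed simp
qed

lemma word_prod_closed:
  assumes "set a \<subseteq> carrier G" "set is \<subseteq> {..<length a}"
  shows "word_prod a is \<in> carrier G"
  using assms(2)
proof (induction "is")
  case (Cons i "is")
  hence "a ! i \<in> carrier G" using assms(1) nth_mem[of i a] by auto
  thus ?case using Cons by simp
qed simp

lemma walk_eq_sum_words:
  assumes a: "set a \<subseteq> carrier G" and x: "x \<in> carrier G"
  shows "walk a v q x = (\<Sum>is\<in>words q {..<length a}. v (word_prod a is \<otimes> x))"
  using x
proof (induction q arbitrary: x)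
  case 0
  have "words 0 {..<length a} = {[]}" by auto
  thus ?case using 0 by simp
next
  case (Suc q)
  have "walk a v (Suc q) x = (\<Sum>i<length a. walk a v q (letter (even q) (a ! i) \<otimes> x))"
    by (simp add: shift_sum_def)
  also have "\<dots> = (\<Sum>i<length a. \<Sum>is\<in>words q {..<length a}. v (word_prod a (i # is) \<otimes> x))"
  proof (rule sum.cong[OF refl])
    fix i assume "i \<in> {..<length a}"
    hence ai: "a ! i \<in> carrier G" using a nth_mem[of i a] by auto
    have "walk a v q (letter (even q) (a ! i) \<otimes> x)
       = (\<Sum>is\<in>words q {..<length a}. v (word_prod a is \<otimes> (letter (even q) (a ! i) \<otimes> x)))"
      using ai Suc.prems by (intro Suc.IH) simp
    also have "\<dots> = (\<Sum>is\<in>words q {..<length a}. v (word_prod a (i # is) \<otimes> x))"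
      using ai Suc.prems word_prod_closed[OF a] by (intro sum.cong refl) (auto simp: m_assoc)
    finally show "walk a v q (letter (even q) (a ! i) \<otimes> x)
       = (\<Sum>is\<in>words q {..<length a}. v (word_prod a (i # is) \<otimes> x))" .
  qed
  also have "\<dots> = (\<Sum>is\<in>words (Suc q) {..<length a}. v (word_prod a is \<otimes> x))"
    by (rule sum_words_Suc[symmetric])
  finally show ?case .
qed

definition closed_pairs :: "'a list \<Rightarrow> nat \<Rightarrow> (nat list \<times> nat list) set" where
  "closed_pairs a q = {(is,js) \<in> words q {..<length a} \<times> words q {..<length a}. word_prod a is = word_prod a js}"

text \<open>The trace of the q-th power of \<open>M\<^sup>* M\<close> on functions of sum zero: the
  first term is the trace on all functions, and the constants form an invariant line with eigenvalue
  \<open>length a ^ 2\<close>.\<close>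

definition centred_trace :: "'a list \<Rightarrow> nat \<Rightarrow> real" where
  "centred_trace a q = real n * real (card (closed_pairs a q)) - real (length a) ^ (2 * q)"

lemma card_words: "card (words q {..<m::nat}) = m ^ q"
  using card_lists_length_eq[of "{..<m}" q] by simp

lemma finite_words: "finite (words q {..<m::nat})"
  by (rule finite_lists_length_eq) simp

text \<open>The orthogonal projection of the point mass at \<open>y\<close> to the functions of sum
  zero.\<close>

definition centred_single :: "'a \<Rightarrow> 'a \<Rightarrow> real" where
  "centred_single y = (\<lambda>x. (if x = y then 1 else 0) - 1 / n)"

lemma sum_nrm2_walk_centred_single:
  assumes a: "set a \<subseteq> carrier G"
  shows "(\<Sum>y\<in>carrier G. nrm2 (walk a (centred_single y) q)) = centred_trace a q"
proof -
  define L where "L = words q {..<length a}"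
  define W where "W = word_prod a"
  have Wc: "W is \<in> carrier G" if "is \<in> L" for "is"
    using word_prod_closed[OF a] that by (auto simp: L_def W_def)
  have fL: "finite L" unfolding L_def by (rule finite_words)
  have cL: "card L = length a ^ q" unfolding L_def by (rule card_words)
  have n0: "real n \<noteq> 0" using n_pos by simp
  \<comment> \<open>As a matrix in \<open>g\<close> and \<open>h\<close> this is the projection to
    sum zero multiplied by its transpose, hence the projection itself.\<close>
  have inner: "(\<Sum>y\<in>carrier G. centred_single y g * centred_single y h) = (if g = h then 1 else 0) - 1 / n"
    if "g \<in> carrier G" "h \<in> carrier G" for g h
  proof -
    have "centred_single y g * centred_single y h = (if y = g then (if g = h then 1 else 0) else 0)
        - (if y = g then 1 / n else 0) - (if y = h then 1 / n else 0) + 1 / n * (1 / n)" for y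
      by (auto simp: centred_single_def algebra_simps)
    hence "(\<Sum>y\<in>carrier G. centred_single y g * centred_single y h)
      = (if g = h then 1 else 0) - 1 / n - 1 / n + n * (1 / n * (1 / n))"
      using that fin by (simp only: sum.distrib sum_subtractf sum.delta sum_constant if_True)
    thus ?thesis using n0 by simp
  qed
  have "(\<Sum>y\<in>carrier G. nrm2 (walk a (centred_single y) q))
      = (\<Sum>y\<in>carrier G. \<Sum>x\<in>carrier G. \<Sum>is\<in>L. \<Sum>js\<in>L. centred_single y (W is \<otimes> x) * centred_single y (W js \<otimes> x))"
    unfolding nrm2_def
    by (intro sum.cong refl) (simp add: walk_eq_sum_words[OF a] L_def W_def power2_eq_square sum_product)
  also have "\<dots> = (\<Sum>x\<in>carrier G. \<Sum>y\<in>carrier G. \<Sum>is\<in>L. \<Sum>js\<in>L. centred_single y (W is \<otimes> x) * centred_single y (W js \<otimes> x))"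
    by (rule sum.swap)
  also have "\<dots> = (\<Sum>x\<in>carrier G. \<Sum>is\<in>L. \<Sum>js\<in>L. \<Sum>y\<in>carrier G. centred_single y (W is \<otimes> x) * centred_single y (W js \<otimes> x))"
    by (subst sum.swap, subst (2) sum.swap) simp
  also have "\<dots> = (\<Sum>x\<in>carrier G. \<Sum>is\<in>L. \<Sum>js\<in>L. (if W is = W js then 1 else 0) - 1 / n)"
    using Wc by (intro sum.cong refl) (simp add: inner)
  also have "\<dots> = n * (\<Sum>is\<in>L. \<Sum>js\<in>L. (if W is = W js then 1 else 0) - 1 / n)" by simp
  also have "(\<Sum>is\<in>L. \<Sum>js\<in>L. (if W is = W js then 1 else 0) - 1 / real n)
     = (\<Sum>p\<in>L\<times>L. if W (fst p) = W (snd p) then 1 else 0) - real (card L)^2 / n"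
    by (simp add: sum.cartesian_product sum_subtractf case_prod_unfold power2_eq_square)
  also have "(\<Sum>p\<in>L\<times>L. if W (fst p) = W (snd p) then 1 else 0) = real (card (closed_pairs a q))"
  proof -
    have "closed_pairs a q = {p\<in>L\<times>L. W (fst p) = W (snd p)}"
      by (auto simp: closed_pairs_def L_def W_def)
    thus ?thesis using fL by (simp add: sum.If_cases Int_def)
  qed
  finally have "(\<Sum>y\<in>carrier G. nrm2 (walk a (centred_single y) q))
    = real n * (real (card (closed_pairs a q)) - (real (card L))\<^sup>2 / real n)" .
  moreover have "real (card L)^2 = real (length a) ^ (2 * q)"
    unfolding cL by (simp add: power_mult[symmetric] mult.commute)
  ultimately show ?thesis using n0 unfolding centred_trace_def by (simp add: right_diff_distrib)
qed

text \<open>An operator norm is at most the Hilbert-Schmidt norm: a function of sum zero is the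
  combination of the projected point masses with its own values as coefficients.\<close>

lemma nrm2_walk_le:
  assumes a: "set a \<subseteq> carrier G" and v: "(\<Sum>x\<in>carrier G. v x) = 0"
  shows "nrm2 (walk a v q) \<le> nrm2 v * centred_trace a q"
proof -
  have "(walk a v q x)\<^sup>2 \<le> nrm2 v * (\<Sum>y\<in>carrier G. (walk a (centred_single y) q x)\<^sup>2)" if x: "x \<in> carrier G" for x
  proof -
    have vz: "v z = (\<Sum>y\<in>carrier G. v y * centred_single y z)" if "z \<in> carrier G" for z
    proof -
      have "(\<Sum>y\<in>carrier G. v y * centred_single y z)
          = (\<Sum>y\<in>carrier G. (if y = z then v y else 0)) - (\<Sum>y\<in>carrier G. v y) * (1 / n)"
        unfolding sum_distrib_right sum_subtractf[symmetric]
        by (intro sum.cong) (auto simp: centred_single_def algebra_simps)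
      thus ?thesis using that fin v by simp
    qed
    have "walk a v q x = (\<Sum>is\<in>words q {..<length a}. \<Sum>y\<in>carrier G. v y * centred_single y (word_prod a is \<otimes> x))"
      unfolding walk_eq_sum_words[OF a x]
      by (intro sum.cong refl vz) (use word_prod_closed[OF a] x in auto)
    also have "\<dots> = (\<Sum>y\<in>carrier G. v y * walk a (centred_single y) q x)"
      unfolding walk_eq_sum_words[OF a x] sum_distrib_left by (rule sum.swap)
    finally show ?thesis using Cauchy_Schwarz_ineq_sum by (simp only: nrm2_def)
  qed
  hence "nrm2 (walk a v q) \<le> (\<Sum>x\<in>carrier G. nrm2 v * (\<Sum>y\<in>carrier G. (walk a (centred_single y) q x)\<^sup>2))"
    unfolding nrm2_def[of "walk a v q"] by (rule sum_mono)
  also have "\<dots> = nrm2 v * (\<Sum>y\<in>carrier G. nrm2 (walk a (centred_single y) q))"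
    unfolding nrm2_def[of "walk _ _ _"] sum_distrib_left[symmetric] by (subst sum.swap) simp
  finally show ?thesis using sum_nrm2_walk_centred_single[OF a] by simp
qed

lemma centred_trace_nonneg: "set a \<subseteq> carrier G \<Longrightarrow> centred_trace a q \<ge> 0"
  using sum_nrm2_walk_centred_single[of a q, symmetric] by (simp add: sum_nonneg nrm2_nonneg)

text \<open>The bad event. Since \<open>nrm2\<close> is a squared norm, \<open>\<gamma>\<close> is
  the square of the tolerated operator norm.\<close>

definition expanding :: "'a list \<Rightarrow> real \<Rightarrow> bool" where
  "expanding a \<gamma> \<longleftrightarrow> (\<exists>v. (\<Sum>x\<in>carrier G. v x) = 0 \<and> nrm2 (shift_sum a True v) > \<gamma> * nrm2 v)"

text \<open>The trace bounds the quadratic form at \<open>v\<close> from above, the growth of the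
  walk bounds it from below, and the strict excess in \<open>expanding\<close> makes
  \<open>v\<close> nonzero, so that its norm can be cancelled.\<close>

lemma centred_trace_ge:
  assumes a: "set a \<subseteq> carrier G" and l: "\<gamma> \<ge> 0" and bad: "expanding a \<gamma>"
  shows "\<gamma> ^ q \<le> centred_trace a q"
proof -
  obtain v where v: "(\<Sum>x\<in>carrier G. v x) = 0" "nrm2 (shift_sum a True v) > \<gamma> * nrm2 v"
    using bad by (auto simp: expanding_def)
  have le1: "nrm2 (walk a v 1) \<le> nrm2 v * centred_trace a 1" by (rule nrm2_walk_le[OF a v(1)])
  have w1: "walk a v 1 = shift_sum a True v" by simp
  have "nrm2 v \<noteq> 0"
  proof
    assume "nrm2 v = 0"
    thus False using le1 v(2) unfolding w1 by simp
  qed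
  hence pos: "nrm2 v > 0" using nrm2_nonneg[of v] by simp
  have "\<gamma> ^ q * nrm2 v \<le> nrm2 (walk a v q)"
    by (rule nrm2_walk_ge_power[OF a l]) (use v(2) w1 in simp)
  also have "\<dots> \<le> centred_trace a q * nrm2 v" using nrm2_walk_le[OF a v(1), of q] by (simp add: mult.commute)
  finally show ?thesis using pos by simp
qed

end

section \<open>Averages over random sequences and the passage to subsets\<close>

lemma card_filter_sum: "finite A \<Longrightarrow> card {x\<in>A. P x} = (\<Sum>x\<in>A. if P x then 1 else 0)"
  by (simp add: sum.If_cases Int_def)

text \<open>The left-hand side counts the injective sequences, so this is the birthday bound. For
  \<open>m > N\<close> the right-hand side is negative.\<close>

lemma fact_binomial_ge:
  fixes N :: nat
  assumes "N > 0"
  shows "fact m * real (N choose m) \<ge> real N ^ m * (1 - real m ^ 2 / N)"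
proof (induction m)
  case 0
  thus ?case by simp
next
  case (Suc m)
  show ?case
  proof (cases "m \<le> N")
    case False
    have "real (Suc m) ^ 2 \<ge> real (Suc m) * 1"
      unfolding power2_eq_square by (intro mult_left_mono) auto
    hence "real N \<le> real (Suc m) ^ 2" using False by simp
    hence "1 - real (Suc m) ^ 2 / N \<le> 0" using assms by (simp add: field_simps)
    hence "real N ^ Suc m * (1 - real (Suc m) ^ 2 / N) \<le> 0" by (intro mult_nonneg_nonpos) auto
    also have "0 \<le> fact (Suc m) * real (N choose Suc m)" by simp
    finally show ?thesis .
  next
    case True
    have "Suc m * (N choose Suc m) = (N - m) * (N choose m)"
      using binomial_absorption[of m N] binomial_absorb_comp[of N m] by simp
    hence "real (Suc m) * real (N choose Suc m) = (real N - real m) * real (N choose m)"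
      using True by (metis of_nat_diff of_nat_mult)
    have "fact (Suc m) * real (N choose Suc m) = fact m * (real (Suc m) * real (N choose Suc m))"
      by (simp add: field_simps)
    also have "\<dots> = fact m * ((real N - real m) * real (N choose m))"
      by (simp only: \<open>real (Suc m) * real (N choose Suc m) = (real N - real m) * real (N choose m)\<close>)
    finally have eq: "fact (Suc m) * real (N choose Suc m) = (fact m * real (N choose m)) * (real N - real m)"
      by (simp add: mult_ac)
    have "(real m / N) * (real m ^ 2 / N) \<ge> 0" by simp
    hence "1 - real (Suc m) ^ 2 / N \<le> (1 - real m ^ 2 / N) * (1 - real m / N)"
      using assms by (simp add: field_simps power2_eq_square)
    hence "real N ^ Suc m * (1 - real (Suc m) ^ 2 / N) \<le> real N ^ Suc m * ((1 - real m ^ 2 / N) * (1 - real m / N))"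
      by (intro mult_left_mono) auto
    also have "\<dots> = (real N ^ m * (1 - real m ^ 2 / N)) * (real N - real m)"
      using assms by (simp add: field_simps)
    also have "\<dots> \<le> (fact m * real (N choose m)) * (real N - real m)"
      using Suc.IH True by (intro mult_right_mono) auto
    finally show ?thesis unfolding eq .
  qed
qed

context fin_group
begin

lemma word_prod_cong:
  "(\<And>j. j \<in> set is \<Longrightarrow> a ! j = a' ! j) \<Longrightarrow> word_prod a is = word_prod a' is"
  by (induction "is") auto

text \<open>Everything to the left and right of the single occurrence of \<open>i\<close> is the
  same for both sequences and cancels.\<close>

lemma word_prod_single_cancel:
  assumes a: "set a \<subseteq> carrier G" "set a' \<subseteq> carrier G" "length a = length a'"
    and agree: "\<And>j. j < length a \<Longrightarrow> j \<noteq> i \<Longrightarrow> a ! j = a' ! j"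
    and "set is \<subseteq> {..<length a}" "count_list is i = 1" "word_prod a is = word_prod a' is"
  shows "a ! i = a' ! i"
  using assms(5-7)
proof (induction "is")
  case (Cons j "is")
  have j: "j < length a" and sub: "set is \<subseteq> {..<length a}" using Cons.prems(1) by auto
  have c: "a ! j \<in> carrier G" "a' ! j \<in> carrier G" using j a nth_mem by (metis subsetD)+
  have w: "word_prod a is \<in> carrier G" "word_prod a' is \<in> carrier G"
    using word_prod_closed sub a by auto
  show ?case
  proof (cases "j = i")
    case True
    hence "i \<notin> set is" using Cons.prems(2) by (simp add: count_list_0_iff)
    hence "word_prod a is = word_prod a' is" using sub agree by (intro word_prod_cong) auto
    hence "letter (even (length is)) (a ! j) = letter (even (length is)) (a' ! j)"
      using Cons.prems(3) w c by simp
    thus ?thesis using letter_inj c True by blast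
  next
    case False
    hence "a ! j = a' ! j" using agree j by simp
    hence "word_prod a is = word_prod a' is" using Cons.prems(3) w c by simp
    thus ?thesis using Cons.IH sub Cons.prems(2) False by simp
  qed
qed simp

text \<open>The equation determines \<open>a ! i\<close> from the remaining entries, so deleting
  entry \<open>i\<close> is injective on the solutions. The proportion of solutions is thus at most
  \<open>1/n\<close>.\<close>

lemma card_word_eq_single:
  assumes ij: "set is \<subseteq> {..<m}" "set js \<subseteq> {..<m}" and i: "count_list (is @ js) i = 1"
  shows "n * card {a \<in> words m (carrier G). word_prod a is = word_prod a js} \<le> n ^ m"
proof -
  let ?S = "{a \<in> words m (carrier G). word_prod a is = word_prod a js}"
  let ?f = "\<lambda>a. take i a @ drop (Suc i) a"
  have "i \<in> set (is @ js)" using i by (metis count_notin zero_neq_one)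
  hence im: "i < m" using ij by auto
  have "inj_on ?f ?S"
  proof (rule inj_onI)
    fix a a' assume aa: "a \<in> ?S" "a' \<in> ?S" "?f a = ?f a'"
    hence a: "set a \<subseteq> carrier G" "set a' \<subseteq> carrier G" "length a = m" "length a' = m" by auto
    have td: "take i a = take i a'" "drop (Suc i) a = drop (Suc i) a'"
      using aa(3) a(3,4) by auto
    have agree: "a ! j = a' ! j" if "j < m" "j \<noteq> i" for j
    proof (cases "j < i")
      case True
      thus ?thesis using arg_cong[OF td(1), of "\<lambda>l. l ! j"] by simp
    next
      case False
      hence "j = Suc i + (j - Suc i)" using that by simp
      thus ?thesis using arg_cong[OF td(2), of "\<lambda>l. l ! (j - Suc i)"] a(3,4) that im by simp
    qed
    have "count_list is i = 1 \<and> i \<notin> set js \<or> count_list js i = 1 \<and> i \<notin> set is"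
      using i by (auto simp: count_list_0_iff[symmetric])
    hence "a ! i = a' ! i"
    proof
      assume c: "count_list is i = 1 \<and> i \<notin> set js"
      have "word_prod a js = word_prod a' js" using c agree ij by (intro word_prod_cong) auto
      hence "word_prod a is = word_prod a' is" using aa(1,2) by simp
      thus ?thesis using word_prod_single_cancel[of a a' i "is"] a agree ij c by simp
    next
      assume c: "count_list js i = 1 \<and> i \<notin> set is"
      have "word_prod a is = word_prod a' is" using c agree ij by (intro word_prod_cong) auto
      hence "word_prod a js = word_prod a' js" using aa(1,2) by simp
      thus ?thesis using word_prod_single_cancel[of a a' i js] a agree ij c by simp
    qed
    thus "a = a'" using agree a by (metis nth_equalityI)
  qed
  moreover have "?f ` ?S \<subseteq> words (m - 1) (carrier G)"
  proof
    fix b assume "b \<in> ?f ` ?S"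
    then obtain a where a: "a \<in> ?S" "b = ?f a" by auto
    thus "b \<in> words (m - 1) (carrier G)"
      using im set_take_subset[of i a] set_drop_subset[of "Suc i" a] by auto
  qed
  ultimately have "card ?S \<le> card (words (m - 1) (carrier G))"
    using card_inj_on_le finite_lists_length_eq[OF fin] by blast
  also have "\<dots> = n ^ (m - 1)" by (rule card_lists_length_eq[OF fin])
  finally have "n * card ?S \<le> n * n ^ (m - 1)" by simp
  also have "\<dots> = n ^ m" using im by (simp add: power_eq_if)
  finally show ?thesis .
qed

lemma sum_centred_trace_le:
  "(\<Sum>a\<in>words m (carrier G). centred_trace a q) \<le> real n ^ (m + 1) * real (card (no_single_words (2 * q) m))"
proof -
  define Seq where "Seq = words m (carrier G)"
  define L where "L = words q {..<m}"
  define E where "E = {p\<in>L\<times>L. \<forall>i. count_list (fst p @ snd p) i \<noteq> 1}"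
  have fS: "finite Seq" unfolding Seq_def by (rule finite_lists_length_eq[OF fin])
  have cS: "card Seq = n ^ m" unfolding Seq_def by (rule card_lists_length_eq[OF fin])
  have fL: "finite L" unfolding L_def by (rule finite_words)
  have cL: "card L = m ^ q" unfolding L_def by (rule card_words)
  have fE: "finite E" using fL by (simp add: E_def)
  have cE: "card E \<le> card (no_single_words (2 * q) m)"
  proof (rule card_inj_on_le[OF _ _ finite_no_single_words])
    show "inj_on (\<lambda>p. fst p @ snd p) E"
    proof (rule inj_onI)
      fix x y assume xy: "x \<in> E" "y \<in> E" "fst x @ snd x = fst y @ snd y"
      have "length (fst x) = length (fst y)" using xy(1,2) by (simp add: E_def L_def mem_Times_iff)
      thus "x = y" using xy(3) by (simp add: prod_eq_iff)
    qed
    show "(\<lambda>p. fst p @ snd p) ` E \<subseteq> no_single_words (2 * q) m"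
      by (auto simp: E_def L_def no_single_words_def)
  qed
  have "n * (\<Sum>a\<in>Seq. card (closed_pairs a q))
      = n * (\<Sum>a\<in>Seq. \<Sum>p\<in>L\<times>L. if word_prod a (fst p) = word_prod a (snd p) then 1 else 0)"
  proof -
    have "closed_pairs a q = {p\<in>L\<times>L. word_prod a (fst p) = word_prod a (snd p)}" if "a \<in> Seq" for a
      using that by (auto simp: closed_pairs_def L_def Seq_def)
    thus ?thesis using fL by (simp add: card_filter_sum)
  qed
  also have "\<dots> = (\<Sum>p\<in>L\<times>L. n * card {a\<in>Seq. word_prod a (fst p) = word_prod a (snd p)})"
    using fS by (subst sum.swap) (simp add: card_filter_sum sum_distrib_left)
  \<comment> \<open>Every pair is charged \<open>n ^ m\<close>, those in \<open>E\<close> included,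
    because the total of this charge is exactly the mean subtracted in \<open>centred_trace\<close>.
    What remains is the trivial bound for the pairs in \<open>E\<close>.\<close>
  also have "\<dots> \<le> (\<Sum>p\<in>L\<times>L. (if p \<in> E then n ^ (m + 1) else 0) + n ^ m)"
  proof (rule sum_mono)
    fix p assume p: "p \<in> L \<times> L"
    show "n * card {a\<in>Seq. word_prod a (fst p) = word_prod a (snd p)} \<le> (if p \<in> E then n ^ (m + 1) else 0) + n ^ m"
    proof (cases "p \<in> E")
      case True
      have "card {a\<in>Seq. word_prod a (fst p) = word_prod a (snd p)} \<le> card Seq"
        using fS by (intro card_mono) auto
      thus ?thesis using True cS by (simp add: trans_le_add1)
    next
      case False
      then obtain i where "count_list (fst p @ snd p) i = 1" using p by (auto simp: E_def)
      thus ?thesis using card_word_eq_single[of "fst p" m "snd p" i] p False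
        by (auto simp: L_def Seq_def)
    qed
  qed
  also have "\<dots> = card E * n ^ (m + 1) + card (L \<times> L) * n ^ m"
  proof -
    have "{p\<in>L\<times>L. p \<in> E} = E" by (auto simp: E_def)
    thus ?thesis using fL by (simp add: sum.distrib sum.If_cases Int_def)
  qed
  finally have "n * (\<Sum>a\<in>Seq. card (closed_pairs a q)) \<le> card E * n ^ (m + 1) + card (L \<times> L) * n ^ m" .
  hence "real n * (\<Sum>a\<in>Seq. real (card (closed_pairs a q)))
    \<le> real (card E) * real n ^ (m + 1) + real (m ^ q) * real (m ^ q) * real n ^ m"
    using cL by (simp only: card_cartesian_product of_nat_mult[symmetric] of_nat_sum[symmetric]
      of_nat_power[symmetric] of_nat_add[symmetric] of_nat_le_iff)
  moreover have "(\<Sum>a\<in>Seq. centred_trace a q)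
    = real n * (\<Sum>a\<in>Seq. real (card (closed_pairs a q))) - real n ^ m * real m ^ (2 * q)"
  proof -
    have "centred_trace a q = real n * real (card (closed_pairs a q)) - real m ^ (2 * q)" if "a \<in> Seq" for a
      using that by (simp add: centred_trace_def Seq_def)
    thus ?thesis using cS by (simp add: sum_subtractf sum_distrib_left)
  qed
  moreover have "real (card E) * real n ^ (m + 1) \<le> real (card (no_single_words (2 * q) m)) * real n ^ (m + 1)"
    using cE by (intro mult_right_mono) auto
  moreover have "real (m ^ q) * real (m ^ q) = real m ^ (2 * q)" by (simp add: mult_2 power_add)
  ultimately show ?thesis by (simp add: Seq_def mult.commute)
qed

text \<open>Markov's inequality with an exponential weight: the lower bounds
  \<open>(c\<^sup>2) ^ q\<close> on bad sequences are summed with weights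
  \<open>t ^ (2 * q) / fact (2 * q)\<close>. Only even powers occur, so the sum is a hyperbolic
  cosine, at the cost of a factor 2.\<close>

lemma card_expanding_le:
  assumes t: "t \<ge> 0" and c: "c \<ge> 0"
  shows "real (card {a \<in> words m (carrier G). expanding a (c\<^sup>2)}) * (exp (t * c) / 2)
    \<le> real n ^ (m + 1) * (exp t - t) ^ m"
proof -
  define Seq where "Seq = words m (carrier G)"
  define Bad where "Bad = {a \<in> Seq. expanding a (c\<^sup>2)}"
  have fS: "finite Seq" unfolding Seq_def by (rule finite_lists_length_eq[OF fin])
  \<comment> \<open>The estimate is made for partial sums; the limit is then taken in a scalar
    series only.\<close>
  have part: "real (card Bad) * (\<Sum>N<K. if even N then (t * c) ^ N / fact N else 0) \<le> real n ^ (m + 1) * (exp t - t) ^ m" for K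
  proof -
    have "real (card Bad) * (\<Sum>N<K. if even N then (t * c) ^ N / fact N else 0)
        = (\<Sum>a\<in>Bad. \<Sum>N<K. if even N then t ^ N / fact N * (c\<^sup>2) ^ (N div 2) else 0)"
      by (auto intro!: sum.cong simp: power_mult[symmetric] power_mult_distrib)
    also have "\<dots> \<le> (\<Sum>a\<in>Bad. \<Sum>N<K. if even N then t ^ N / fact N * centred_trace a (N div 2) else 0)"
    proof (intro sum_mono)
      fix a N assume "a \<in> Bad"
      hence a: "set a \<subseteq> carrier G" "expanding a (c\<^sup>2)" by (auto simp: Bad_def Seq_def)
      show "(if even N then t ^ N / fact N * (c\<^sup>2) ^ (N div 2) else 0)
         \<le> (if even N then t ^ N / fact N * centred_trace a (N div 2) else 0)"
        using centred_trace_ge[OF a(1) _ a(2), of "N div 2"] t by (auto intro!: mult_left_mono divide_right_mono)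
    qed
    also have "\<dots> \<le> (\<Sum>a\<in>Seq. \<Sum>N<K. if even N then t ^ N / fact N * centred_trace a (N div 2) else 0)"
      using fS t centred_trace_nonneg by (intro sum_mono2) (auto simp: Bad_def Seq_def intro!: sum_nonneg)
    also have "\<dots> = (\<Sum>N<K. if even N then t ^ N / fact N * (\<Sum>a\<in>Seq. centred_trace a (N div 2)) else 0)"
      by (subst sum.swap) (auto intro!: sum.cong simp: sum_distrib_left)
    \<comment> \<open>The zero terms at odd \<open>N\<close> are replaced by nonnegative ones to
      reach the full generating function.\<close>
    also have "\<dots> \<le> (\<Sum>N<K. real n ^ (m + 1) * (t ^ N / fact N * card (no_single_words N m)))"
    proof (rule sum_mono)
      fix N
      show "(if even N then t ^ N / fact N * (\<Sum>a\<in>Seq. centred_trace a (N div 2)) else 0)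
        \<le> real n ^ (m + 1) * (t ^ N / fact N * card (no_single_words N m))"
      proof (cases "even N")
        case True
        have "t ^ N / fact N * (\<Sum>a\<in>Seq. centred_trace a (N div 2))
          \<le> t ^ N / fact N * (real n ^ (m + 1) * card (no_single_words N m))"
          using sum_centred_trace_le[of "N div 2" m] True t by (intro mult_left_mono) (auto simp: Seq_def)
        thus ?thesis using True by (simp add: mult_ac)
      qed (use t in simp)
    qed
    also have "\<dots> \<le> real n ^ (m + 1) * (\<Sum>N\<le>K. t ^ N / fact N * card (no_single_words N m))"
      unfolding sum_distrib_left[symmetric] using t
      by (intro mult_left_mono sum_mono2) auto
    also have "\<dots> \<le> real n ^ (m + 1) * (exp t - t) ^ m"
      by (intro mult_left_mono no_single_words_egf t) simp
    finally show ?thesis .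
  qed
  have "(\<lambda>K. \<Sum>N<K. if even N then (t * c) ^ N / fact N else 0) \<longlonglongrightarrow> cosh (t * c)"
    using cosh_converges[of "t * c"] by (simp add: sums_def divide_inverse_commute cong: if_cong)
  hence "(\<lambda>K. real (card Bad) * (\<Sum>N<K. if even N then (t * c) ^ N / fact N else 0)) \<longlonglongrightarrow> real (card Bad) * cosh (t * c)"
    by (rule tendsto_mult_left)
  hence "real (card Bad) * cosh (t * c) \<le> real n ^ (m + 1) * (exp t - t) ^ m"
    by (rule LIMSEQ_le_const2) (use part in auto)
  moreover have "exp (t * c) / 2 \<le> cosh (t * c)" by (simp add: cosh_field_def)
  hence "real (card Bad) * (exp (t * c) / 2) \<le> real (card Bad) * cosh (t * c)" by (intro mult_left_mono) auto
  ultimately show ?thesis unfolding Bad_def Seq_def by linarith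
qed

definition set_expanding :: "'a set \<Rightarrow> real \<Rightarrow> bool" where
  "set_expanding A \<gamma> \<longleftrightarrow> (\<exists>v. (\<Sum>x\<in>carrier G. v x) = 0 \<and> nrm2 (\<lambda>x. \<Sum>c\<in>A. v (c \<otimes> x)) > \<gamma> * nrm2 v)"

text \<open>All orderings of a bad set are bad sequences, and different sets have disjoint sets of
  orderings.\<close>

lemma card_set_expanding_le:
  "fact m * real (card {A. A \<subseteq> carrier G \<and> card A = m \<and> set_expanding A \<gamma>})
    \<le> real (card {a \<in> words m (carrier G). expanding a \<gamma>})"
proof -
  define \<A> where "\<A> = {A. A \<subseteq> carrier G \<and> card A = m \<and> set_expanding A \<gamma>}"
  have f\<A>: "finite \<A>" unfolding \<A>_def by (rule finite_subset[of _ "Pow (carrier G)"]) (auto simp: fin)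
  have fA: "finite A" if "A \<in> \<A>" for A using that fin finite_subset by (auto simp: \<A>_def)
  have "card (\<Union>A\<in>\<A>. permutations_of_set A) = (\<Sum>A\<in>\<A>. card (permutations_of_set A))"
    by (intro card_UN_disjoint ballI impI finite_permutations_of_set f\<A>) (auto dest: permutations_of_setD)
  also have "\<dots> = (\<Sum>A\<in>\<A>. fact m)"
    using fA by (intro sum.cong refl) (auto simp: \<A>_def)
  also have "\<dots> = fact m * card \<A>" by simp
  finally have "fact m * card \<A> = card (\<Union>A\<in>\<A>. permutations_of_set A)" ..
  also have "\<dots> \<le> card {a \<in> words m (carrier G). expanding a \<gamma>}"
  proof (rule card_mono)
    show "finite {a \<in> words m (carrier G). expanding a \<gamma>}"
      by (rule finite_subset[OF _ finite_lists_length_eq[OF fin, of m]]) auto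
    show "(\<Union>A\<in>\<A>. permutations_of_set A) \<subseteq> {a \<in> words m (carrier G). expanding a \<gamma>}"
    proof
      fix a assume "a \<in> (\<Union>A\<in>\<A>. permutations_of_set A)"
      then obtain A where A: "A \<in> \<A>" "set a = A" "distinct a" by (auto simp: permutations_of_set_def)
      have len: "length a = m" using A distinct_card[OF A(3)] by (simp add: \<A>_def)
      have "shift_sum a True v = (\<lambda>x. \<Sum>c\<in>A. v (c \<otimes> x))" for v
      proof
        fix x
        show "shift_sum a True v x = (\<Sum>c\<in>A. v (c \<otimes> x))"
          using sum.reindex_bij_betw[OF bij_betw_nth[OF A(3) refl A(2)[symmetric]], of "\<lambda>c. v (c \<otimes> x)"]
          by (simp add: shift_sum_def letter_def)
      qed
      thus "a \<in> {a \<in> words m (carrier G). expanding a \<gamma>}"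
        using A len by (auto simp: \<A>_def expanding_def set_expanding_def)
    qed
  qed
  finally have "real (fact m * card \<A>) \<le> real (card {a \<in> words m (carrier G). expanding a \<gamma>})" by (simp only: of_nat_le_iff)
  thus ?thesis by (simp add: \<A>_def)
qed

lemma set_expanding_probability:
  assumes d: "0 < \<delta>" "\<delta> \<le> 1" and m1: "real n ^ 2 \<le> exp (4 / 9 * \<delta>\<^sup>2 * m)" and m2: "4 * real m ^ 2 \<le> real n"
  shows "real (card {A. A \<subseteq> carrier G \<and> card A = m \<and> set_expanding A ((\<delta> * m)\<^sup>2)}) / real (n choose m) < 6 / n"
proof -
  define B where "B = real (card {A. A \<subseteq> carrier G \<and> card A = m \<and> set_expanding A ((\<delta> * m)\<^sup>2)})"
  define t where "t = 8 / 9 * \<delta>"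
  have t: "0 \<le> t" "t \<le> 8 / 9" using d by (auto simp: t_def)
  have n0: "real n > 0" using n_pos by simp
  have e0: "exp t - t \<ge> 0" using exp_ge_add_one_self[of t] by linarith
  have "fact m * B * (exp (t * (\<delta> * m)) / 2)
      \<le> real (card {a \<in> words m (carrier G). expanding a ((\<delta> * m)\<^sup>2)}) * (exp (t * (\<delta> * m)) / 2)"
    unfolding B_def by (intro mult_right_mono card_set_expanding_le) simp
  also have "\<dots> \<le> real n ^ (m + 1) * (exp t - t) ^ m"
    using t d by (intro card_expanding_le) auto
  also have "\<dots> \<le> real n ^ (m + 1) * exp (9 * t\<^sup>2 / 16) ^ m"
    using e0 exp_minus_le[OF t] by (intro mult_left_mono power_mono) auto
  also have "exp (9 * t\<^sup>2 / 16) ^ m = exp (4 / 9 * \<delta>\<^sup>2 * m)"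
    by (simp add: exp_of_nat_mult[symmetric] t_def power2_eq_square)
  \<comment> \<open>At the optimal \<open>t\<close> the exponent on this side is twice the one on
    the other side, so one exponential factor cancels.\<close>
  also have "exp (t * (\<delta> * m)) = exp (4 / 9 * \<delta>\<^sup>2 * m) * exp (4 / 9 * \<delta>\<^sup>2 * m)"
    by (simp add: exp_add[symmetric] t_def power2_eq_square)
  finally have "fact m * B * exp (4 / 9 * \<delta>\<^sup>2 * m) * exp (4 / 9 * \<delta>\<^sup>2 * m) \<le> 2 * real n ^ (m + 1) * exp (4 / 9 * \<delta>\<^sup>2 * m)"
    by simp
  hence 1: "fact m * B * exp (4 / 9 * \<delta>\<^sup>2 * m) \<le> 2 * real n ^ (m + 1)"
    by (rule mult_right_le_imp_le) simp
  have "fact m * B * real n ^ 2 \<le> fact m * B * exp (4 / 9 * \<delta>\<^sup>2 * m)"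
    by (intro mult_left_mono m1) (simp add: B_def)
  with 1 have "(fact m * B * real n) * real n \<le> (2 * real n ^ m) * real n"
    by (simp add: power2_eq_square mult_ac)
  hence 2: "fact m * B * real n \<le> 2 * real n ^ m" using n0 by simp
  have "real m ^ 2 / n \<le> 1 / 4" using m2 n0 by (simp add: field_simps)
  hence "real n ^ m * (3 / 4) \<le> real n ^ m * (1 - real m ^ 2 / n)" by (intro mult_left_mono) auto
  also have "\<dots> \<le> fact m * real (n choose m)" by (rule fact_binomial_ge[OF n_pos])
  finally have 3: "real n ^ m * (3 / 4) \<le> fact m * real (n choose m)" .
  have pos: "real n ^ m > 0" using n0 by simp
  have C0: "real (n choose m) > 0"
    using 3 pos by (metis fact_gt_zero less_le_trans mult_pos_pos zero_less_divide_iff zero_less_mult_pos zero_less_numeral)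
  have "fact m * (B * real n) \<le> 2 * real n ^ m" using 2 by (simp add: mult.assoc)
  also have "\<dots> \<le> 8 / 3 * (fact m * real (n choose m))" using 3 by simp
  finally have "fact m * (B * real n) \<le> fact m * (8 / 3 * real (n choose m))" by simp
  hence "B * real n \<le> 8 / 3 * real (n choose m)" by simp
  also have "\<dots> < 6 * real (n choose m)" using C0 by simp
  finally show ?thesis using C0 n0 unfolding B_def[symmetric] by (simp add: field_simps)
qed

end

section \<open>Linear algebra of finitely supported functions\<close>

text \<open>Total functions with pointwise scaling, over any field: complex functions on the group
  and real cochains share it. Finite dimension comes from a finite support, through the point masses
  \<open>single\<close>.\<close>

global_interpretation fs: vector_space "\<lambda>c (f::'x \<Rightarrow> 'f::field) x. c * f x"
  by standard (auto simp: fun_eq_iff algebra_simps)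

definition single :: "'x \<Rightarrow> 'x \<Rightarrow> 'f::zero_neq_one" where
  "single x = (\<lambda>y. if y = x then 1 else 0)"

lemma sum_fun_apply: "(\<Sum>i\<in>A. f i) x = (\<Sum>i\<in>A. f i x)"
  by (induction A rule: infinite_finite_induct) auto

lemma sum_fun_eq: "(\<Sum>i\<in>A. f i) = (\<lambda>x. \<Sum>i\<in>A. f i x)"
  by (rule ext) (rule sum_fun_apply)

text \<open>Matrix coefficients and eigenvectors arrive as indexed families; independence in the
  indexed sense includes that no member is repeated.\<close>

lemma inj_independent_family:
  fixes f :: "'i \<Rightarrow> 'x \<Rightarrow> 'f::field"
  assumes ind: "\<And>J c. finite J \<Longrightarrow> J \<subseteq> I \<Longrightarrow> (\<And>x. (\<Sum>i\<in>J. c i * f i x) = 0) \<Longrightarrow> (\<forall>i\<in>J. c i = 0)"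
  shows "inj_on f I" "fs.independent (f ` I)"
proof -
  show inj: "inj_on f I"
  proof (rule inj_onI, rule ccontr)
    fix i j assume ij: "i \<in> I" "j \<in> I" "f i = f j" "i \<noteq> j"
    have "\<forall>l\<in>{i,j}. (if l = i then 1 else - 1::'f) = 0"
    proof (rule ind)
      fix x
      show "(\<Sum>l\<in>{i, j}. (if l = i then 1 else - 1) * f l x) = 0"
        using ij(4) fun_cong[OF ij(3), of x] by simp
    qed (use ij(1,2) in auto)
    thus False by simp
  qed
  show "fs.independent (f ` I)"
    unfolding fs.independent_explicit_finite_subsets
  proof (intro allI impI ballI)
    fix T u v assume T: "T \<subseteq> f ` I" "finite T" "(\<Sum>v\<in>T. (\<lambda>x. u v * v x)) = 0" "v \<in> T"
    obtain J where J: "J \<subseteq> I" "finite J" "T = f ` J"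
      using finite_subset_image[OF T(2,1)] by blast
    have injJ: "inj_on f J" using inj J(1) inj_on_subset by blast
    have "\<forall>i\<in>J. u (f i) = 0"
    proof (rule ind[OF J(2,1)])
      fix x
      have "(\<Sum>i\<in>J. u (f i) * f i x) = (\<Sum>v\<in>T. u v * v x)"
        unfolding J(3) by (simp add: sum.reindex[OF injJ])
      also have "\<dots> = 0" using T(3) by (simp add: sum_fun_eq fun_eq_iff)
      finally show "(\<Sum>i\<in>J. u (f i) * f i x) = 0" .
    qed
    thus "u v = 0" using T(4) J(3) by auto
  qed
qed

lemma supported_in_span_single:
  fixes f :: "'x \<Rightarrow> 'f::field"
  assumes "finite S" "\<And>x. x \<notin> S \<Longrightarrow> f x = 0"
  shows "f \<in> fs.span (single ` S)"
proof -
  have "f = (\<Sum>s\<in>S. (\<lambda>x. f s * single s x))"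
    using assms by (auto simp: fun_eq_iff sum_fun_eq single_def if_distrib cong: if_cong)
  also have "\<dots> \<in> fs.span (single ` S)"
    by (intro fs.span_sum fs.span_scale fs.span_base) auto
  finally show ?thesis .
qed

lemma independent_family_card:
  fixes f :: "'i \<Rightarrow> 'x \<Rightarrow> 'f::field"
  assumes "finite S" and supp: "\<And>i x. i \<in> I \<Longrightarrow> x \<notin> S \<Longrightarrow> f i x = 0"
    and ind: "\<And>J c. finite J \<Longrightarrow> J \<subseteq> I \<Longrightarrow> (\<And>x. (\<Sum>i\<in>J. c i * f i x) = 0) \<Longrightarrow> (\<forall>i\<in>J. c i = 0)"
  shows "finite I \<and> card I \<le> card S"
proof -
  have 1: "inj_on f I" "fs.independent (f ` I)"
    by (rule inj_independent_family, rule ind; assumption)+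
  have "finite (f ` I) \<and> card (f ` I) \<le> card (single ` S :: ('x \<Rightarrow> 'f) set)"
  proof (rule fs.independent_span_bound)
    show "f ` I \<subseteq> fs.span (single ` S)"
      using supported_in_span_single[OF assms(1)] supp by blast
  qed (use 1(2) assms in auto)
  moreover have "card (single ` S :: ('x \<Rightarrow> 'f) set) \<le> card S" using assms(1) by (rule card_image_le)
  ultimately show ?thesis using card_image[OF 1(1)] finite_image_iff[OF 1(1)] by simp
qed

lemma spanning_card:
  fixes T :: "('x \<Rightarrow> 'f::field) set"
  assumes "finite T" "finite S" "\<And>x. x \<in> S \<Longrightarrow> single x \<in> fs.span T"
  shows "card S \<le> card T"
proof -
  have ind: "\<forall>i\<in>J. c i = 0" if "finite J" "J \<subseteq> S" "\<And>x. (\<Sum>i\<in>J. c i * (single i x :: 'f)) = 0" for J c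
  proof
    fix i assume "i \<in> J"
    thus "c i = 0" using that(3)[of i] that(1) by (simp add: single_def if_distrib cong: if_cong)
  qed
  have 1: "inj_on (single :: 'x \<Rightarrow> 'x \<Rightarrow> 'f) S" "fs.independent (single ` S :: ('x \<Rightarrow> 'f) set)"
    by (rule inj_independent_family, rule ind; assumption)+
  have "card (single ` S :: ('x \<Rightarrow> 'f) set) \<le> card T"
    using fs.independent_span_bound[OF assms(1) 1(2)] assms(3) by auto
  thus ?thesis using card_image[OF 1(1)] by simp
qed

text \<open>Gram-Schmidt by induction on \<open>B\<close>: \<open>w\<close> is the part of the new
  vector orthogonal to the old span, and the old projection of \<open>v\<close> is corrected along
  \<open>w\<close>.\<close>

lemma orthogonal_projection_exists:
  fixes B :: "('x \<Rightarrow> complex) set"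
  assumes "finite B" "finite S"
  shows "\<exists>u\<in>fs.span B. \<forall>b\<in>fs.span B. (\<Sum>x\<in>S. (v x - u x) * cnj (b x)) = 0"
  using assms(1)
proof (induction B arbitrary: v)
  case empty
  show ?case by (auto intro!: bexI[of _ 0] simp: fs.span_zero)
next
  case (insert a B)
  define ip where "ip f g = (\<Sum>x\<in>S. f x * cnj (g x))" for f g :: "'x \<Rightarrow> complex"
  obtain p where p: "p \<in> fs.span B" "\<forall>b\<in>fs.span B. ip (a - p) b = 0"
    using insert.IH[of a] by (auto simp: ip_def)
  obtain q where q: "q \<in> fs.span B" "\<forall>b\<in>fs.span B. ip (v - q) b = 0"
    using insert.IH[of v] by (auto simp: ip_def)
  define w where "w = a - p"
  \<comment> \<open>Functions may be nonzero outside \<open>S\<close>, so the form is only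
    semidefinite. A null vector \<open>w\<close> vanishes on \<open>S\<close> and is orthogonal to
    everything, so no correction is made.\<close>
  define c where "c = (if ip w w = 0 then 0 else ip (v - q) w / ip w w)"
  define u where "u = q + (\<lambda>x. c * w x)"
  have ipdiff: "ip (f - (\<lambda>x. c * g x)) h = ip f h - c * ip g h" for f g h c
    by (simp add: ip_def algebra_simps sum_subtractf sum_distrib_left)
  have ipr: "ip f (g + (\<lambda>x. c * h x)) = ip f g + cnj c * ip f h" for f g h c
    by (simp add: ip_def algebra_simps sum.distrib sum_distrib_left)
  have w0: "ip (v - q) w = 0" if "ip w w = 0"
  proof -
    have "(\<Sum>x\<in>S. (cmod (w x))\<^sup>2) = 0"
    proof -
      have "ip w w = of_real (\<Sum>x\<in>S. (cmod (w x))\<^sup>2)"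
        unfolding ip_def of_real_sum by (intro sum.cong refl) (simp only: complex_norm_square)
      thus ?thesis using that by (simp del: of_real_sum)
    qed
    hence "\<forall>x\<in>S. w x = 0" using assms(2) by (simp add: sum_nonneg_eq_0_iff)
    thus ?thesis by (simp add: ip_def)
  qed
  have uw: "ip (v - u) w = 0"
  proof -
    have "v - u = (v - q) - (\<lambda>x. c * w x)" by (simp add: u_def fun_eq_iff)
    hence "ip (v - u) w = ip (v - q) w - c * ip w w" by (simp only: ipdiff)
    thus ?thesis using w0 by (auto simp: c_def)
  qed
  have pin: "p \<in> fs.span (insert a B)" and qin: "q \<in> fs.span (insert a B)"
    using p(1) q(1) fs.span_mono[of B "insert a B"] by auto
  have "w \<in> fs.span (insert a B)"
    unfolding w_def by (intro fs.span_diff pin fs.span_base) simp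
  hence uin: "u \<in> fs.span (insert a B)"
    unfolding u_def by (intro fs.span_add qin fs.span_scale)
  have "ip (v - u) b = 0" if b: "b \<in> fs.span (insert a B)" for b
  proof -
    obtain k where k: "b - (\<lambda>x. k * a x) \<in> fs.span B" using b fs.span_breakdown_eq by blast
    define b' where "b' = (b - (\<lambda>x. k * a x)) + (\<lambda>x. k * p x)"
    have b'in: "b' \<in> fs.span B" unfolding b'_def by (intro fs.span_add k fs.span_scale p(1))
    have beq: "b = b' + (\<lambda>x. k * w x)" by (simp add: b'_def w_def fun_eq_iff algebra_simps)
    have "ip (v - u) b' = 0"
    proof -
      have "v - u = (v - q) - (\<lambda>x. c * w x)" by (simp add: u_def fun_eq_iff)
      hence "ip (v - u) b' = ip (v - q) b' - c * ip w b'" by (simp only: ipdiff)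
      thus ?thesis using q(2) p(2) b'in by (simp add: w_def)
    qed
    thus ?thesis unfolding beq ipr using uw by simp
  qed
  thus ?case using uin by (auto simp: ip_def intro!: bexI[of _ u])
qed

section \<open>The degree sum of the irreducible representations\<close>

lemma index_mult_mat_sum:
  assumes "A \<in> carrier_mat a b" "B \<in> carrier_mat b c" "i < a" "j < c"
  shows "(A * B) $$ (i,j) = (\<Sum>k<b. A $$ (i,k) * B $$ (k,j))"
  using assms by (auto simp: scalar_prod_def atLeast0LessThan intro!: sum.cong)

lemma index_mult_mat_vec_sum:
  assumes "A \<in> carrier_mat a b" "v \<in> carrier_vec b" "i < a"
  shows "(A *\<^sub>v v) $ i = (\<Sum>k<b. A $$ (i,k) * v $ k)"
  using assms by (auto simp: scalar_prod_def atLeast0LessThan intro!: sum.cong)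

lemma mult_mat_zero_vec:
  "A \<in> carrier_mat a b \<Longrightarrow> A *\<^sub>v 0\<^sub>v b = (0\<^sub>v a :: 'a::semiring_0 vec)"
  by (rule eq_vecI) (auto simp: scalar_prod_def)

section \<open>Translations and completeness of the matrix coefficients\<close>

context fin_group
begin

text \<open>The right regular representation, realised on functions that vanish off the
  carrier.\<close>

definition rtrans :: "'a \<Rightarrow> ('a \<Rightarrow> complex) \<Rightarrow> 'a \<Rightarrow> complex" where
  "rtrans g f = (\<lambda>x. if x \<in> carrier G then f (x \<otimes> g) else 0)"

definition supported :: "('a \<Rightarrow> complex) set" where
  "supported = {f. \<forall>x. x \<notin> carrier G \<longrightarrow> f x = 0}"

definition inv_subspace :: "('a \<Rightarrow> complex) set \<Rightarrow> bool" where
  "inv_subspace W \<longleftrightarrow> fs.subspace W \<and> W \<subseteq> supported \<and> (\<forall>g\<in>carrier G. \<forall>f\<in>W. rtrans g f \<in> W)"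

lemma rtrans_add: "rtrans g (f + h) = rtrans g f + rtrans g h"
  by (auto simp: rtrans_def)

lemma rtrans_scale: "rtrans g (\<lambda>x. c * f x) = (\<lambda>x. c * rtrans g f x)"
  by (auto simp: rtrans_def)

lemma rtrans_sum: "rtrans g (\<lambda>x. \<Sum>i\<in>I. c i * f i x) = (\<lambda>x. \<Sum>i\<in>I. c i * rtrans g (f i) x)"
  by (auto simp: rtrans_def)

lemma rtrans_mult:
  "g \<in> carrier G \<Longrightarrow> h \<in> carrier G \<Longrightarrow> rtrans (g \<otimes> h) f = rtrans g (rtrans h f)"
  by (auto simp: rtrans_def m_assoc)

lemma rtrans_one: "f \<in> supported \<Longrightarrow> rtrans \<one> f = f"
  by (auto simp: rtrans_def supported_def)

lemma supported_in_span: "supported \<subseteq> fs.span (single ` carrier G)"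
  using supported_in_span_single[OF fin] by (auto simp: supported_def)

lemma supported_independent_finite:
  assumes "B \<subseteq> supported" "fs.independent B"
  shows "finite B"
  using fs.independent_span_bound[OF _ assms(2), of "single ` carrier G"] fin assms(1) supported_in_span
  by auto

text \<open>A nonzero invariant subspace of least dimension. A properly smaller one has smaller
  dimension, since its basis stays independent after adding a vector outside it.\<close>

lemma minimal_inv_subspace:
  assumes "inv_subspace U" "U \<noteq> {0}"
  obtains W where "inv_subspace W" "W \<subseteq> U" "W \<noteq> {0}"
    "\<And>W'. inv_subspace W' \<Longrightarrow> W' \<subseteq> W \<Longrightarrow> W' \<noteq> {0} \<Longrightarrow> W' = W"
proof -
  define P where "P W \<longleftrightarrow> inv_subspace W \<and> W \<subseteq> U \<and> W \<noteq> {0}" for W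
  have "P U" using assms by (simp add: P_def)
  then obtain W where W: "P W" "\<And>W'. P W' \<Longrightarrow> fs.dim W \<le> fs.dim W'"
    using exists_least_iff[of "\<lambda>c. \<exists>W. P W \<and> fs.dim W = c"]
    by (metis (no_types, lifting) linorder_not_less)
  have "W' = W" if W': "inv_subspace W'" "W' \<subseteq> W" "W' \<noteq> {0}" for W'
  proof (rule ccontr)
    assume ne: "W' \<noteq> W"
    have "P W'" using W' W(1) by (auto simp: P_def)
    hence le: "fs.dim W \<le> fs.dim W'" by (rule W(2))
    obtain B where B: "B \<subseteq> W" "fs.independent B" "W \<subseteq> fs.span B" "card B = fs.dim W"
      using fs.basis_exists by blast
    obtain B' where B': "B' \<subseteq> W'" "fs.independent B'" "W' \<subseteq> fs.span B'" "card B' = fs.dim W'"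
      using fs.basis_exists by blast
    have fB: "finite B" using supported_independent_finite B W(1) by (auto simp: P_def inv_subspace_def)
    have fB': "finite B'" using supported_independent_finite B' W' by (auto simp: inv_subspace_def)
    obtain w where w: "w \<in> W" "w \<notin> W'" using ne W'(2) by auto
    have "fs.span B' \<subseteq> W'" using B'(1) W'(1) fs.span_minimal by (auto simp: inv_subspace_def)
    hence wn: "w \<notin> fs.span B'" using w by auto
    hence "fs.independent (insert w B')" using B'(2) fs.independent_insertI by blast
    moreover have "insert w B' \<subseteq> fs.span B" using B(3) w B'(1) W'(2) by auto
    ultimately have "card (insert w B') \<le> card B" using fs.independent_span_bound[OF fB] by blast
    moreover have "w \<notin> B'" using wn fs.span_base by blast
    ultimately show False using le B(4) B'(4) fB' by simp
  qed
  thus ?thesis using that W(1) by (auto simp: P_def)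
qed

definition mcoef :: "('a \<Rightarrow> complex mat) \<Rightarrow> nat \<Rightarrow> nat \<Rightarrow> 'a \<Rightarrow> complex" where
  "mcoef \<rho> i j = (\<lambda>g. if g \<in> carrier G then \<rho> g $$ (i,j) else 0)"

definition coef_span :: "('a \<Rightarrow> complex) set" where
  "coef_span = fs.span (\<Union>(d,\<rho>)\<in>irreps G. {mcoef \<rho> i j |i j. i < d \<and> j < d})"

lemma rep_carrier: "is_rep G d \<rho> \<Longrightarrow> g \<in> carrier G \<Longrightarrow> \<rho> g \<in> carrier_mat d d"
  by (simp add: is_rep_def)

lemma rep_mult_entry:
  assumes "is_rep G d \<rho>" "g \<in> carrier G" "h \<in> carrier G" "i < d" "j < d"
  shows "\<rho> (g \<otimes> h) $$ (i,j) = (\<Sum>k<d. \<rho> g $$ (i,k) * \<rho> h $$ (k,j))"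
proof -
  have "\<rho> (g \<otimes> h) = \<rho> g * \<rho> h" using assms by (simp add: is_rep_def)
  moreover have "\<rho> g \<in> carrier_mat d d" "\<rho> h \<in> carrier_mat d d" using assms rep_carrier by auto
  ultimately show ?thesis using index_mult_mat_sum[of "\<rho> g" d d "\<rho> h" d i j] assms(4,5) by (simp only:)
qed

text \<open>In a basis \<open>b\<close> of \<open>W\<close> translations become matrices
  \<open>\<rho> g\<close>, irreducible because \<open>W\<close> is minimal. Evaluating the translate
  of \<open>b j\<close> by \<open>g\<close> at the identity expresses \<open>b j g\<close> through
  the entries of column \<open>j\<close> of \<open>\<rho> g\<close>.\<close>

lemma minimal_inv_subspace_in_coef_span:
  assumes W: "inv_subspace W" "W \<noteq> {0}"
    and min: "\<And>W'. inv_subspace W' \<Longrightarrow> W' \<subseteq> W \<Longrightarrow> W' \<noteq> {0} \<Longrightarrow> W' = W"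
  shows "W \<subseteq> coef_span"
proof -
  have Wsub: "fs.subspace W" and Wsup: "W \<subseteq> supported"
    and Winv: "\<And>g f. g \<in> carrier G \<Longrightarrow> f \<in> W \<Longrightarrow> rtrans g f \<in> W"
    using W(1) unfolding inv_subspace_def by blast+
  obtain B where B: "B \<subseteq> W" "fs.independent B" "W \<subseteq> fs.span B"
    by (rule fs.maximal_independent_subset)
  have fB: "finite B" by (rule supported_independent_finite[OF _ B(2)]) (use B(1) Wsup in blast)
  define d where "d = card B"
  obtain b where b: "bij_betw b {..<d} B"
    using ex_bij_betw_nat_finite[OF fB] by (auto simp: d_def atLeast0LessThan)
  have bW: "b i \<in> W" if "i < d" for i using b B(1) that by (auto simp: bij_betw_def)
  define T where "T c = (\<lambda>x. \<Sum>i<d. c i * b i x)" for c :: "nat \<Rightarrow> complex"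
  have T_sum: "T c = (\<Sum>i<d. (\<lambda>x. c i * b i x))" for c by (simp add: T_def sum_fun_eq)
  have TW: "T c \<in> W" for c
    unfolding T_sum by (intro fs.subspace_sum[OF Wsub] fs.subspace_scale[OF Wsub] bW) simp
  have Tex: "\<exists>c. f = T c" if "f \<in> W" for f
  proof -
    have "f \<in> fs.span B" using B(3) that by auto
    then obtain u where u: "f = (\<Sum>v\<in>B. (\<lambda>x. u v * v x))" using fs.span_finite[OF fB] by auto
    also have "\<dots> = (\<Sum>i<d. (\<lambda>x. u (b i) * b i x))"
      using sum.reindex_bij_betw[OF b, of "\<lambda>v. (\<lambda>x. u v * v x)"] by simp
    finally show ?thesis unfolding T_sum by (rule exI[of _ "\<lambda>i. u (b i)"])
  qed
  have T0: "c i = 0" if "T c = 0" "i < d" for c i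
  proof -
    define u where "u v = c (the_inv_into {..<d} b v)" for v
    have ub: "u (b i) = c i" if "i < d" for i
      using the_inv_into_f_f[of b "{..<d}"] b that by (auto simp: u_def bij_betw_def)
    have "(\<Sum>v\<in>B. (\<lambda>x. u v * v x)) = (\<Sum>i<d. (\<lambda>x. u (b i) * b i x))"
      using sum.reindex_bij_betw[OF b, of "\<lambda>v. (\<lambda>x. u v * v x)"] by simp
    also have "\<dots> = T c" unfolding T_sum by (rule sum.cong) (auto simp: ub)
    also have "\<dots> = 0" by (rule that)
    finally have "u (b i) = 0"
      using fs.independentD[OF B(2) fB, of u "b i"] b that(2) by (auto simp: bij_betw_def)
    thus ?thesis using ub that(2) by simp
  qed
  have Tuniq: "c i = c' i" if "T c = T c'" "i < d" for c c' i
  proof -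
    have "T (\<lambda>i. c i - c' i) = 0"
      using that(1) by (auto simp: T_def fun_eq_iff algebra_simps sum_subtractf)
    from T0[OF this that(2)] show ?thesis by simp
  qed
  define C where "C f = (SOME c. f = T c)" for f
  have C: "T (C f) = f" if "f \<in> W" for f
    using someI_ex[OF Tex[OF that]] by (simp add: C_def)
  define \<rho> where "\<rho> g = mat d d (\<lambda>(i,j). C (rtrans g (b j)) i)" for g
  have rb: "rtrans g (b j) = T (\<lambda>i. \<rho> g $$ (i,j))" if "g \<in> carrier G" "j < d" for g j
  proof -
    have "rtrans g (b j) = T (C (rtrans g (b j)))" using C[OF Winv[OF that(1) bW[OF that(2)]]] by simp
    also have "\<dots> = T (\<lambda>i. \<rho> g $$ (i,j))" unfolding T_def using that(2) by (auto simp: \<rho>_def)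
    finally show ?thesis .
  qed
  have rT: "rtrans g (T c) = T (\<lambda>i. \<Sum>j<d. \<rho> g $$ (i,j) * c j)" if g: "g \<in> carrier G" for g c
  proof -
    have "rtrans g (T c) = (\<lambda>x. \<Sum>j<d. c j * rtrans g (b j) x)" unfolding T_def by (rule rtrans_sum)
    also have "\<dots> = (\<lambda>x. \<Sum>j<d. c j * (\<Sum>i<d. \<rho> g $$ (i,j) * b i x))"
      using rb[OF g] by (auto simp: T_def intro!: sum.cong)
    also have "\<dots> = (\<lambda>x. \<Sum>i<d. (\<Sum>j<d. \<rho> g $$ (i,j) * c j) * b i x)"
      by (rule ext, simp only: sum_distrib_left sum_distrib_right, subst sum.swap, simp add: mult_ac)
    finally show ?thesis by (simp add: T_def)
  qed
  have b_T: "b j = T (\<lambda>i. if i = j then 1 else 0)" if "j < d" for j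
    using that by (auto simp: T_def fun_eq_iff if_distrib[of "\<lambda>x. x * _"] cong: if_cong)
  have \<rho>c: "\<rho> g \<in> carrier_mat d d" for g by (simp add: \<rho>_def)
  have rep: "is_rep G d \<rho>"
    unfolding is_rep_def
  proof (intro conjI ballI)
    show "\<rho> \<one> = 1\<^sub>m d"
    proof (rule eq_matI)
      fix i j assume "i < dim_row (1\<^sub>m d :: complex mat)" "j < dim_col (1\<^sub>m d :: complex mat)"
      hence ij: "i < d" "j < d" by auto
      have "T (\<lambda>i. \<rho> \<one> $$ (i,j)) = rtrans \<one> (b j)" using rb[OF one_closed ij(2)] by simp
      also have "\<dots> = b j" using rtrans_one bW[OF ij(2)] Wsup by blast
      also have "\<dots> = T (\<lambda>i. if i = j then 1 else 0)" by (rule b_T[OF ij(2)])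
      finally show "\<rho> \<one> $$ (i,j) = 1\<^sub>m d $$ (i,j)" 
        using Tuniq[OF _ ij(1), of "\<lambda>i. \<rho> \<one> $$ (i,j)" "\<lambda>i. if i = j then 1 else 0"] ij by simp
    qed (use \<rho>c[of \<one>] in auto)
  next
    fix g h assume gh: "g \<in> carrier G" "h \<in> carrier G"
    show "\<rho> (g \<otimes> h) = \<rho> g * \<rho> h"
    proof (rule eq_matI)
      fix i j assume "i < dim_row (\<rho> g * \<rho> h)" "j < dim_col (\<rho> g * \<rho> h)"
      hence ij: "i < d" "j < d" using \<rho>c[of g] \<rho>c[of h] by auto
      have "T (\<lambda>i. \<rho> (g \<otimes> h) $$ (i,j)) = rtrans (g \<otimes> h) (b j)" using rb[of "g \<otimes> h" j] gh ij by simp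
      also have "\<dots> = rtrans g (T (\<lambda>i. \<rho> h $$ (i,j)))" using rtrans_mult[OF gh] rb[OF gh(2) ij(2)] by simp
      also have "\<dots> = T (\<lambda>i. \<Sum>k<d. \<rho> g $$ (i,k) * \<rho> h $$ (k,j))" by (rule rT[OF gh(1)])
      finally show "\<rho> (g \<otimes> h) $$ (i,j) = (\<rho> g * \<rho> h) $$ (i,j)"
        using Tuniq[OF _ ij(1)] index_mult_mat_sum[OF \<rho>c[of g] \<rho>c[of h] ij] by simp
    qed (use \<rho>c[of "g \<otimes> h"] \<rho>c[of g] \<rho>c[of h] in auto)
  qed (rule \<rho>c)
  have d0: "d > 0"
  proof (rule ccontr)
    assume "\<not> d > 0"
    hence "B = {}" using fB by (simp add: d_def)
    hence "W \<subseteq> {0}" using B(3) by simp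
    thus False using W(2) fs.subspace_0[OF Wsub] by auto
  qed
  have "is_irrep G d \<rho>"
    unfolding is_irrep_def
  proof (intro conjI rep d0 allI impI)
    fix V assume V: "is_subspace d V \<and> (\<forall>g\<in>carrier G. \<forall>w\<in>V. \<rho> g *\<^sub>v w \<in> V)"
    hence Vc: "V \<subseteq> carrier_vec d" "0\<^sub>v d \<in> V" "\<And>v w. v \<in> V \<Longrightarrow> w \<in> V \<Longrightarrow> v + w \<in> V"
      "\<And>c v. v \<in> V \<Longrightarrow> c \<cdot>\<^sub>v v \<in> V" by (auto simp: is_subspace_def)
    \<comment> \<open>The coordinate map carries an invariant space of column vectors to an
      invariant subspace of \<open>W\<close>, where minimality applies.\<close>
    define T' where "T' v = T (\<lambda>i. v $ i)" for v
    have sub: "fs.subspace (T' ` V)"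
    proof (rule fs.subspaceI)
      have "T' (0\<^sub>v d) = 0" by (auto simp: T'_def T_def)
      thus "0 \<in> T' ` V" using Vc(2) by (metis image_eqI)
    next
      fix f g assume "f \<in> T' ` V" "g \<in> T' ` V"
      then obtain v w where vw: "v \<in> V" "w \<in> V" "f = T' v" "g = T' w" by auto
      have vwc: "v \<in> carrier_vec d" "w \<in> carrier_vec d" using vw Vc(1) by auto
      have "f + g = T' (v + w)" unfolding vw using vwc
        by (auto simp: T'_def T_def fun_eq_iff sum.distrib[symmetric] algebra_simps)
      thus "f + g \<in> T' ` V" using Vc(3)[OF vw(1,2)] by auto
    next
      fix c f assume "f \<in> T' ` V"
      then obtain v where v: "v \<in> V" "f = T' v" by auto
      have vc: "v \<in> carrier_vec d" using v Vc(1) by auto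
      have "(\<lambda>x. c * f x) = T' (c \<cdot>\<^sub>v v)" unfolding v using vc
        by (auto simp: T'_def T_def fun_eq_iff sum_distrib_left algebra_simps)
      thus "(\<lambda>x. c * f x) \<in> T' ` V" using Vc(4)[OF v(1)] by auto
    qed
    have inv: "inv_subspace (T' ` V)"
      unfolding inv_subspace_def
    proof (intro conjI sub ballI)
      show "T' ` V \<subseteq> supported" using TW Wsup by (auto simp: T'_def)
      fix g f assume g: "g \<in> carrier G" and "f \<in> T' ` V"
      then obtain v where v: "v \<in> V" "f = T' v" by auto
      have vc: "v \<in> carrier_vec d" using v Vc(1) by auto
      have "rtrans g f = T (\<lambda>i. \<Sum>j<d. \<rho> g $$ (i,j) * v $ j)" unfolding v T'_def by (rule rT[OF g])
      also have "\<dots> = T' (\<rho> g *\<^sub>v v)" unfolding T'_def T_def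
        using index_mult_mat_vec_sum[OF \<rho>c[of g] vc] by (intro ext sum.cong) simp_all
      finally show "rtrans g f \<in> T' ` V" using V g v(1) by auto
    qed
    have subW: "T' ` V \<subseteq> W" using TW by (auto simp: T'_def)
    show "V = {0\<^sub>v d} \<or> V = carrier_vec d"
    proof (cases "T' ` V = {0}")
      case True
      have "v = 0\<^sub>v d" if "v \<in> V" for v
      proof (rule eq_vecI)
        fix i assume "i < dim_vec (0\<^sub>v d :: complex vec)"
        hence i: "i < d" by simp
        have "T' v = 0" using True that by auto
        hence "T (\<lambda>i. v $ i) = 0" by (simp add: T'_def)
        from T0[OF this i] show "v $ i = 0\<^sub>v d $ i" using i by simp
      next
        show "dim_vec v = dim_vec (0\<^sub>v d :: complex vec)" using that Vc(1) by auto
      qed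
      hence "V = {0\<^sub>v d}" using Vc(2) by blast
      thus ?thesis ..
    next
      case False
      hence eq: "T' ` V = W" by (intro min inv subW)
      have "v \<in> V" if v: "v \<in> carrier_vec d" for v
      proof -
        have "T' v \<in> T' ` V" unfolding eq using TW by (simp add: T'_def)
        then obtain w where w: "w \<in> V" "T' v = T' w" by auto
        have "v = w"
        proof (rule eq_vecI)
          show "dim_vec v = dim_vec w" using v w Vc(1) by auto
          fix i assume "i < dim_vec w"
          hence "i < d" using w Vc(1) by auto
          thus "v $ i = w $ i" using Tuniq[OF w(2)[unfolded T'_def]] by simp
        qed
        thus ?thesis using w by simp
      qed
      thus ?thesis using Vc(1) by auto
    qed
  qed
  hence irr: "(d,\<rho>) \<in> irreps G" by (simp add: irreps_def)
  have "b j \<in> coef_span" if j: "j < d" for j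
  proof -
    have "b j g = (\<Sum>i<d. b i \<one> * mcoef \<rho> i j g)" for g
    proof (cases "g \<in> carrier G")
      case True
      have "b j g = rtrans g (b j) \<one>" using True by (simp add: rtrans_def)
      also have "\<dots> = (\<Sum>i<d. b i \<one> * mcoef \<rho> i j g)"
        unfolding rb[OF True j] T_def using True by (auto simp: mcoef_def mult_ac)
      finally show ?thesis .
    next
      case False
      thus ?thesis using bW[OF j] Wsup by (auto simp: mcoef_def supported_def)
    qed
    hence "b j = (\<Sum>i<d. (\<lambda>g. b i \<one> * mcoef \<rho> i j g))" by (auto simp: sum_fun_eq)
    also have "\<dots> \<in> coef_span" unfolding coef_span_def
      using irr j by (intro fs.span_sum fs.span_scale fs.span_base) blast
    finally show ?thesis .
  qed
  hence "B \<subseteq> coef_span" using b by (auto simp: bij_betw_def)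
  hence "fs.span B \<subseteq> coef_span" unfolding coef_span_def
    by (rule fs.span_minimal) (rule fs.subspace_span)
  thus ?thesis using B(3) by auto
qed

text \<open>By multiplicativity a translated coefficient is a combination of coefficients in the
  same row of the same representation. This makes the orthogonal complement invariant as
  well.\<close>

lemma coef_span_rtrans:
  assumes h: "h \<in> carrier G" and s: "s \<in> coef_span"
  shows "rtrans h s \<in> coef_span"
proof -
  let ?M = "\<Union>(d,\<rho>)\<in>irreps G. {mcoef \<rho> i j |i j. i < d \<and> j < d}"
  have sub: "fs.subspace {s. rtrans h s \<in> coef_span}"
  proof (rule fs.subspaceI)
    have "rtrans h 0 = 0" by (auto simp: rtrans_def)
    thus "0 \<in> {s. rtrans h s \<in> coef_span}" by (simp add: coef_span_def fs.span_zero)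
  next
    fix x y assume "x \<in> {s. rtrans h s \<in> coef_span}" "y \<in> {s. rtrans h s \<in> coef_span}"
    thus "x + y \<in> {s. rtrans h s \<in> coef_span}" by (simp add: rtrans_add coef_span_def fs.span_add)
  next
    fix c x assume "x \<in> {s. rtrans h s \<in> coef_span}"
    thus "(\<lambda>y. c * x y) \<in> {s. rtrans h s \<in> coef_span}"
      by (simp add: rtrans_scale coef_span_def fs.span_scale)
  qed
  have "?M \<subseteq> {s. rtrans h s \<in> coef_span}"
  proof
    fix s assume "s \<in> ?M"
    then obtain d \<rho> i j where \<rho>: "(d,\<rho>) \<in> irreps G" and ij: "i < d" "j < d" and s: "s = mcoef \<rho> i j"
      by auto
    have rep: "is_rep G d \<rho>" using \<rho> by (simp add: irreps_def is_irrep_def)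
    have "rtrans h s = (\<Sum>k<d. (\<lambda>x. \<rho> h $$ (k,j) * mcoef \<rho> i k x))"
      unfolding s sum_fun_eq
      using rep_mult_entry[OF rep _ h ij] h by (auto simp: rtrans_def mcoef_def mult_ac)
    also have "\<dots> \<in> coef_span" unfolding coef_span_def
      by (intro fs.span_sum fs.span_scale fs.span_base) (use \<rho> ij in blast)
    finally show "s \<in> {s. rtrans h s \<in> coef_span}" by simp
  qed
  hence "fs.span ?M \<subseteq> {s. rtrans h s \<in> coef_span}" using fs.span_minimal sub by blast
  thus ?thesis using s by (auto simp: coef_span_def)
qed

lemma coef_span_supported: "coef_span \<subseteq> supported"
proof -
  have "fs.subspace supported" by (rule fs.subspaceI) (auto simp: supported_def)
  thus ?thesis unfolding coef_span_def
    by (intro fs.span_minimal) (auto simp: supported_def mcoef_def)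
qed

text \<open>The orthogonal complement of \<open>coef_span\<close> is translation invariant.  A minimal nonzero invariant
  subspace of it would be irreducible, hence consist of matrix coefficients.\<close>

lemma supported_subset_coef_span: "supported \<subseteq> coef_span"
proof (rule ccontr)
  assume "\<not> supported \<subseteq> coef_span"
  then obtain v where v: "v \<in> supported" "v \<notin> coef_span" by auto
  have sc: "fs.subspace coef_span" by (simp add: coef_span_def fs.subspace_span)
  obtain B where B: "B \<subseteq> coef_span" "fs.independent B" "coef_span \<subseteq> fs.span B"
    by (rule fs.maximal_independent_subset)
  have "finite B" using supported_independent_finite[OF _ B(2)] B(1) coef_span_supported by auto
  from orthogonal_projection_exists[OF this fin, of v]
  obtain u where u: "u \<in> fs.span B" "\<And>b. b \<in> fs.span B \<Longrightarrow> (\<Sum>x\<in>carrier G. (v x - u x) * cnj (b x)) = 0"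
    by blast
  have uc: "u \<in> coef_span" using u(1) fs.span_minimal[OF B(1) sc] by auto
  define U where "U = {f\<in>supported. \<forall>s\<in>coef_span. (\<Sum>x\<in>carrier G. f x * cnj (s x)) = 0}"
  have "v - u \<in> U"
    using v uc u(2) B(3) coef_span_supported by (auto simp: U_def supported_def)
  moreover have "v - u \<noteq> 0" using v uc by auto
  ultimately have U0: "U \<noteq> {0}" by auto
  have "inv_subspace U"
    unfolding inv_subspace_def
  proof (intro conjI ballI)
    show "fs.subspace U"
      by (rule fs.subspaceI)
         (auto simp: U_def supported_def algebra_simps sum.distrib sum_distrib_left[symmetric])
    show "U \<subseteq> supported" by (auto simp: U_def)
    fix g f assume g: "g \<in> carrier G" and f: "f \<in> U"
    show "rtrans g f \<in> U"
      unfolding U_def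
    proof (intro CollectI conjI ballI)
      show "rtrans g f \<in> supported" by (simp add: supported_def rtrans_def)
      fix s assume s: "s \<in> coef_span"
      \<comment> \<open>Translation is unitary, with adjoint the translation by
        \<open>inv g\<close>, which preserves \<open>coef_span\<close>.\<close>
      have "(\<Sum>x\<in>carrier G. rtrans g f x * cnj (s x))
          = (\<Sum>x\<in>carrier G. f (x \<otimes> g) * cnj (rtrans (inv g) s (x \<otimes> g)))"
        using g by (intro sum.cong) (auto simp: rtrans_def m_assoc)
      also have "\<dots> = (\<Sum>x\<in>carrier G. f x * cnj (rtrans (inv g) s x))"
        by (rule sum_translate_right[OF g])
      also have "\<dots> = 0" using f coef_span_rtrans[OF _ s, of "inv g"] g by (auto simp: U_def)
      finally show "(\<Sum>x\<in>carrier G. rtrans g f x * cnj (s x)) = 0" .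
    qed
  qed
  from minimal_inv_subspace[OF this U0] obtain W where W: "inv_subspace W" "W \<subseteq> U" "W \<noteq> {0}"
    "\<And>W'. inv_subspace W' \<Longrightarrow> W' \<subseteq> W \<Longrightarrow> W' \<noteq> {0} \<Longrightarrow> W' = W" by metis
  have "W \<subseteq> coef_span" using minimal_inv_subspace_in_coef_span W by metis
  moreover obtain w where w: "w \<in> W" "w \<noteq> 0"
    using W(1,3) fs.subspace_0 by (auto simp: inv_subspace_def)
  ultimately have "(\<Sum>x\<in>carrier G. w x * cnj (w x)) = 0" using W(2) by (auto simp: U_def)
  moreover have "(\<Sum>x\<in>carrier G. w x * cnj (w x)) = of_real (\<Sum>x\<in>carrier G. (cmod (w x))\<^sup>2)"
    unfolding of_real_sum by (intro sum.cong refl) (simp only: complex_norm_square)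
  ultimately have "(\<Sum>x\<in>carrier G. (cmod (w x))\<^sup>2) = 0" by (simp del: of_real_sum)
  hence "\<forall>x\<in>carrier G. w x = 0" using fin by (simp add: sum_nonneg_eq_0_iff)
  moreover have "\<forall>x. x \<notin> carrier G \<longrightarrow> w x = 0" using w W(2) by (auto simp: U_def supported_def)
  ultimately show False using w(2) by (auto simp: fun_eq_iff)
qed

section \<open>Isomorphism classes, Schur's lemma and bounds for the degree sum\<close>

abbreviation "iso_rel \<equiv> rep_iso G \<inter> (irreps G \<times> irreps G)"

lemma invertible_matE:
  fixes P :: "complex mat"
  assumes "invertible_mat P" "P \<in> carrier_mat d d"
  obtains Q where "Q \<in> carrier_mat d d" "P * Q = 1\<^sub>m d" "Q * P = 1\<^sub>m d"
proof -
  obtain Q where Q: "P * Q = 1\<^sub>m (dim_row P)" "Q * P = 1\<^sub>m (dim_row Q)"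
    using assms by (auto simp: invertible_mat_def inverts_mat_def)
  have "dim_col Q = d" using arg_cong[OF Q(1), of dim_col] assms(2) by simp
  moreover have "dim_row Q = d" using arg_cong[OF Q(2), of dim_col] assms(2) by simp
  ultimately show ?thesis using that[of Q] Q assms(2) by auto
qed

lemma invertible_matI:
  fixes P :: "complex mat"
  assumes "P \<in> carrier_mat d d" "Q \<in> carrier_mat d d" "P * Q = 1\<^sub>m d" "Q * P = 1\<^sub>m d"
  shows "invertible_mat P"
  using assms by (auto simp: invertible_mat_def inverts_mat_def intro!: exI[of _ Q])

lemma rep_iso_iff:
  "((d,\<rho>),(d',\<sigma>)) \<in> rep_iso G \<longleftrightarrow> d = d' \<and> (\<exists>P\<in>carrier_mat d d. \<exists>Q\<in>carrier_mat d d.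
    P * Q = 1\<^sub>m d \<and> Q * P = 1\<^sub>m d \<and> (\<forall>g\<in>carrier G. P * \<rho> g = \<sigma> g * P))"
  unfolding rep_iso_def using invertible_matE invertible_matI by (simp, metis)

lemma equiv_iso_rel: "equiv (irreps G) iso_rel"
proof (rule equivI)
  show "iso_rel \<subseteq> irreps G \<times> irreps G" by auto
  have rep: "is_rep G d \<rho>" if "(d,\<rho>) \<in> irreps G" for d \<rho>
    using that by (simp add: irreps_def is_irrep_def)
  show "refl_on (irreps G) iso_rel"
  proof (rule refl_onI)
    fix x assume x: "x \<in> irreps G"
    obtain d \<rho> where dx: "x = (d,\<rho>)" by (cases x)
    have "1\<^sub>m d * \<rho> g = \<rho> g * 1\<^sub>m d" if "g \<in> carrier G" for g
      using rep_carrier[OF rep, of d \<rho> g] x dx that by simp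
    hence "(x,x) \<in> rep_iso G" unfolding dx rep_iso_iff by (auto intro!: bexI[of _ "1\<^sub>m d"])
    thus "(x,x) \<in> iso_rel" using x by simp
  qed
  show "sym iso_rel"
  proof (rule symI)
    fix x y assume xy: "(x,y) \<in> iso_rel"
    obtain d \<rho> d' \<sigma> where dx: "x = (d,\<rho>)" "y = (d',\<sigma>)" by (cases x, cases y)
    from xy obtain P Q where d: "d' = d" and P: "P \<in> carrier_mat d d" "Q \<in> carrier_mat d d" "P * Q = 1\<^sub>m d"
      "Q * P = 1\<^sub>m d" "\<And>g. g \<in> carrier G \<Longrightarrow> P * \<rho> g = \<sigma> g * P" by (auto simp: rep_iso_iff dx)
    have "Q * \<sigma> g = \<rho> g * Q" if g: "g \<in> carrier G" for g
    proof -
      have c: "\<rho> g \<in> carrier_mat d d" "\<sigma> g \<in> carrier_mat d d"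
        using xy g rep_carrier[OF rep] by (auto simp: dx d)
      have "Q * \<sigma> g = Q * (\<sigma> g * P) * Q" using c P(1-3) by (simp add: assoc_mult_mat[of _ d d _ d _ d])
      also have "\<dots> = Q * (P * \<rho> g) * Q" using P(5)[OF g] by simp
      also have "\<dots> = \<rho> g * Q" using c P(1,2,4) by (simp add: assoc_mult_mat[symmetric, of _ d d _ d _ d])
      finally show ?thesis .
    qed
    hence "(y,x) \<in> rep_iso G" unfolding dx d rep_iso_iff using P(1-4) by blast
    thus "(y,x) \<in> iso_rel" using xy by auto
  qed
  show "trans iso_rel"
  proof (rule transI)
    fix x y z assume xy: "(x,y) \<in> iso_rel" and yz: "(y,z) \<in> iso_rel"
    obtain d \<rho> d' \<sigma> d'' \<tau> where dx: "x = (d,\<rho>)" "y = (d',\<sigma>)" "z = (d'',\<tau>)" by (cases x, cases y, cases z)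
    from xy obtain P Q where d: "d' = d" and P: "P \<in> carrier_mat d d" "Q \<in> carrier_mat d d" "P * Q = 1\<^sub>m d"
      "Q * P = 1\<^sub>m d" "\<And>g. g \<in> carrier G \<Longrightarrow> P * \<rho> g = \<sigma> g * P" by (auto simp: rep_iso_iff dx)
    from yz obtain R S where d': "d'' = d" and R: "R \<in> carrier_mat d d" "S \<in> carrier_mat d d" "R * S = 1\<^sub>m d"
      "S * R = 1\<^sub>m d" "\<And>g. g \<in> carrier G \<Longrightarrow> R * \<sigma> g = \<tau> g * R" by (auto simp: rep_iso_iff dx d)
    note assoc = assoc_mult_mat[of _ d d _ d _ d]
    have "R * P * \<rho> g = \<tau> g * (R * P)" if g: "g \<in> carrier G" for g
    proof -
      have c: "\<rho> g \<in> carrier_mat d d" "\<sigma> g \<in> carrier_mat d d" "\<tau> g \<in> carrier_mat d d"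
        using xy yz g rep_carrier[OF rep] by (auto simp: dx d d')
      have "R * P * \<rho> g = R * (P * \<rho> g)" using c P(1) R(1) by (simp add: assoc)
      also have "\<dots> = R * \<sigma> g * P" using c P(1) R(1) P(5)[OF g] by (simp add: assoc)
      also have "\<dots> = \<tau> g * (R * P)" using c P(1) R(1) R(5)[OF g] by (simp add: assoc)
      finally show ?thesis .
    qed
    moreover have "R * P * (Q * S) = 1\<^sub>m d"
    proof -
      have "R * P * (Q * S) = R * (P * Q) * S" using P(1,2) R(1,2) by (simp add: assoc)
      thus ?thesis using P R by simp
    qed
    moreover have "Q * S * (R * P) = 1\<^sub>m d"
    proof -
      have "Q * S * (R * P) = Q * (S * R) * P" using P(1,2) R(1,2) by (simp add: assoc)
      thus ?thesis using P R by simp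
    qed
    moreover have "R * P \<in> carrier_mat d d" "Q * S \<in> carrier_mat d d" using P R by auto
    ultimately have "(x,z) \<in> rep_iso G" unfolding dx d d' rep_iso_iff by blast
    thus "(x,z) \<in> iso_rel" using xy yz by auto
  qed
qed

text \<open>Schur's lemma: kernel and range of an intertwiner are invariant, so for a nonzero one
  the kernel is zero and the range is everything.\<close>

lemma intertwiner_invertible:
  assumes \<rho>: "is_irrep G d \<rho>" and \<sigma>: "is_irrep G d' \<sigma>"
    and P: "P \<in> carrier_mat d' d" "\<And>g. g \<in> carrier G \<Longrightarrow> P * \<rho> g = \<sigma> g * P"
    and P0: "P \<noteq> 0\<^sub>m d' d"
  shows "d = d' \<and> invertible_mat P"
proof -
  have rc: "\<And>g. g \<in> carrier G \<Longrightarrow> \<rho> g \<in> carrier_mat d d" "\<And>g. g \<in> carrier G \<Longrightarrow> \<sigma> g \<in> carrier_mat d' d'"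
    using \<rho> \<sigma> by (auto simp: is_irrep_def is_rep_def)
  define K where "K = {v \<in> carrier_vec d. P *\<^sub>v v = 0\<^sub>v d'}"
  have "is_subspace d K"
    unfolding is_subspace_def K_def using P(1)
    by (auto simp: mult_add_distrib_mat_vec[OF P(1)] mult_mat_vec[OF P(1)])
  moreover have "\<rho> g *\<^sub>v v \<in> K" if "g \<in> carrier G" "v \<in> K" for g v
  proof -
    have v: "v \<in> carrier_vec d" "P *\<^sub>v v = 0\<^sub>v d'" using that by (auto simp: K_def)
    have "P *\<^sub>v (\<rho> g *\<^sub>v v) = (\<sigma> g * P) *\<^sub>v v"
      using P(2)[OF that(1)] assoc_mult_mat_vec[OF P(1) rc(1)[OF that(1)] v(1)] by simp
    also have "\<dots> = \<sigma> g *\<^sub>v (P *\<^sub>v v)"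
      by (rule assoc_mult_mat_vec[OF rc(2)[OF that(1)] P(1) v(1)])
    finally have "P *\<^sub>v (\<rho> g *\<^sub>v v) = 0\<^sub>v d'" using v(2) mult_mat_zero_vec[OF rc(2)[OF that(1)]] by simp
    thus ?thesis using mult_mat_vec_carrier[OF rc(1)[OF that(1)] v(1)] by (simp add: K_def)
  qed
  ultimately have "K = {0\<^sub>v d} \<or> K = carrier_vec d" using \<rho> by (auto simp: is_irrep_def)
  moreover have "K \<noteq> carrier_vec d"
  proof
    assume K: "K = carrier_vec d"
    have "P = 0\<^sub>m d' d"
    proof (rule eq_matI)
      fix i j assume "i < dim_row (0\<^sub>m d' d :: complex mat)" "j < dim_col (0\<^sub>m d' d :: complex mat)"
      hence ij: "i < d'" "j < d" by auto
      have "unit_vec d j \<in> K" using K by simp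
      hence "(P *\<^sub>v unit_vec d j) $ i = 0" using ij by (simp add: K_def)
      thus "P $$ (i,j) = 0\<^sub>m d' d $$ (i,j)" using ij P(1) by simp
    qed (use P(1) in auto)
    thus False using P0 by simp
  qed
  ultimately have K0: "K = {0\<^sub>v d}" by blast
  define J where "J = (\<lambda>v. P *\<^sub>v v) ` carrier_vec d"
  have "is_subspace d' J"
    unfolding is_subspace_def
  proof (intro conjI ballI allI)
    show "J \<subseteq> carrier_vec d'" using P(1) by (auto simp: J_def)
    show "0\<^sub>v d' \<in> J" unfolding J_def by (rule image_eqI[of _ _ "0\<^sub>v d"]) (use P(1) in auto)
  next
    fix v w assume "v \<in> J" "w \<in> J"
    then obtain a b where "a \<in> carrier_vec d" "b \<in> carrier_vec d" "v = P *\<^sub>v a" "w = P *\<^sub>v b"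
      by (auto simp: J_def)
    thus "v + w \<in> J" unfolding J_def
      by (intro image_eqI[of _ _ "a + b"]) (auto simp: mult_add_distrib_mat_vec[OF P(1)])
  next
    fix c v assume "v \<in> J"
    then obtain a where "a \<in> carrier_vec d" "v = P *\<^sub>v a" by (auto simp: J_def)
    thus "c \<cdot>\<^sub>v v \<in> J" unfolding J_def
      by (intro image_eqI[of _ _ "c \<cdot>\<^sub>v a"]) (auto simp: mult_mat_vec[OF P(1)])
  qed
  moreover have "\<sigma> g *\<^sub>v w \<in> J" if gw: "g \<in> carrier G" "w \<in> J" for g w
  proof -
    obtain a where a: "a \<in> carrier_vec d" "w = P *\<^sub>v a" using gw(2) unfolding J_def by blast
    have "\<sigma> g *\<^sub>v w = P *\<^sub>v (\<rho> g *\<^sub>v a)"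
      unfolding a(2) using assoc_mult_mat_vec[OF rc(2)[OF gw(1)] P(1) a(1)]
        assoc_mult_mat_vec[OF P(1) rc(1)[OF gw(1)] a(1)] P(2)[OF gw(1)] by simp
    moreover have "\<rho> g *\<^sub>v a \<in> carrier_vec d" using rc(1)[OF gw(1)] a(1) by simp
    ultimately show ?thesis unfolding J_def by blast
  qed
  ultimately have "J = {0\<^sub>v d'} \<or> J = carrier_vec d'" using \<sigma> by (auto simp: is_irrep_def)
  moreover have "J \<noteq> {0\<^sub>v d'}"
  proof
    assume "J = {0\<^sub>v d'}"
    hence "K = carrier_vec d" by (auto simp: J_def K_def)
    thus False using \<open>K \<noteq> carrier_vec d\<close> by simp
  qed
  ultimately have J: "J = carrier_vec d'" by blast
  have "\<exists>a. a \<in> carrier_vec d \<and> P *\<^sub>v a = unit_vec d' j" if "j < d'" for j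
  proof -
    have "unit_vec d' j \<in> J" using J by simp
    thus ?thesis by (auto simp: J_def)
  qed
  then obtain q where q: "\<And>j. j < d' \<Longrightarrow> q j \<in> carrier_vec d \<and> P *\<^sub>v q j = unit_vec d' j" by metis
  define Q where "Q = mat d d' (\<lambda>(i,j). q j $ i)"
  have Qc: "Q \<in> carrier_mat d d'" by (simp add: Q_def)
  have PQ: "P * Q = 1\<^sub>m d'"
  proof (rule eq_matI)
    fix i j assume "i < dim_row (1\<^sub>m d' :: complex mat)" "j < dim_col (1\<^sub>m d' :: complex mat)"
    hence ij: "i < d'" "j < d'" by auto
    have "(P * Q) $$ (i,j) = (P *\<^sub>v q j) $ i"
      using index_mult_mat_sum[OF P(1) Qc ij] index_mult_mat_vec_sum[OF P(1) _ ij(1), of "q j"] q[OF ij(2)] ij(2)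
      by (simp add: Q_def)
    also have "\<dots> = 1\<^sub>m d' $$ (i,j)" using q[OF ij(2)] ij by simp
    finally show "(P * Q) $$ (i,j) = 1\<^sub>m d' $$ (i,j)" .
  qed (use P(1) Qc in auto)
  have QP: "Q * P = 1\<^sub>m d"
  proof (rule eq_matI)
    fix i j assume "i < dim_row (1\<^sub>m d :: complex mat)" "j < dim_col (1\<^sub>m d :: complex mat)"
    hence ij: "i < d" "j < d" by auto
    \<comment> \<open>So far \<open>Q\<close> is a right inverse only. \<open>P\<close> annihilates
      the defect \<open>w\<close>, and its kernel is zero.\<close>
    define w where "w = (Q * P) *\<^sub>v unit_vec d j - unit_vec d j"
    have QPc: "Q * P \<in> carrier_mat d d" using Qc P(1) by simp
    have "P *\<^sub>v ((Q * P) *\<^sub>v unit_vec d j) = (P * Q) *\<^sub>v (P *\<^sub>v unit_vec d j)"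
      using Qc P(1) by (simp add: assoc_mult_mat_vec[of _ d' d _ d'] assoc_mult_mat_vec[of _ d d' _ d])
    also have "\<dots> = P *\<^sub>v unit_vec d j" unfolding PQ using P(1) by simp
    finally have "P *\<^sub>v w = 0\<^sub>v d'" unfolding w_def using QPc P(1)
      by (simp add: mult_minus_distrib_mat_vec[OF P(1)])
    moreover have "w \<in> carrier_vec d" using QPc by (simp add: w_def)
    ultimately have "w = 0\<^sub>v d" using K0 by (auto simp: K_def)
    hence "w $ i = 0" using ij by simp
    hence "((Q * P) *\<^sub>v unit_vec d j) $ i = unit_vec d j $ i" using ij QPc by (simp add: w_def)
    moreover have "((Q * P) *\<^sub>v unit_vec d j) $ i = (Q * P) $$ (i,j)"
      using carrier_matD[OF QPc] ij by (simp del: index_mult_mat assoc_mult_mat_vec)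
    ultimately show "(Q * P) $$ (i,j) = 1\<^sub>m d $$ (i,j)" using ij by simp
  qed (use P(1) Qc in auto)
  \<comment> \<open>The dimensions agree because \<open>P * Q\<close> and \<open>Q * P\<close> have
    the same trace.\<close>
  have "(of_nat d' :: complex) = (\<Sum>i<d'. (P * Q) $$ (i,i))" using PQ by simp
  also have "\<dots> = (\<Sum>i<d'. \<Sum>k<d. P $$ (i,k) * Q $$ (k,i))"
    using index_mult_mat_sum[OF P(1) Qc] by simp
  also have "\<dots> = (\<Sum>k<d. \<Sum>i<d'. Q $$ (k,i) * P $$ (i,k))"
    by (subst sum.swap) (simp add: mult_ac)
  also have "\<dots> = (\<Sum>i<d. (Q * P) $$ (i,i))" using index_mult_mat_sum[OF Qc P(1)] by simp
  also have "\<dots> = of_nat d" using QP by simp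
  finally have "d = d'" by simp
  thus ?thesis using invertible_matI[of P d Q] P(1) Qc PQ QP by auto
qed

text \<open>For fixed \<open>j\<close> and \<open>k\<close>, summing \<open>\<sigma> g\<close> times
  the matrix unit at (j,k) times \<open>\<rho> (inv g)\<close> over the group gives an intertwiner,
  which Schur's lemma forces to vanish. The claim reads off one entry.\<close>

lemma schur_orthogonality:
  assumes \<rho>: "(d,\<rho>) \<in> irreps G" and \<sigma>: "(d',\<sigma>) \<in> irreps G"
    and niso: "((d,\<rho>),(d',\<sigma>)) \<notin> rep_iso G"
    and ijkl: "i < d'" "j < d'" "k < d" "l < d"
  shows "(\<Sum>g\<in>carrier G. \<sigma> g $$ (i,j) * \<rho> (inv g) $$ (k,l)) = 0"
proof -
  have irr: "is_irrep G d \<rho>" "is_irrep G d' \<sigma>" using \<rho> \<sigma> by (auto simp: irreps_def)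
  hence rep: "is_rep G d \<rho>" "is_rep G d' \<sigma>" by (auto simp: is_irrep_def)
  define P where "P = mat d' d (\<lambda>(i,l). \<Sum>g\<in>carrier G. \<sigma> g $$ (i,j) * \<rho> (inv g) $$ (k,l))"
  have Pc: "P \<in> carrier_mat d' d" by (simp add: P_def)
  have "P * \<rho> h = \<sigma> h * P" if h: "h \<in> carrier G" for h
  proof (rule eq_matI)
    have rc: "\<rho> h \<in> carrier_mat d d" "\<sigma> h \<in> carrier_mat d' d'" using rep h rep_carrier by auto
    fix a b assume "a < dim_row (\<sigma> h * P)" "b < dim_col (\<sigma> h * P)"
    hence ab: "a < d'" "b < d" using rc Pc by auto
    have "(P * \<rho> h) $$ (a,b) = (\<Sum>s<d. (\<Sum>g\<in>carrier G. \<sigma> g $$ (a,j) * \<rho> (inv g) $$ (k,s)) * \<rho> h $$ (s,b))"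
      using index_mult_mat_sum[OF Pc rc(1) ab] ab by (simp add: P_def)
    also have "\<dots> = (\<Sum>g\<in>carrier G. \<sigma> g $$ (a,j) * (\<Sum>s<d. \<rho> (inv g) $$ (k,s) * \<rho> h $$ (s,b)))"
      unfolding sum_distrib_left sum_distrib_right by (subst sum.swap) (simp add: mult_ac)
    also have "\<dots> = (\<Sum>g\<in>carrier G. \<sigma> g $$ (a,j) * \<rho> (inv g \<otimes> h) $$ (k,b))"
      using rep_mult_entry[OF rep(1) _ h ijkl(3) ab(2)] by (intro sum.cong) auto
    also have "\<dots> = (\<Sum>g\<in>carrier G. \<sigma> (h \<otimes> g) $$ (a,j) * \<rho> (inv (h \<otimes> g) \<otimes> h) $$ (k,b))"
      by (rule sum_translate_left[OF h, symmetric])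
    also have "\<dots> = (\<Sum>g\<in>carrier G. \<sigma> (h \<otimes> g) $$ (a,j) * \<rho> (inv g) $$ (k,b))"
      using h by (intro sum.cong) (auto simp: inv_mult_group m_assoc)
    also have "\<dots> = (\<Sum>g\<in>carrier G. (\<Sum>s<d'. \<sigma> h $$ (a,s) * \<sigma> g $$ (s,j)) * \<rho> (inv g) $$ (k,b))"
      using rep_mult_entry[OF rep(2) h _ ab(1) ijkl(2)] by (intro sum.cong) auto
    also have "\<dots> = (\<Sum>s<d'. \<sigma> h $$ (a,s) * (\<Sum>g\<in>carrier G. \<sigma> g $$ (s,j) * \<rho> (inv g) $$ (k,b)))"
      unfolding sum_distrib_left sum_distrib_right by (subst sum.swap) (simp add: mult_ac)
    also have "\<dots> = (\<sigma> h * P) $$ (a,b)"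
      using index_mult_mat_sum[OF rc(2) Pc ab] ab by (simp add: P_def)
    finally show "(P * \<rho> h) $$ (a,b) = (\<sigma> h * P) $$ (a,b)" .
  qed (use Pc rep h rep_carrier in auto)
  moreover have "P = 0\<^sub>m d' d"
  proof (rule ccontr)
    assume "P \<noteq> 0\<^sub>m d' d"
    with intertwiner_invertible[OF irr Pc] calculation have "d = d'" "invertible_mat P" by auto
    thus False using niso calculation Pc by (auto simp: rep_iso_def)
  qed
  hence "P $$ (i,l) = 0" using ijkl by simp
  thus ?thesis using ijkl by (simp add: P_def)
qed


lemma is_subspace_irrep_zero:
  assumes "is_irrep G d \<rho>" "is_subspace d W" "\<And>g w. g \<in> carrier G \<Longrightarrow> w \<in> W \<Longrightarrow> \<rho> g *\<^sub>v w \<in> W"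
    "v \<in> carrier_vec d" "v \<notin> W"
  shows "W = {0\<^sub>v d}"
  using assms by (auto simp: is_irrep_def)

text \<open>The entries of row 0 of \<open>\<rho>\<close> are linearly independent functions on the
  group: a relation is a vector \<open>v\<close> for which entry 0 of
  \<open>\<rho> g *\<^sub>v v\<close> vanishes for all \<open>g\<close>, and such vectors form a
  proper invariant subspace.\<close>

lemma irrep_dim_le:
  assumes "(d,\<rho>) \<in> irreps G"
  shows "d \<le> n"
proof -
  have irr: "is_irrep G d \<rho>" using assms by (simp add: irreps_def)
  hence rep: "is_rep G d \<rho>" and d0: "d > 0" by (auto simp: is_irrep_def)
  note rc = rep_carrier[OF rep]
  define W where "W = {v \<in> carrier_vec d. \<forall>g\<in>carrier G. (\<rho> g *\<^sub>v v) $ 0 = 0}"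
  have W0: "W = {0\<^sub>v d}"
  proof (rule is_subspace_irrep_zero[OF irr])
    show "is_subspace d W"
      unfolding is_subspace_def W_def using d0 rc carrier_matD[OF rc]
      by (auto simp: scalar_prod_add_distrib[of _ d] mult_add_distrib_mat_vec[OF rc] mult_mat_vec[OF rc] mult_mat_zero_vec[OF rc])
    show "unit_vec d 0 \<in> carrier_vec d" by simp
    have "\<rho> \<one> = 1\<^sub>m d" using rep by (simp add: is_rep_def)
    thus "unit_vec d 0 \<notin> W" using d0 by (auto simp: W_def intro!: bexI[of _ \<one>])
    fix h v assume h: "h \<in> carrier G" and v: "v \<in> W"
    hence vc: "v \<in> carrier_vec d" by (simp add: W_def)
    have "\<rho> g *\<^sub>v (\<rho> h *\<^sub>v v) = \<rho> (g \<otimes> h) *\<^sub>v v" if "g \<in> carrier G" for g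
    proof -
      have "\<rho> (g \<otimes> h) = \<rho> g * \<rho> h" using rep that h by (simp add: is_rep_def)
      thus ?thesis using assoc_mult_mat_vec[OF rc[OF that] rc[OF h] vc] by simp
    qed
    thus "\<rho> h *\<^sub>v v \<in> W" using v h rc[OF h] vc by (auto simp: W_def)
  qed
  have "finite {..<d} \<and> card {..<d} \<le> n"
  proof (rule independent_family_card[of "carrier G" "{..<d}" "mcoef \<rho> 0"])
    fix J and c :: "nat \<Rightarrow> complex"
    assume J: "finite J" "J \<subseteq> {..<d}" "\<And>x. (\<Sum>i\<in>J. c i * mcoef \<rho> 0 i x) = 0"
    define v where "v = vec d (\<lambda>i. if i \<in> J then c i else 0)"
    have vc: "v \<in> carrier_vec d" by (simp add: v_def)
    have "(\<rho> g *\<^sub>v v) $ 0 = 0" if g: "g \<in> carrier G" for g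
    proof -
      have "(\<rho> g *\<^sub>v v) $ 0 = (\<Sum>k<d. \<rho> g $$ (0,k) * v $ k)"
        by (rule index_mult_mat_vec_sum[OF rc[OF g] vc d0])
      also have "\<dots> = (\<Sum>k\<in>J. c k * mcoef \<rho> 0 k g)"
        using J(2) g by (intro sum.mono_neutral_cong_right) (auto simp: v_def mcoef_def)
      finally show ?thesis using J(3) by simp
    qed
    hence "v \<in> W" using vc by (simp add: W_def)
    hence "v = 0\<^sub>v d" using W0 by simp
    show "\<forall>i\<in>J. c i = 0"
    proof
      fix i assume i: "i \<in> J"
      hence "i < d" using J(2) by auto
      thus "c i = 0" using i arg_cong[OF \<open>v = 0\<^sub>v d\<close>, of "\<lambda>v. v $ i"] by (simp add: v_def)
    qed
  qed (auto simp: fin mcoef_def)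
  thus ?thesis by simp
qed

abbreviation "irrep_classes \<equiv> irreps G // iso_rel"

definition class_rep :: "(nat \<times> ('a \<Rightarrow> complex mat)) set \<Rightarrow> nat \<times> ('a \<Rightarrow> complex mat)" where
  "class_rep C = (SOME p. p \<in> C)"

lemma class_rep_in: "C \<in> irrep_classes \<Longrightarrow> class_rep C \<in> C"
  using in_quotient_imp_non_empty[OF equiv_iso_rel] some_in_eq unfolding class_rep_def by blast

lemma class_rep_irreps: "C \<in> irrep_classes \<Longrightarrow> class_rep C \<in> irreps G"
  using class_rep_in in_quotient_imp_subset[OF equiv_iso_rel] by blast

text \<open>A suitable matrix coefficient is chosen from each class; by Schur orthogonality these are linearly
  independent.\<close>

lemma irrep_classes_finite: "finite irrep_classes \<and> card irrep_classes \<le> n"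
proof -
  define dd \<rho> where "dd C = fst (class_rep C)" and "\<rho> C = snd (class_rep C)" for C
  have irr: "(dd C, \<rho> C) \<in> irreps G" if "C \<in> irrep_classes" for C
    using class_rep_irreps[OF that] by (simp add: dd_def \<rho>_def)
  \<comment> \<open>Summed over \<open>j\<close> these expressions give \<open>n\<close> times an
    entry 1 of the identity matrix, so one of them is nonzero. This is the suitable
    coefficient.\<close>
  have ex: "\<exists>j<dd C. (\<Sum>g\<in>carrier G. \<rho> C g $$ (0,j) * \<rho> C (inv g) $$ (j,0)) \<noteq> 0"
    if C: "C \<in> irrep_classes" for C
  proof (rule ccontr)
    assume "\<not> ?thesis"
    hence z: "\<And>j. j < dd C \<Longrightarrow> (\<Sum>g\<in>carrier G. \<rho> C g $$ (0,j) * \<rho> C (inv g) $$ (j,0)) = 0" by auto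
    have rep: "is_rep G (dd C) (\<rho> C)" and d0: "dd C > 0"
      using irr[OF C] by (auto simp: irreps_def is_irrep_def)
    have "0 = (\<Sum>j<dd C. \<Sum>g\<in>carrier G. \<rho> C g $$ (0,j) * \<rho> C (inv g) $$ (j,0))"
      using z by simp
    also have "\<dots> = (\<Sum>g\<in>carrier G. \<Sum>j<dd C. \<rho> C g $$ (0,j) * \<rho> C (inv g) $$ (j,0))"
      by (rule sum.swap)
    also have "\<dots> = (\<Sum>g\<in>carrier G. \<rho> C (g \<otimes> inv g) $$ (0,0))"
      by (intro sum.cong refl rep_mult_entry[OF rep _ _ d0 d0, symmetric]) auto
    also have "\<dots> = (\<Sum>g\<in>carrier G. 1)"
      using rep d0 by (intro sum.cong) (auto simp: is_rep_def)
    finally show False using n_pos by simp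
  qed
  define j where "j C = (SOME j. j < dd C \<and> (\<Sum>g\<in>carrier G. \<rho> C g $$ (0,j) * \<rho> C (inv g) $$ (j,0)) \<noteq> 0)" for C
  have j: "j C < dd C" "(\<Sum>g\<in>carrier G. \<rho> C g $$ (0,j C) * \<rho> C (inv g) $$ (j C,0)) \<noteq> 0"
    if "C \<in> irrep_classes" for C
    using someI_ex[OF ex[OF that]] unfolding j_def by blast+
  show ?thesis
  proof (rule independent_family_card[of "carrier G" _ "\<lambda>C. mcoef (\<rho> C) 0 (j C)"])
    fix J and c :: "(nat \<times> ('a \<Rightarrow> complex mat)) set \<Rightarrow> complex"
    assume J: "finite J" "J \<subseteq> irrep_classes" "\<And>x. (\<Sum>C\<in>J. c C * mcoef (\<rho> C) 0 (j C) x) = 0"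
    show "\<forall>C\<in>J. c C = 0"
    proof
      fix C assume C: "C \<in> J"
      hence CQ: "C \<in> irrep_classes" using J by auto
      have orth: "(\<Sum>g\<in>carrier G. \<rho> D g $$ (0,j D) * \<rho> C (inv g) $$ (j C,0)) = 0"
        if D: "D \<in> irrep_classes" "D \<noteq> C" for D
      proof (rule schur_orthogonality[OF irr[OF CQ] irr[OF D(1)]])
        have "(class_rep C, class_rep D) \<notin> iso_rel"
          using quotient_eq_iff[OF equiv_iso_rel CQ D(1) class_rep_in[OF CQ] class_rep_in[OF D(1)]] D(2) by blast
        thus "((dd C, \<rho> C), dd D, \<rho> D) \<notin> rep_iso G"
          using irr[OF CQ] irr[OF D(1)] by (simp add: dd_def \<rho>_def)
        show "j D < dd D" "j C < dd C" "0 < dd D" "0 < dd C" using j(1)[OF D(1)] j(1)[OF CQ] by auto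
      qed
      have "0 = (\<Sum>g\<in>carrier G. (\<Sum>D\<in>J. c D * mcoef (\<rho> D) 0 (j D) g) * \<rho> C (inv g) $$ (j C,0))"
        using J(3) by simp
      also have "\<dots> = (\<Sum>g\<in>carrier G. \<Sum>D\<in>J. c D * (\<rho> D g $$ (0,j D) * \<rho> C (inv g) $$ (j C,0)))"
        by (intro sum.cong refl) (simp add: sum_distrib_right mcoef_def mult.assoc)
      also have "\<dots> = (\<Sum>D\<in>J. c D * (\<Sum>g\<in>carrier G. \<rho> D g $$ (0,j D) * \<rho> C (inv g) $$ (j C,0)))"
        by (subst sum.swap) (simp add: sum_distrib_left)
      also have "\<dots> = (\<Sum>D\<in>{C}. c D * (\<Sum>g\<in>carrier G. \<rho> D g $$ (0,j D) * \<rho> C (inv g) $$ (j C,0)))"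
        by (rule sum.mono_neutral_right) (use J C orth in auto)
      finally show "c C = 0" using j(2)[OF CQ] by simp
    qed
  qed (auto simp: fin mcoef_def)
qed

lemma Dsum_class_rep: "Dsum G = (\<Sum>C\<in>irrep_classes. fst (class_rep C))"
  by (simp add: Dsum_def class_rep_def)

lemma Dsum_le: "Dsum G \<le> n\<^sup>2"
proof -
  have "Dsum G \<le> (\<Sum>C\<in>irrep_classes. n)"
    unfolding Dsum_class_rep
  proof (rule sum_mono)
    fix C assume "C \<in> irrep_classes"
    thus "fst (class_rep C) \<le> n"
      using irrep_dim_le[of "fst (class_rep C)" "snd (class_rep C)"] class_rep_irreps by simp
  qed
  also have "\<dots> = card irrep_classes * n" by simp
  also have "\<dots> \<le> n * n" using irrep_classes_finite by (intro mult_right_mono) auto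
  finally show ?thesis by (simp add: power2_eq_square)
qed

text \<open>By completeness the coefficients of the class representatives span all functions on the
  group, so \<open>n\<close> is at most the sum of the squared degrees, hence at most the square of
  their sum.\<close>

lemma Dsum_ge: "n \<le> (Dsum G)\<^sup>2"
proof -
  define dd \<rho> where "dd C = fst (class_rep C)" and "\<rho> C = snd (class_rep C)" for C
  have irr: "(dd C, \<rho> C) \<in> irreps G" if "C \<in> irrep_classes" for C
    using class_rep_irreps[OF that] by (simp add: dd_def \<rho>_def)
  have fc: "finite irrep_classes" using irrep_classes_finite by simp
  define I where "I = Sigma irrep_classes (\<lambda>C. {..<dd C} \<times> {..<dd C})"
  define T where "T = (\<lambda>(C,i,j). mcoef (\<rho> C) i j) ` I"
  have fI: "finite I" using fc by (auto simp: I_def)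
  have sub: "coef_span \<subseteq> fs.span T"
    unfolding coef_span_def
  proof (rule fs.span_minimal)
    show "(\<Union>(d,\<rho>)\<in>irreps G. {mcoef \<rho> i j |i j. i < d \<and> j < d}) \<subseteq> fs.span T"
    proof
      fix f assume "f \<in> (\<Union>(d,\<rho>)\<in>irreps G. {mcoef \<rho> i j |i j. i < d \<and> j < d})"
      then obtain d \<sigma> i j where \<sigma>: "(d,\<sigma>) \<in> irreps G" and ij: "i < d" "j < d" and f: "f = mcoef \<sigma> i j" by auto
      define C where "C = iso_rel `` {(d,\<sigma>)}"
      have CQ: "C \<in> irrep_classes" using \<sigma> by (auto simp: C_def intro: quotientI)
      have "((d,\<sigma>), class_rep C) \<in> iso_rel" using class_rep_in[OF CQ] by (simp add: C_def)
      hence "((d,\<sigma>), (dd C, \<rho> C)) \<in> rep_iso G" by (simp add: dd_def \<rho>_def)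
      then obtain P Q where d: "dd C = d" and P: "P \<in> carrier_mat d d"
        "\<And>g. g \<in> carrier G \<Longrightarrow> P * \<sigma> g = \<rho> C g * P"
        and Q: "Q \<in> carrier_mat d d" "P * Q = 1\<^sub>m d" "Q * P = 1\<^sub>m d"
        unfolding rep_iso_iff by blast
      have reps: "is_rep G d \<sigma>" "is_rep G d (\<rho> C)"
        using \<sigma> irr[OF CQ] d by (auto simp: irreps_def is_irrep_def)
      \<comment> \<open>Conjugation by \<open>P\<close>, with inverse \<open>Q\<close>, writes an
        entry of \<open>\<sigma>\<close> through the entries of the class representative.\<close>
      have "f g = (\<Sum>(k,l)\<in>{..<d}\<times>{..<d}. (Q $$ (i,k) * P $$ (l,j)) * mcoef (\<rho> C) k l g)" for g
      proof (cases "g \<in> carrier G")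
        case True
        have c: "\<sigma> g \<in> carrier_mat d d" "\<rho> C g \<in> carrier_mat d d" using reps True rep_carrier by auto
        have "\<sigma> g = Q * (P * \<sigma> g)" using c(1) P(1) Q by (simp add: assoc_mult_mat[symmetric, of _ d d _ d _ d])
        also have "\<dots> = Q * (\<rho> C g * P)" using P(2)[OF True] by simp
        finally have "\<sigma> g $$ (i,j) = (\<Sum>k<d. Q $$ (i,k) * (\<rho> C g * P) $$ (k,j))"
          using index_mult_mat_sum[OF Q(1) _ ij, of "\<rho> C g * P"] c(2) P(1) by simp
        also have "\<dots> = (\<Sum>k<d. \<Sum>l<d. Q $$ (i,k) * P $$ (l,j) * \<rho> C g $$ (k,l))"
          using index_mult_mat_sum[OF c(2) P(1) _ ij(2)] by (simp add: sum_distrib_left mult_ac)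
        finally show ?thesis using True by (simp add: f mcoef_def sum.cartesian_product)
      next
        case False
        thus ?thesis by (auto simp: f mcoef_def)
      qed
      hence "f = (\<Sum>p\<in>{..<d}\<times>{..<d}. (\<lambda>g. (Q $$ (i,fst p) * P $$ (snd p,j)) * mcoef (\<rho> C) (fst p) (snd p) g))"
        by (auto simp: sum_fun_eq fun_eq_iff case_prod_unfold)
      also have "\<dots> \<in> fs.span T"
      proof (intro fs.span_sum fs.span_scale fs.span_base)
        fix p assume "p \<in> {..<d}\<times>{..<d}"
        hence "(C, fst p, snd p) \<in> I" using CQ d by (auto simp: I_def)
        thus "mcoef (\<rho> C) (fst p) (snd p) \<in> T" unfolding T_def by (rule rev_image_eqI) (simp add: case_prod_unfold)
      qed
      finally show "f \<in> fs.span T" .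
    qed
  qed (rule fs.subspace_span)
  have "n \<le> card T"
  proof (rule spanning_card)
    show "finite T" using fI by (simp add: T_def)
    fix x assume "x \<in> carrier G"
    hence "single x \<in> supported" by (auto simp: supported_def single_def)
    thus "single x \<in> fs.span T" using supported_subset_coef_span sub by blast
  qed (rule fin)
  also have "\<dots> \<le> card I" unfolding T_def by (rule card_image_le[OF fI])
  also have "\<dots> = (\<Sum>C\<in>irrep_classes. dd C * dd C)" using fc by (simp add: I_def)
  also have "\<dots> \<le> (\<Sum>C\<in>irrep_classes. dd C * (\<Sum>C\<in>irrep_classes. dd C))"
    using fc by (intro sum_mono mult_left_mono member_le_sum) auto
  also have "\<dots> = (Dsum G)\<^sup>2"
    by (simp add: Dsum_class_rep dd_def power2_eq_square sum_distrib_right)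
  finally show ?thesis .
qed

end

section \<open>Laplacians of finite complexes\<close>

text \<open>The Rayleigh quotient attains its minimum on the unit sphere of \<open>V\<close>, and a
  minimiser is an eigenvector. The existence matters because \<open>min_eig\<close> is a
  \<open>Min\<close>, which says nothing about an empty set.\<close>

lemma symmetric_operator_has_eigenvector:
  fixes V :: "('x \<Rightarrow> real) set" and T :: "('x \<Rightarrow> real) \<Rightarrow> 'x \<Rightarrow> real"
  assumes S: "finite S" and supp: "\<And>\<phi> x. \<phi> \<in> V \<Longrightarrow> x \<notin> S \<Longrightarrow> \<phi> x = 0"
    and cl: "closed V"
    and add: "\<And>\<phi> \<psi> c. \<phi> \<in> V \<Longrightarrow> \<psi> \<in> V \<Longrightarrow> (\<lambda>x. \<phi> x + c * \<psi> x) \<in> V"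
    and TV: "\<And>\<phi>. \<phi> \<in> V \<Longrightarrow> T \<phi> \<in> V"
    and lin: "\<And>\<phi> \<psi> c. \<phi> \<in> V \<Longrightarrow> \<psi> \<in> V \<Longrightarrow> T (\<lambda>x. \<phi> x + c * \<psi> x) = (\<lambda>x. T \<phi> x + c * T \<psi> x)"
    and sym: "\<And>\<phi> \<psi>. \<phi> \<in> V \<Longrightarrow> \<psi> \<in> V \<Longrightarrow> (\<Sum>x\<in>S. T \<phi> x * \<psi> x) = (\<Sum>x\<in>S. \<phi> x * T \<psi> x)"
    and cont: "\<And>x. continuous_on UNIV (\<lambda>\<phi>. T \<phi> x)"
    and ne: "\<phi>1 \<in> V" "\<phi>1 \<noteq> (\<lambda>_. 0)"
  obtains e \<phi> where "\<phi> \<in> V" "\<phi> \<noteq> (\<lambda>_. 0)" "T \<phi> = (\<lambda>x. e * \<phi> x)"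
proof -
  define ip where "ip f g = (\<Sum>x\<in>S. f x * g x)" for f g :: "'x \<Rightarrow> real"
  have ip_comm: "ip f g = ip g f" for f g by (simp add: ip_def mult.commute)
  have ip_add: "ip (\<lambda>x. f x + c * g x) h = ip f h + c * ip g h" for f g h c
    by (simp add: ip_def algebra_simps sum.distrib sum_distrib_left)
  have ip_add2: "ip h (\<lambda>x. f x + c * g x) = ip h f + c * ip h g" for f g h c
    using ip_add[of f c g h] by (simp add: ip_comm)
  have ip_pos: "ip f f \<ge> 0" for f by (simp add: ip_def sum_nonneg)
  have ip_zero: "f = (\<lambda>_. 0)" if "f \<in> V" "ip f f = 0" for f
  proof
    fix x show "f x = 0"
      using that supp[OF that(1)] S by (cases "x \<in> S") (auto simp: ip_def sum_nonneg_eq_0_iff)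
  qed
  have zeroV: "(\<lambda>_. 0) \<in> V" using add[OF ne(1) ne(1), of "-1"] by simp
  have scaleV: "(\<lambda>x. c * f x) \<in> V" if "f \<in> V" for c f using add[OF zeroV that, of c] by simp
  have T0: "T (\<lambda>_. 0) = (\<lambda>_. 0)"
    using lin[OF zeroV zeroV, of "-1"] by simp
  have T_scale: "T (\<lambda>x. c * f x) = (\<lambda>x. c * T f x)" if "f \<in> V" for c f
    using lin[OF zeroV that, of c] by (simp add: T0)
  define K where "K = {f\<in>V. ip f f = 1}"
  have cont_ip: "continuous_on UNIV (\<lambda>f. ip f f)" unfolding ip_def
    by (intro continuous_intros continuous_on_product_coordinates)
  have cont_T: "continuous_on UNIV (\<lambda>f. ip (T f) f)" unfolding ip_def
    by (intro continuous_intros cont continuous_on_product_coordinates)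
  \<comment> \<open>Functions carry the product topology. Unit vectors have values in [-1,1] on
    \<open>S\<close> and 0 elsewhere, so the sphere is a closed subset of a product of compact
    sets.\<close>
  define Box where "Box = (\<Pi>\<^sub>E x\<in>UNIV. if x \<in> S then {-1..1::real} else {0})"
  have "compactin (product_topology (\<lambda>_::'x. euclidean :: real topology) UNIV) Box"
    unfolding Box_def by (subst compactin_PiE) auto
  hence cBox: "compact Box" by (simp add: euclidean_product_topology)
  have "K \<subseteq> Box"
  proof
    fix f assume f: "f \<in> K"
    have "f x \<in> (if x \<in> S then {-1..1} else {0})" for x
    proof (cases "x \<in> S")
      case True
      have "(f x)\<^sup>2 \<le> (\<Sum>x\<in>S. (f x)\<^sup>2)" by (rule member_le_sum) (use True S in auto)
      also have "\<dots> = 1" using f by (simp add: K_def ip_def power2_eq_square)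
      finally have "\<bar>f x\<bar> \<le> 1" by (simp add: abs_square_le_1)
      thus ?thesis using True by auto
    next
      case False
      thus ?thesis using f supp by (auto simp: K_def)
    qed
    thus "f \<in> Box" by (simp add: Box_def PiE_def)
  qed
  moreover have "closed K"
  proof -
    have "K = V \<inter> {f. ip f f = 1}" by (auto simp: K_def)
    moreover have "closed {f. ip f f = 1}" by (rule closed_Collect_eq[OF cont_ip]) simp
    ultimately show ?thesis using cl by (simp add: closed_Int)
  qed
  ultimately have cK: "compact K" using compact_Int_closed[OF cBox, of K] by (simp add: Int_absorb1)
  define c1 where "c1 = ip \<phi>1 \<phi>1"
  have c1: "c1 > 0" using ip_zero[OF ne(1)] ne(2) ip_pos[of \<phi>1] by (auto simp: c1_def less_le)
  have normalise: "(\<lambda>x. f x / sqrt (ip f f)) \<in> K" if "f \<in> V" "ip f f > 0" for f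
  proof -
    have "ip (\<lambda>x. f x / sqrt (ip f f)) (\<lambda>x. f x / sqrt (ip f f)) = ip f f / ip f f"
      using that(2) unfolding ip_def[of "\<lambda>x. _ x / _"] by (simp add: sum_divide_distrib[symmetric] ip_def)
    thus ?thesis using that scaleV[OF that(1), of "1 / sqrt (ip f f)"] by (simp add: K_def)
  qed
  have "K \<noteq> {}" using normalise[OF ne(1)] c1 by (auto simp: c1_def)
  from continuous_attains_inf[OF cK this continuous_on_subset[OF cont_T subset_UNIV]]
  obtain f0 where f0: "f0 \<in> K" "\<And>f. f \<in> K \<Longrightarrow> ip (T f0) f0 \<le> ip (T f) f" by blast
  have f0V: "f0 \<in> V" and f01: "ip f0 f0 = 1" using f0 by (auto simp: K_def)
  define \<mu> where "\<mu> = ip (T f0) f0"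
  have rayleigh: "\<mu> * ip f f \<le> ip (T f) f" if f: "f \<in> V" for f
  proof (cases "ip f f = 0")
    case True
    thus ?thesis using ip_zero[OF f True] by (simp add: ip_def)
  next
    case False
    hence pos: "ip f f > 0" using ip_pos[of f] by simp
    define g where "g = (\<lambda>x. (1 / sqrt (ip f f)) * f x)"
    have "\<mu> \<le> ip (T g) g" using f0(2)[OF normalise[OF f pos]] by (simp add: \<mu>_def g_def)
    also have "ip (T g) g = (1 / sqrt (ip f f)) * (1 / sqrt (ip f f)) * ip (T f) f"
      unfolding g_def T_scale[OF f] by (simp add: ip_def sum_divide_distrib)
    also have "\<dots> = ip (T f) f / ip f f" using pos by simp
    finally show ?thesis using pos by (simp add: field_simps)
  qed
  define r where "r = (\<lambda>x. T f0 x + (- \<mu>) * f0 x)"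
  have rV: "r \<in> V" unfolding r_def by (rule add[OF TV[OF f0V] f0V])
  define R where "R = ip r r"
  define B where "B = ip (T r) r - \<mu> * R"
  have B0: "B \<ge> 0" using rayleigh[OF rV] by (simp add: B_def R_def)
  have R0: "R \<ge> 0" by (simp add: R_def ip_pos)
  have Tr: "ip (T r) f0 = ip r (T f0)" using sym[OF rV f0V] by (simp add: ip_def)
  \<comment> \<open>The Rayleigh inequality along the line from \<open>f0\<close> in the direction
    of the residual \<open>r\<close>; the linear coefficient is twice the squared norm
    \<open>R\<close> of the residual.\<close>
  have var: "0 \<le> 2 * s * R + s\<^sup>2 * B" for s
  proof -
    define h where "h = (\<lambda>x. f0 x + s * r x)"
    have hV: "h \<in> V" unfolding h_def by (rule add[OF f0V rV])
    have a: "ip (T h) h = \<mu> + 2 * s * ip r (T f0) + s\<^sup>2 * ip (T r) r"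
      unfolding h_def lin[OF f0V rV] ip_add ip_add2
      using Tr by (simp add: \<mu>_def ip_comm[of "T f0" r] power2_eq_square algebra_simps)
    have b: "ip h h = 1 + 2 * s * ip r f0 + s\<^sup>2 * R"
      unfolding h_def ip_add ip_add2
      by (simp add: f01 ip_comm[of f0 r] R_def power2_eq_square algebra_simps)
    have "ip r (T f0) = R + \<mu> * ip r f0"
    proof -
      have "R = ip r (\<lambda>x. T f0 x + (- \<mu>) * f0 x)" by (simp add: R_def r_def)
      thus ?thesis unfolding ip_add2 by simp
    qed
    hence "ip (T h) h - \<mu> * ip h h = 2 * s * R + s\<^sup>2 * B"
      unfolding a b B_def by (simp add: algebra_simps)
    thus ?thesis using rayleigh[OF hV] by simp
  qed
  have "R = 0"
  proof (rule ccontr)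
    assume "R \<noteq> 0"
    hence R: "R > 0" using R0 by simp
    \<comment> \<open>In the direction \<open>- r\<close> the best step is \<open>R / B\<close>;
      adding 1 avoids a zero denominator and still contradicts \<open>var\<close>.\<close>
    define s where "s = R / (B + 1)"
    have s: "s > 0" "s * (B + 1) = R" using R B0 by (auto simp: s_def)
    have "0 \<le> s * (s * B - 2 * R)" using var[of "- s"] by (simp add: power2_eq_square algebra_simps)
    hence "2 * R \<le> s * B" using s(1) by (simp add: zero_le_mult_iff)
    also have "\<dots> \<le> s * (B + 1)" by (rule mult_left_mono) (use s(1) in auto)
    finally show False using s R by simp
  qed
  hence "r = (\<lambda>_. 0)" using ip_zero[OF rV] by (simp add: R_def)
  hence "T f0 = (\<lambda>x. \<mu> * f0 x)" by (auto simp: r_def fun_eq_iff)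
  moreover have "f0 \<noteq> (\<lambda>_. 0)" using f01 by (auto simp: ip_def)
  ultimately show ?thesis using that f0V by blast
qed

section \<open>Skew functions on ordered simplices, coboundary and adjoint\<close>

abbreviation (input) "swap_pos \<equiv> Transposition.transpose"

abbreviation omit :: "nat \<Rightarrow> 'x list \<Rightarrow> 'x list" where
  "omit i xs \<equiv> take i xs @ drop (Suc i) xs"

lemma mset_omit: "i < length xs \<Longrightarrow> mset (xs ! i # omit i xs) = mset xs"
  by (metis append_take_drop_id Cons_nth_drop_Suc mset_append mset.simps(2) union_mset_add_mset_right)

text \<open>This lets any deleted position be treated as the head: \<open>S\<close> is closed under
  rearrangement, and moving entry \<open>i\<close> to the front is a bijection of
  \<open>S\<close>.\<close>

lemma sum_move_to_front:
  assumes len: "\<And>xs. xs \<in> S \<Longrightarrow> length xs = L"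
    and perm: "\<And>xs ys. xs \<in> S \<Longrightarrow> mset ys = mset xs \<Longrightarrow> ys \<in> S" and i: "i < L"
  shows "(\<Sum>xs\<in>S. f (xs ! i) (omit i xs)) = (\<Sum>xs\<in>S. f (hd xs) (tl xs))"
proof (rule sum.reindex_bij_witness[of _ "\<lambda>ys. take i (tl ys) @ hd ys # drop i (tl ys)" "\<lambda>xs. xs ! i # omit i xs"])
  fix xs assume xs: "xs \<in> S"
  hence l: "length xs = L" by (rule len)
  show "take i (tl (xs ! i # omit i xs)) @ hd (xs ! i # omit i xs) # drop i (tl (xs ! i # omit i xs)) = xs"
    using l i by (simp add: id_take_nth_drop[symmetric])
  show "xs ! i # omit i xs \<in> S" by (rule perm[OF xs]) (use mset_omit[of i xs] l i in simp)
next
  fix ys assume ys: "ys \<in> S"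
  hence l: "length ys = L" by (rule len)
  then obtain y zs where y: "ys = y # zs" using i by (cases ys) auto
  show "(take i (tl ys) @ hd ys # drop i (tl ys)) ! i # omit i (take i (tl ys) @ hd ys # drop i (tl ys)) = ys"
    using l i y by (simp add: nth_append min_def)
  have "mset (take i zs @ y # drop i zs) = mset (y # zs)"
    by (metis append_take_drop_id mset_append mset.simps(2) union_mset_add_mset_right)
  thus "take i (tl ys) @ hd ys # drop i (tl ys) \<in> S" using perm[OF ys] y by simp
qed simp

locale fin_complex =
  fixes X :: "'v set set"
  assumes down: "S \<in> X \<Longrightarrow> T \<subseteq> S \<Longrightarrow> T \<in> X" and fin_vertices: "finite (\<Union>X)"
begin

text \<open>All indices from here on count vertices: \<open>os N\<close> consists of the ordered (N-1)-simplices, and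
  \<open>cb N\<close> and \<open>link_sum N\<close> below map between functions on \<open>os N\<close> and on \<open>os (Suc N)\<close>.\<close>

definition os :: "nat \<Rightarrow> 'v list set" where
  "os N = ordsimp X (int N - 1)"

lemma os_iff: "xs \<in> os N \<longleftrightarrow> distinct xs \<and> length xs = N \<and> set xs \<in> X"
  by (auto simp: os_def ordsimp_def)

abbreviation (input) ip :: "nat \<Rightarrow> ('v list \<Rightarrow> real) \<Rightarrow> ('v list \<Rightarrow> real) \<Rightarrow> real" where
  "ip N f g \<equiv> \<Sum>xs\<in>os N. f xs * g xs"

lemma finite_os: "finite (os N)"
  by (rule finite_subset[OF _ finite_lists_length_eq[OF fin_vertices, of N]]) (auto simp: os_iff)

lemma os_mset: "xs \<in> os N \<Longrightarrow> mset ys = mset xs \<Longrightarrow> ys \<in> os N"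
  by (metis os_iff mset_eq_setD mset_eq_length mset_eq_imp_distinct_iff)

lemma os_omit: "xs \<in> os (Suc N) \<Longrightarrow> i < Suc N \<Longrightarrow> omit i xs \<in> os N"
proof -
  assume xs: "xs \<in> os (Suc N)" and i: "i < Suc N"
  have "xs ! i # omit i xs \<in> os (Suc N)"
    by (rule os_mset[OF xs mset_omit]) (use xs i in \<open>simp add: os_iff\<close>)
  thus ?thesis using down by (auto simp: os_iff)
qed

lemma os_tl: "v # zs \<in> os (Suc N) \<Longrightarrow> zs \<in> os N"
  using down by (auto simp: os_iff)

text \<open>Adjacent transpositions generate all permutations, and on lists they are plain patterns.
  This is the working form of membership in \<open>cochains\<close>.\<close>

definition skew :: "nat \<Rightarrow> ('v list \<Rightarrow> real) \<Rightarrow> bool" where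
  "skew N \<phi> \<longleftrightarrow> (\<forall>xs. xs \<notin> os N \<longrightarrow> \<phi> xs = 0) \<and>
     (\<forall>as x y bs. as @ x # y # bs \<in> os N \<longrightarrow> \<phi> (as @ y # x # bs) = - \<phi> (as @ x # y # bs))"

lemma permute_list_adjacent:
  "permute_list (swap_pos (length as) (Suc (length as))) (as @ x # y # bs) = as @ y # x # bs"
proof (rule nth_equalityI)
  let ?t = "swap_pos (length as) (Suc (length as))"
  fix i assume "i < length (permute_list ?t (as @ x # y # bs))"
  hence i: "i < length (as @ x # y # bs)" by simp
  hence *: "permute_list ?t (as @ x # y # bs) ! i = (as @ x # y # bs) ! ?t i"
    by (intro permute_list_nth permutes_swap_id) auto
  consider "i < length as" | "i = length as" | "i = Suc (length as)" | j where "i = length as + Suc (Suc j)"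
    by (metis Suc_lessI add_Suc_right less_iff_Suc_add linorder_neqE_nat)
  thus "permute_list ?t (as @ x # y # bs) ! i = (as @ y # x # bs) ! i"
    unfolding * by cases (auto simp: nth_append Transposition.transpose_def)
qed simp

lemma adjacent_decomp: "Suc i < length xs \<Longrightarrow> xs = take i xs @ xs ! i # xs ! Suc i # drop (Suc (Suc i)) xs"
  by (metis Cons_nth_drop_Suc Suc_lessD append_take_drop_id)

lemma permute_os:
  assumes "xs \<in> os N" "p permutes {..<N}"
  shows "permute_list p xs \<in> os N"
  using assms os_mset[OF assms(1)] mset_permute_list[of p xs] by (simp add: os_iff)

lemma skew_imp_cochain:
  assumes "skew N \<phi>"
  shows "\<phi> \<in> cochains X (int N - 1)"
proof -
  define P where "P p \<longleftrightarrow> (\<forall>xs\<in>os N. \<phi> (permute_list p xs) = of_int (sign p) * \<phi> xs)" for p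
  have comp: "P (f \<circ> g)" if "P f" "P g" "f permutes {..<N}" "g permutes {..<N}" for f g
    unfolding P_def
  proof
    fix xs assume xs: "xs \<in> os N"
    hence "permute_list (f \<circ> g) xs = permute_list g (permute_list f xs)"
      using that(4) by (intro permute_list_compose) (simp add: os_iff)
    moreover have "sign (f \<circ> g) = sign f * sign g"
      using that by (intro sign_compose permutes_imp_permutation[of "{..<N}"]) auto
    ultimately show "\<phi> (permute_list (f \<circ> g) xs) = of_int (sign (f \<circ> g)) * \<phi> xs"
      using that(1,2) xs permute_os[OF xs that(3)] by (simp add: P_def mult_ac)
  qed
  have adj: "P (swap_pos i (Suc i))" if "Suc i < N" for i
    unfolding P_def
  proof
    fix xs assume xs: "xs \<in> os N"
    hence l: "Suc i < length xs" using that by (simp add: os_iff)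
    define as where "as = take i xs"
    have la: "length as = i" using l by (simp add: as_def)
    obtain x y bs where d: "xs = as @ x # y # bs" using adjacent_decomp[OF l] by (metis as_def)
    have "permute_list (swap_pos i (Suc i)) xs = as @ y # x # bs"
      unfolding d la[symmetric] by (rule permute_list_adjacent)
    thus "\<phi> (permute_list (swap_pos i (Suc i)) xs)
        = of_int (sign (swap_pos i (Suc i))) * \<phi> xs"
      using assms xs d by (simp add: skew_def sign_swap_id)
  qed
  have tr: "P (swap_pos a b)" if "a < b" "b < N" for a b
    using that
  proof (induction b)
    case (Suc b)
    show ?case
    proof (cases "a = b")
      case True
      thus ?thesis using adj Suc.prems by simp
    next
      case False
      hence ab: "a < b" using Suc.prems by simp
      let ?t = "swap_pos b (Suc b)"
      have pt: "?t permutes {..<N}" "swap_pos a b permutes {..<N}"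
        using Suc.prems ab by (auto intro!: permutes_swap_id)
      \<comment> \<open>A longer transposition is a shorter one conjugated by an adjacent
        one.\<close>
      have "swap_pos a (Suc b) = ?t \<circ> (swap_pos a b \<circ> ?t)"
        using ab by (auto simp: fun_eq_iff Transposition.transpose_def)
      moreover have "P (?t \<circ> (swap_pos a b \<circ> ?t))"
        using Suc ab pt by (intro comp adj permutes_compose) auto
      ultimately show ?thesis by (simp only:)
    qed
  qed simp
  have "P p" if "p permutes {..<N}" for p
    using that
  proof (rule permutes_induct)
    show "P id" by (simp add: P_def)
    fix a b p assume ab: "a \<in> {..<N}" "b \<in> {..<N}" "a \<noteq> b" "P p" "p permutes {..<N}"
    have "P (swap_pos a b)"
      using ab tr[of a b] tr[of b a] by (cases "a < b") (auto simp: transpose_commute)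
    thus "P (swap_pos a b \<circ> p)" using ab by (intro comp permutes_swap_id) auto
  qed simp
  thus ?thesis using assms by (auto simp: cochains_def P_def skew_def os_def[symmetric] os_iff)
qed

lemma cochain_imp_skew:
  assumes "\<phi> \<in> cochains X (int N - 1)"
  shows "skew N \<phi>"
  unfolding skew_def
proof (intro conjI allI impI)
  fix xs assume "xs \<notin> os N"
  thus "\<phi> xs = 0" using assms by (simp add: cochains_def os_def)
next
  fix as x y bs assume xs: "as @ x # y # bs \<in> os N"
  let ?t = "swap_pos (length as) (Suc (length as))"
  have "?t permutes {..<length (as @ x # y # bs)}" by (rule permutes_swap_id) auto
  hence "\<phi> (permute_list ?t (as @ x # y # bs)) = of_int (sign ?t) * \<phi> (as @ x # y # bs)"
    using assms xs by (simp add: cochains_def os_def)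
  thus "\<phi> (as @ y # x # bs) = - \<phi> (as @ x # y # bs)"
    unfolding permute_list_adjacent by (simp add: sign_swap_id)
qed

lemma skew_iff_cochain: "skew N \<phi> \<longleftrightarrow> \<phi> \<in> cochains X (int N - 1)"
  using skew_imp_cochain cochain_imp_skew by blast

lemma skew_move_to_front:
  assumes s: "skew N \<phi>" and xs: "as @ x # bs \<in> os N"
  shows "\<phi> (as @ x # bs) = (-1) ^ length as * \<phi> (x # as @ bs)"
  using xs
proof (induction as arbitrary: bs rule: rev_induct)
  case (snoc z as)
  have 1: "as @ x # z # bs \<in> os N" by (rule os_mset[OF snoc.prems]) simp
  have "\<phi> (as @ z # x # bs) = - \<phi> (as @ x # z # bs)"
    using s 1 by (simp add: skew_def)
  thus ?case using snoc.IH[OF 1] by simp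
qed simp

lemma skew_nth_to_front:
  assumes s: "skew N \<phi>" and xs: "xs \<in> os N" and i: "i < N"
  shows "\<phi> xs = (-1) ^ i * \<phi> (xs ! i # omit i xs)"
proof -
  have "length xs = N" using xs by (simp add: os_iff)
  hence d: "xs = take i xs @ xs ! i # drop (Suc i) xs" "length (take i xs) = i" using i by (auto simp: id_take_nth_drop)
  show ?thesis using skew_move_to_front[OF s, of "take i xs" "xs ! i" "drop (Suc i) xs"] d xs by simp
qed

definition cb :: "nat \<Rightarrow> ('v list \<Rightarrow> real) \<Rightarrow> 'v list \<Rightarrow> real" where
  "cb N \<phi> = (\<lambda>xs. if xs \<in> os (Suc N) then \<Sum>i<Suc N. (-1) ^ i * \<phi> (omit i xs) else 0)"

lemma cobound_eq_cb: "cobound X (int N - 1) \<phi> = cb N \<phi>"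
proof
  fix xs
  have "ordsimp X (int N - 1 + 1) = os (Suc N)" by (simp add: os_def)
  thus "cobound X (int N - 1) \<phi> xs = cb N \<phi> xs"
    by (auto simp: cobound_def cb_def os_iff simp del: sum.lessThan_Suc)
qed

definition link :: "'v list \<Rightarrow> 'v set" where
  "link zs = {v. v # zs \<in> os (Suc (length zs))}"

lemma link_os: "zs \<in> os N \<Longrightarrow> v \<in> link zs \<longleftrightarrow> v # zs \<in> os (Suc N)"
  by (simp add: link_def os_iff)

lemma link_mset:
  assumes "mset ys = mset zs"
  shows "link ys = link zs"
proof -
  have "v # ys \<in> os N \<longleftrightarrow> v # zs \<in> os N" for v N
    using os_mset[of "v # ys" N "v # zs"] os_mset[of "v # zs" N "v # ys"] assms by auto
  thus ?thesis using mset_eq_length[OF assms] by (simp add: link_def)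
qed

lemma finite_link: "finite (link zs)"
  by (rule finite_subset[OF _ fin_vertices]) (auto simp: link_def os_iff)

definition link_sum :: "nat \<Rightarrow> ('v list \<Rightarrow> real) \<Rightarrow> 'v list \<Rightarrow> real" where
  "link_sum N \<psi> = (\<lambda>zs. if zs \<in> os N then \<Sum>v\<in>link zs. \<psi> (v # zs) else 0)"

lemma sum_os_Suc:
  fixes f :: "'v \<Rightarrow> 'v list \<Rightarrow> 'c::comm_monoid_add"
  shows "(\<Sum>xs\<in>os (Suc N). f (hd xs) (tl xs)) = (\<Sum>zs\<in>os N. \<Sum>v\<in>link zs. f v zs)"
proof -
  have "(\<Sum>zs\<in>os N. \<Sum>v\<in>link zs. f v zs) = (\<Sum>(zs,v)\<in>Sigma (os N) link. f v zs)"
    by (rule sum.Sigma) (auto simp: finite_os finite_link)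
  also have "\<dots> = (\<Sum>xs\<in>os (Suc N). f (hd xs) (tl xs))"
  proof (rule sum.reindex_bij_witness[of _ "\<lambda>xs. (tl xs, hd xs)" "\<lambda>(zs,v). v # zs"])
    fix xs assume xs: "xs \<in> os (Suc N)"
    then obtain v zs where v: "xs = v # zs" by (cases xs) (auto simp: os_iff)
    hence "zs \<in> os N" using os_tl xs by blast
    thus "(tl xs, hd xs) \<in> Sigma (os N) link" using xs v by (simp add: link_os)
    show "(case (tl xs, hd xs) of (zs,v) \<Rightarrow> v # zs) = xs" using v by simp
  qed (auto simp: link_os)
  finally show ?thesis ..
qed

text \<open>Exchanging two neighbouring entries interchanges the two faces that omit one of them,
  which carry opposite signs in the coboundary, and changes the sign of \<open>\<phi>\<close> on
  every other face.\<close>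

lemma skew_cb:
  assumes s: "skew N \<phi>"
  shows "skew (Suc N) (cb N \<phi>)"
  unfolding skew_def
proof (intro conjI allI impI)
  fix xs assume "xs \<notin> os (Suc N)"
  thus "cb N \<phi> xs = 0" by (simp add: cb_def)
next
  fix as x y bs assume xs: "as @ x # y # bs \<in> os (Suc N)"
  define a where "a = length as"
  define xs ys where "xs = as @ x # y # bs" and "ys = as @ y # x # bs"
  have xsos: "xs \<in> os (Suc N)" using xs by (simp add: xs_def)
  have ysos: "ys \<in> os (Suc N)" by (rule os_mset[OF xsos]) (simp add: xs_def ys_def)
  have aN: "Suc a < Suc N" using xsos by (auto simp: os_iff xs_def a_def)
  let ?t = "swap_pos a (Suc a)"
  have tp: "?t permutes {..<Suc N}" using aN by (intro permutes_swap_id) auto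
  have tm: "(-1) ^ ?t i * \<phi> (omit (?t i) ys) = - ((-1) ^ i * \<phi> (omit i xs))" if i: "i < Suc N" for i
  proof -
    consider "i < a" | "i = a" | "i = Suc a" | "i > Suc a" by linarith
    thus ?thesis
    proof cases
      case 1
      have ti: "?t i = i" using 1 by (simp add: Transposition.transpose_def)
      have r: "omit i xs = omit i as @ x # y # bs" "omit i ys = omit i as @ y # x # bs"
        using 1 by (auto simp: xs_def ys_def a_def)
      have "omit i as @ x # y # bs \<in> os N" using os_omit[OF xsos i] r by simp
      hence "\<phi> (omit i as @ y # x # bs) = - \<phi> (omit i as @ x # y # bs)"
        using s unfolding skew_def by blast
      thus ?thesis unfolding ti r by simp
    next
      case 2
      thus ?thesis by (simp add: xs_def ys_def a_def Transposition.transpose_def)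
    next
      case 3
      thus ?thesis by (simp add: xs_def ys_def a_def Transposition.transpose_def)
    next
      case 4
      define j where "j = i - Suc (Suc a)"
      have ij: "i = Suc (Suc (a + j))" using 4 by (simp add: j_def)
      have ti: "?t i = i" using 4 by (simp add: Transposition.transpose_def)
      have r: "omit i xs = as @ x # y # omit j bs" "omit i ys = as @ y # x # omit j bs"
        using ij by (auto simp: xs_def ys_def a_def numeral_eq_Suc)
      have "as @ x # y # omit j bs \<in> os N" using os_omit[OF xsos i] r by simp
      hence "\<phi> (as @ y # x # omit j bs) = - \<phi> (as @ x # y # omit j bs)"
        using s unfolding skew_def by blast
      thus ?thesis unfolding ti r by simp
    qed
  qed
  have "cb N \<phi> ys = (\<Sum>i<Suc N. (-1) ^ i * \<phi> (omit i ys))" using ysos by (simp add: cb_def)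
  also have "\<dots> = (\<Sum>i<Suc N. (-1) ^ ?t i * \<phi> (omit (?t i) ys))"
    using sum.permute[OF tp, of "\<lambda>i. (-1) ^ i * \<phi> (omit i ys)"] by (simp add: comp_def)
  also have "\<dots> = (\<Sum>i<Suc N. - ((-1) ^ i * \<phi> (omit i xs)))" by (rule sum.cong) (simp_all only: tm lessThan_iff)
  also have "\<dots> = - cb N \<phi> xs" using xsos by (simp add: cb_def sum_negf del: sum.lessThan_Suc)
  finally show "cb N \<phi> (as @ y # x # bs) = - cb N \<phi> (as @ x # y # bs)" by (simp add: xs_def ys_def)
qed

lemma skew_link_sum:
  assumes s: "skew (Suc N) \<psi>"
  shows "skew N (link_sum N \<psi>)"
  unfolding skew_def
proof (intro conjI allI impI)
  fix xs assume "xs \<notin> os N"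
  thus "link_sum N \<psi> xs = 0" by (simp add: link_sum_def)
next
  fix as x y bs assume xs: "as @ x # y # bs \<in> os N"
  have ys: "as @ y # x # bs \<in> os N" by (rule os_mset[OF xs]) simp
  have "link (as @ y # x # bs) = link (as @ x # y # bs)"
    by (auto simp: link_def os_iff insert_commute)
  moreover have "\<psi> (v # as @ y # x # bs) = - \<psi> (v # as @ x # y # bs)" if "v \<in> link (as @ x # y # bs)" for v
  proof -
    have "(v # as) @ x # y # bs \<in> os (Suc N)" using that xs by (simp add: link_def os_iff)
    thus ?thesis using s unfolding skew_def by (metis append_Cons)
  qed
  ultimately show "link_sum N \<psi> (as @ y # x # bs) = - link_sum N \<psi> (as @ x # y # bs)"
    using xs ys by (simp add: link_sum_def sum_negf)
qed

text \<open>Moving the deleted vertex to the front of the argument of \<open>\<psi>\<close> costs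
  the same sign that the coboundary carries. The signs cancel, and all \<open>Suc N\<close>
  positions contribute equally.\<close>

lemma sum_cb_mult:
  assumes "skew (Suc N) \<psi>"
  shows "ip (Suc N) (cb N \<phi>) \<psi> = real (Suc N) * ip N \<phi> (link_sum N \<psi>)"
proof -
  have "ip (Suc N) (cb N \<phi>) \<psi>
      = (\<Sum>xs\<in>os (Suc N). \<Sum>i<Suc N. \<phi> (omit i xs) * \<psi> (xs ! i # omit i xs))"
  proof (rule sum.cong[OF refl])
    fix xs assume xs: "xs \<in> os (Suc N)"
    have "cb N \<phi> xs * \<psi> xs = (\<Sum>i<Suc N. (-1) ^ i * \<phi> (omit i xs) * \<psi> xs)"
      using xs by (simp add: cb_def sum_distrib_right del: sum.lessThan_Suc)
    also have "\<dots> = (\<Sum>i<Suc N. \<phi> (omit i xs) * \<psi> (xs ! i # omit i xs))"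
    proof (rule sum.cong[OF refl])
      fix i assume "i \<in> {..<Suc N}"
      hence "\<psi> xs = (-1) ^ i * \<psi> (xs ! i # omit i xs)" using skew_nth_to_front[OF assms xs] by simp
      moreover have "(-1::real) ^ i * (-1) ^ i = 1" by (simp add: power_mult_distrib[symmetric])
      ultimately show "(-1) ^ i * \<phi> (omit i xs) * \<psi> xs = \<phi> (omit i xs) * \<psi> (xs ! i # omit i xs)"
        by (metis (no_types, lifting) mult.assoc mult.commute mult_1)
    qed
    finally show "cb N \<phi> xs * \<psi> xs = (\<Sum>i<Suc N. \<phi> (omit i xs) * \<psi> (xs ! i # omit i xs))" .
  qed
  also have "\<dots> = (\<Sum>i<Suc N. \<Sum>xs\<in>os (Suc N). \<phi> (omit i xs) * \<psi> (xs ! i # omit i xs))"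
    by (rule sum.swap)
  also have "\<dots> = (\<Sum>i<Suc N. \<Sum>xs\<in>os (Suc N). \<phi> (tl xs) * \<psi> (hd xs # tl xs))"
    by (intro sum.cong refl sum_move_to_front[of _ "Suc N" _ "\<lambda>v zs. \<phi> zs * \<psi> (v # zs)"])
       (auto simp: os_iff dest: mset_eq_length mset_eq_imp_distinct_iff mset_eq_setD)
  also have "\<dots> = real (Suc N) * (\<Sum>xs\<in>os (Suc N). \<phi> (tl xs) * \<psi> (hd xs # tl xs))" by simp
  also have "(\<Sum>xs\<in>os (Suc N). \<phi> (tl xs) * \<psi> (hd xs # tl xs)) = ip N \<phi> (link_sum N \<psi>)"
    unfolding sum_os_Suc[of "\<lambda>v zs. \<phi> zs * \<psi> (v # zs)"]
    by (intro sum.cong refl) (simp add: link_sum_def sum_distrib_left)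
  finally show ?thesis .
qed

lemma cinner_os: "cinner X (int N - 1) \<phi> \<psi> = ip N \<phi> \<psi> / fact N"
  by (simp add: cinner_def os_def)

text \<open>The factor \<open>Suc N\<close> of \<open>sum_cb_mult\<close> is the ratio of the
  factorials that normalise the two inner products. Uniqueness follows by testing the difference of
  two candidates against itself.\<close>

lemma coadj_eq_link_sum:
  assumes s: "skew (Suc N) \<psi>"
  shows "coadj X (int N - 1) \<psi> = link_sum N \<psi>"
  unfolding coadj_def
proof (rule the_equality)
  have adj: "cinner X (int N - 1 + 1) (cobound X (int N - 1) \<phi>) \<psi> = cinner X (int N - 1) \<phi> (link_sum N \<psi>)" for \<phi>
  proof -
    have "int N - 1 + 1 = int (Suc N) - 1" by simp
    hence "cinner X (int N - 1 + 1) (cobound X (int N - 1) \<phi>) \<psi>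
        = (real (Suc N) * ip N \<phi> (link_sum N \<psi>)) / fact (Suc N)"
      by (simp only: cobound_eq_cb cinner_os sum_cb_mult[OF s])
    also have "\<dots> = ip N \<phi> (link_sum N \<psi>) / fact N"
      unfolding fact_Suc of_nat_mult by (rule mult_divide_mult_cancel_left) simp
    finally show ?thesis by (simp only: cinner_os)
  qed
  show "link_sum N \<psi> \<in> cochains X (int N - 1) \<and>
    (\<forall>\<phi>\<in>cochains X (int N - 1). cinner X (int N - 1 + 1) (cobound X (int N - 1) \<phi>) \<psi> = cinner X (int N - 1) \<phi> (link_sum N \<psi>))"
    using adj skew_link_sum[OF s] skew_iff_cochain by blast
  fix \<chi> assume \<chi>: "\<chi> \<in> cochains X (int N - 1) \<and>
    (\<forall>\<phi>\<in>cochains X (int N - 1). cinner X (int N - 1 + 1) (cobound X (int N - 1) \<phi>) \<psi> = cinner X (int N - 1) \<phi> \<chi>)"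
  have sk: "skew N \<chi>" "skew N (link_sum N \<psi>)" using \<chi> skew_iff_cochain skew_link_sum[OF s] by auto
  define \<phi> where "\<phi> = (\<lambda>x. \<chi> x - link_sum N \<psi> x)"
  have "skew N \<phi>" using sk by (auto simp: skew_def \<phi>_def)
  hence "cinner X (int N - 1) \<phi> (link_sum N \<psi>) = cinner X (int N - 1) \<phi> \<chi>"
    using \<chi> adj[of \<phi>] skew_iff_cochain by metis
  hence "ip N \<phi> \<chi> - ip N \<phi> (link_sum N \<psi>) = 0"
    unfolding cinner_os by simp
  hence "ip N \<phi> \<phi> = 0"
    unfolding sum_subtractf[symmetric] by (simp add: \<phi>_def algebra_simps)
  hence "\<forall>xs\<in>os N. \<phi> xs = 0" using finite_os by (simp add: sum_nonneg_eq_0_iff)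
  thus "\<chi> = link_sum N \<psi>" using sk by (auto simp: skew_def \<phi>_def fun_eq_iff)
qed


definition lap :: "nat \<Rightarrow> ('v list \<Rightarrow> real) \<Rightarrow> 'v list \<Rightarrow> real" where
  "lap N \<phi> = (\<lambda>xs. cb N (link_sum N \<phi>) xs + link_sum (Suc N) (cb (Suc N) \<phi>) xs)"

lemma laplacian_eq_lap:
  assumes s: "skew (Suc N) \<phi>"
  shows "laplacian X (int N) \<phi> = lap N \<phi>"
proof -
  have "coadj X (int N - 1) \<phi> = link_sum N \<phi>" by (rule coadj_eq_link_sum[OF s])
  moreover have "cobound X (int N) \<phi> = cb (Suc N) \<phi>" using cobound_eq_cb[of "Suc N" \<phi>] by simp
  moreover have "coadj X (int N) (cb (Suc N) \<phi>) = link_sum (Suc N) (cb (Suc N) \<phi>)"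
    using coadj_eq_link_sum[OF skew_cb[OF s]] by simp
  ultimately show ?thesis by (simp add: laplacian_def lap_def cobound_eq_cb)
qed

text \<open>Adjointness turns both halves of the Laplacian into products. As \<open>ip\<close> is
  not normalised, the ratios of the numbers of orderings in neighbouring dimensions appear as
  \<open>Suc N\<close> and \<open>1 / Suc (Suc N)\<close>.\<close>

lemma sum_lap_mult:
  assumes s: "skew (Suc N) \<phi>" "skew (Suc N) \<psi>"
  shows "ip (Suc N) (lap N \<phi>) \<psi> =
    real (Suc N) * ip N (link_sum N \<phi>) (link_sum N \<psi>) +
    (\<Sum>xs\<in>os (Suc (Suc N)). cb (Suc N) \<phi> xs * cb (Suc N) \<psi> xs) / real (Suc (Suc N))"
proof -
  have "(\<Sum>xs\<in>os (Suc (Suc N)). cb (Suc N) \<psi> xs * cb (Suc N) \<phi> xs)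
      = real (Suc (Suc N)) * (\<Sum>zs\<in>os (Suc N). \<psi> zs * link_sum (Suc N) (cb (Suc N) \<phi>) zs)"
    by (rule sum_cb_mult[OF skew_cb[OF s(1)]])
  hence "(\<Sum>zs\<in>os (Suc N). link_sum (Suc N) (cb (Suc N) \<phi>) zs * \<psi> zs)
      = (\<Sum>xs\<in>os (Suc (Suc N)). cb (Suc N) \<phi> xs * cb (Suc N) \<psi> xs) / real (Suc (Suc N))"
    by (simp add: mult.commute field_simps)
  thus ?thesis unfolding lap_def distrib_right sum.distrib sum_cb_mult[OF s(2)] by simp
qed

lemma skew_lap: "skew (Suc N) \<phi> \<Longrightarrow> skew (Suc N) (lap N \<phi>)"
  using skew_cb[OF skew_link_sum] skew_link_sum[OF skew_cb] unfolding skew_def lap_def by fastforce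

lemma cb_linear: "cb N (\<lambda>x. \<phi> x + c * \<psi> x) = (\<lambda>x. cb N \<phi> x + c * cb N \<psi> x)"
  by (auto simp: cb_def fun_eq_iff algebra_simps sum.distrib sum_distrib_left simp del: sum.lessThan_Suc)

lemma link_sum_linear: "link_sum N (\<lambda>x. \<phi> x + c * \<psi> x) = (\<lambda>x. link_sum N \<phi> x + c * link_sum N \<psi> x)"
  by (auto simp: link_sum_def fun_eq_iff sum.distrib sum_distrib_left)

lemma lap_linear: "lap N (\<lambda>x. \<phi> x + c * \<psi> x) = (\<lambda>x. lap N \<phi> x + c * lap N \<psi> x)"
  unfolding lap_def link_sum_linear cb_linear by (simp add: algebra_simps)

lemma continuous_cb:
  assumes "\<And>x. continuous_on UNIV (\<lambda>\<phi>. F \<phi> x)"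
  shows "continuous_on UNIV (\<lambda>\<phi>. cb N (F \<phi>) x)"
  unfolding cb_def by (cases "x \<in> os (Suc N)") (auto intro!: continuous_intros assms simp del: sum.lessThan_Suc)

lemma continuous_link_sum:
  assumes "\<And>x. continuous_on UNIV (\<lambda>\<phi>. F \<phi> x)"
  shows "continuous_on UNIV (\<lambda>\<phi>. link_sum N (F \<phi>) x)"
  unfolding link_sum_def by (cases "x \<in> os N") (auto intro!: continuous_intros assms)

lemma continuous_lap: "continuous_on UNIV (\<lambda>\<phi>. lap N \<phi> x)"
  unfolding lap_def
  by (intro continuous_on_add continuous_cb continuous_link_sum continuous_on_product_coordinates)

lemma closed_cochains: "closed (cochains X j)"
proof -
  have c: "continuous_on UNIV (\<lambda>\<phi> :: 'v list \<Rightarrow> real. \<phi> x)" for x by (rule continuous_on_product_coordinates)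
  have eq: "cochains X j = (\<Inter>xs\<in>- ordsimp X j. {\<phi>. \<phi> xs = 0}) \<inter>
    (\<Inter>xs\<in>ordsimp X j. \<Inter>p\<in>{p. p permutes {..<length xs}}. {\<phi>. \<phi> (permute_list p xs) = of_int (sign p) * \<phi> xs})"
    by (auto simp: cochains_def)
  show ?thesis unfolding eq
    by (intro closed_Int closed_INT ballI closed_Collect_eq continuous_intros c)
qed

text \<open>The alternating sum over the orderings of one simplex. Its entries are distinct, so only
  the identity permutation fixes \<open>xs0\<close> and the value there is 1.\<close>

lemma nonzero_cochain:
  assumes x0: "xs0 \<in> os N"
  obtains \<phi> where "\<phi> \<in> cochains X (int N - 1)" "\<phi> \<noteq> (\<lambda>_. 0)"
proof -
  define PS where "PS = {p. p permutes {..<N}}"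
  define \<phi> where "\<phi> xs = (\<Sum>p\<in>PS. if permute_list p xs0 = xs then of_int (sign p) else 0 :: real)" for xs
  have len: "length xs0 = N" using x0 by (simp add: os_iff)
  have "\<phi> xs = 0" if "xs \<notin> os N" for xs
  proof -
    have "permute_list p xs0 \<noteq> xs" if "p \<in> PS" for p using permute_os[OF x0, of p] that \<open>xs \<notin> os N\<close> by (auto simp: PS_def)
    thus ?thesis by (simp add: \<phi>_def)
  qed
  moreover have "\<phi> (permute_list q xs) = of_int (sign q) * \<phi> xs" if xs: "xs \<in> os N" and q: "q permutes {..<N}" for xs q
  proof -
    have lx: "length xs = N" using xs by (simp add: os_iff)
    have inj: "A = B" if "permute_list q A = permute_list q B" "length A = N" "length B = N" for A B :: "'v list"
    proof -
      have "permute_list (inv_into UNIV q) (permute_list q A) = permute_list (inv_into UNIV q) (permute_list q B)" using that by simp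
      moreover have "permute_list (inv_into UNIV q) (permute_list q C) = C" if "length C = N" for C :: "'v list"
      proof -
        have "inv_into UNIV q permutes {..<length C}" using permutes_inv[OF q] that by simp
        from permute_list_compose[OF this, of q] show ?thesis using permutes_inv_o(1)[OF q] by simp
      qed
      ultimately show ?thesis using that by metis
    qed
    have "\<phi> (permute_list q xs) = (\<Sum>p\<in>PS. if permute_list (p \<circ> q) xs0 = permute_list q xs then of_int (sign (p \<circ> q)) else 0)"
      unfolding \<phi>_def PS_def by (rule sum_permutations_compose_right[OF q])
    also have "\<dots> = (\<Sum>p\<in>PS. of_int (sign q) * (if permute_list p xs0 = xs then of_int (sign p) else 0))"
    proof (rule sum.cong[OF refl])
      fix p assume p: "p \<in> PS"
      have "permute_list (p \<circ> q) xs0 = permute_list q (permute_list p xs0)"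
        by (rule permute_list_compose) (simp add: len q)
      moreover have "permute_list q (permute_list p xs0) = permute_list q xs \<longleftrightarrow> permute_list p xs0 = xs"
        using inj[of "permute_list p xs0" xs] lx len by auto
      moreover have "sign (p \<circ> q) = sign p * sign q"
        using p q by (intro sign_compose permutes_imp_permutation[of "{..<N}"]) (auto simp: PS_def)
      ultimately show "(if permute_list (p \<circ> q) xs0 = permute_list q xs then of_int (sign (p \<circ> q)) else 0)
        = of_int (sign q) * (if permute_list p xs0 = xs then of_int (sign p) else 0 :: real)" by simp
    qed
    finally show ?thesis by (simp add: \<phi>_def sum_distrib_left)
  qed
  ultimately have "\<phi> \<in> cochains X (int N - 1)" by (auto simp: cochains_def os_def[symmetric] os_iff)
  moreover have "\<phi> xs0 = 1"
  proof -
    have "p = id" if p: "p permutes {..<N}" "permute_list p xs0 = xs0" for p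
    proof
      fix i
      show "p i = id i"
      proof (cases "i < N")
        case True
        have "xs0 ! p i = xs0 ! i" using permute_list_nth[of p xs0 i] p True len by simp
        moreover have "p i < N" using permutes_in_image[OF p(1), of i] True by simp
        ultimately show ?thesis using x0 True len by (simp add: os_iff nth_eq_iff_index_eq)
      next
        case False
        thus ?thesis using permutes_not_in[OF p(1), of i] by simp
      qed
    qed
    hence "\<phi> xs0 = (\<Sum>p\<in>PS. if p = id then 1 else 0)"
      unfolding \<phi>_def by (intro sum.cong) (auto simp: PS_def)
    also have "\<dots> = 1" by (simp add: PS_def finite_permutations permutes_id)
    finally show ?thesis .
  qed
  hence "\<phi> \<noteq> (\<lambda>_. 0)" by auto
  ultimately show ?thesis using that by blast
qed

section \<open>The eigenvalue set and a local criterion for its minimum\<close>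

definition eigenvalues :: "nat \<Rightarrow> real set" where
  "eigenvalues N = {e. \<exists>\<phi>\<in>cochains X (int N). \<phi> \<noteq> (\<lambda>_. 0) \<and> laplacian X (int N) \<phi> = (\<lambda>xs. e * \<phi> xs)}"

lemma eigenvaluesE:
  assumes "e \<in> eigenvalues N"
  obtains \<phi> where "skew (Suc N) \<phi>" "\<phi> \<noteq> (\<lambda>_. 0)" "lap N \<phi> = (\<lambda>xs. e * \<phi> xs)"
    "ip (Suc N) \<phi> \<phi> > 0"
proof -
  obtain \<phi> where \<phi>: "\<phi> \<in> cochains X (int N)" "\<phi> \<noteq> (\<lambda>_. 0)" "laplacian X (int N) \<phi> = (\<lambda>xs. e * \<phi> xs)"
    using assms by (auto simp: eigenvalues_def)
  have s: "skew (Suc N) \<phi>" using \<phi>(1) skew_iff_cochain[of "Suc N"] by simp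
  have "ip (Suc N) \<phi> \<phi> \<noteq> 0"
  proof
    assume "ip (Suc N) \<phi> \<phi> = 0"
    hence "\<forall>xs\<in>os (Suc N). \<phi> xs = 0" using finite_os by (simp add: sum_nonneg_eq_0_iff)
    thus False using s \<phi>(2) by (auto simp: skew_def fun_eq_iff)
  qed
  moreover have "ip (Suc N) \<phi> \<phi> \<ge> 0" by (simp add: sum_nonneg)
  ultimately show ?thesis using that[OF s \<phi>(2)] laplacian_eq_lap[OF s] \<phi>(3) by simp
qed

lemma lap_symmetric:
  assumes "skew (Suc N) \<phi>" "skew (Suc N) \<psi>"
  shows "ip (Suc N) (lap N \<phi>) \<psi> = ip (Suc N) \<phi> (lap N \<psi>)"
proof -
  have "ip (Suc N) \<phi> (lap N \<psi>) = ip (Suc N) (lap N \<psi>) \<phi>"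
    by (simp add: mult.commute)
  thus ?thesis unfolding sum_lap_mult[OF assms] sum_lap_mult[OF assms(2,1)] by (simp add: mult.commute)
qed

text \<open>Eigenvectors of distinct eigenvalues are orthogonal, hence independent among functions
  on finitely many ordered simplices. Together with nonemptiness this makes the \<open>Min\<close>
  in \<open>min_eig\<close> a genuine minimum.\<close>

lemma finite_eigenvalues: "finite (eigenvalues N)"
proof -
  define ev where "ev e = (SOME \<phi>. skew (Suc N) \<phi> \<and> lap N \<phi> = (\<lambda>xs. e * \<phi> xs) \<and>
      ip (Suc N) \<phi> \<phi> > 0)" for e
  have ev: "skew (Suc N) (ev e)" "lap N (ev e) = (\<lambda>xs. e * ev e xs)"
    "ip (Suc N) (ev e) (ev e) > 0" if e: "e \<in> eigenvalues N" for e
  proof -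
    obtain \<phi> where "skew (Suc N) \<phi>" "lap N \<phi> = (\<lambda>xs. e * \<phi> xs)" "ip (Suc N) \<phi> \<phi> > 0"
      using eigenvaluesE[OF e] by metis
    hence "\<exists>\<phi>. skew (Suc N) \<phi> \<and> lap N \<phi> = (\<lambda>xs. e * \<phi> xs) \<and> ip (Suc N) \<phi> \<phi> > 0" by blast
    from someI_ex[OF this] show "skew (Suc N) (ev e)" "lap N (ev e) = (\<lambda>xs. e * ev e xs)"
      "ip (Suc N) (ev e) (ev e) > 0" unfolding ev_def by blast+
  qed
  have orth: "ip (Suc N) (ev e) (ev e') = 0" if "e \<in> eigenvalues N" "e' \<in> eigenvalues N" "e \<noteq> e'" for e e'
  proof -
    have "e * ip (Suc N) (ev e) (ev e') = e' * ip (Suc N) (ev e) (ev e')"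
      using lap_symmetric[OF ev(1)[OF that(1)] ev(1)[OF that(2)]]
      unfolding ev(2)[OF that(1)] ev(2)[OF that(2)] by (simp add: sum_distrib_left mult_ac)
    thus ?thesis using that(3) by simp
  qed
  have "finite (eigenvalues N) \<and> card (eigenvalues N) \<le> card (os (Suc N))"
  proof (rule independent_family_card[OF finite_os, of _ _ ev])
    fix e xs assume "e \<in> eigenvalues N" "xs \<notin> os (Suc N)"
    thus "ev e xs = 0" using ev(1) by (simp add: skew_def)
  next
    fix J c assume J: "finite J" "J \<subseteq> eigenvalues N" "\<And>x. (\<Sum>e\<in>J. c e * ev e x) = 0"
    show "\<forall>e\<in>J. c e = 0"
    proof
      fix e assume e: "e \<in> J"
      have z: "ip (Suc N) (ev e') (ev e) = 0" if "e' \<in> J" "e' \<noteq> e" for e'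
        by (rule orth) (use that e J(2) in auto)
      have "0 = (\<Sum>xs\<in>os (Suc N). (\<Sum>e'\<in>J. c e' * ev e' xs) * ev e xs)" using J(3) by simp
      also have "\<dots> = (\<Sum>e'\<in>J. c e' * ip (Suc N) (ev e') (ev e))"
        unfolding sum_distrib_left sum_distrib_right by (subst sum.swap) (simp add: mult_ac)
      also have "\<dots> = (\<Sum>e'\<in>{e}. c e' * ip (Suc N) (ev e') (ev e))"
        by (rule sum.mono_neutral_right) (use J(1) e z in auto)
      finally show "c e = 0" using ev(3)[of e] e J(2) by auto
    qed
  qed
  thus ?thesis by simp
qed

lemma eigenvalues_nonempty:
  assumes "xs0 \<in> os (Suc N)"
  shows "eigenvalues N \<noteq> {}"
proof -
  obtain \<phi>1 where \<phi>1: "\<phi>1 \<in> cochains X (int (Suc N) - 1)" "\<phi>1 \<noteq> (\<lambda>_. 0)" by (rule nonzero_cochain[OF assms])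
  let ?V = "cochains X (int (Suc N) - 1)"
  note sk = skew_iff_cochain[of "Suc N", symmetric]
  obtain e \<phi> where "\<phi> \<in> ?V" "\<phi> \<noteq> (\<lambda>_. 0)" "lap N \<phi> = (\<lambda>x. e * \<phi> x)"
  proof (rule symmetric_operator_has_eigenvector[OF finite_os[of "Suc N"] _ closed_cochains, of "int (Suc N) - 1" "lap N" \<phi>1])
    show "\<phi> xs = 0" if "\<phi> \<in> ?V" "xs \<notin> os (Suc N)" for \<phi> xs using that sk by (simp add: skew_def)
    show "(\<lambda>x. \<phi> x + c * \<psi> x) \<in> ?V" if "\<phi> \<in> ?V" "\<psi> \<in> ?V" for \<phi> \<psi> c
    proof -
      have s: "skew (Suc N) \<phi>" "skew (Suc N) \<psi>" using that by (simp_all only: sk)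
      have "skew (Suc N) (\<lambda>x. \<phi> x + c * \<psi> x)"
        unfolding skew_def
      proof (intro conjI allI impI)
        fix as x y bs assume "as @ x # y # bs \<in> os (Suc N)"
        hence "\<phi> (as @ y # x # bs) = - \<phi> (as @ x # y # bs)" "\<psi> (as @ y # x # bs) = - \<psi> (as @ x # y # bs)"
          using s unfolding skew_def by blast+
        thus "\<phi> (as @ y # x # bs) + c * \<psi> (as @ y # x # bs) = - (\<phi> (as @ x # y # bs) + c * \<psi> (as @ x # y # bs))" by simp
      qed (use s in \<open>simp add: skew_def\<close>)
      thus ?thesis by (simp only: sk)
    qed
    show "lap N \<phi> \<in> ?V" if "\<phi> \<in> ?V" for \<phi> using that skew_lap by (simp only: sk)
    show "lap N (\<lambda>x. \<phi> x + c * \<psi> x) = (\<lambda>x. lap N \<phi> x + c * lap N \<psi> x)" for \<phi> \<psi> c by (rule lap_linear)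
    show "ip (Suc N) (lap N \<phi>) \<psi> = ip (Suc N) \<phi> (lap N \<psi>)" if "\<phi> \<in> ?V" "\<psi> \<in> ?V" for \<phi> \<psi>
      using that lap_symmetric by (simp only: sk)
    show "continuous_on UNIV (\<lambda>\<phi>. lap N \<phi> x)" for x by (rule continuous_lap)
  qed (use \<phi>1 in auto)
  moreover from this(1) have "skew (Suc N) \<phi>" by (simp only: sk)
  ultimately have "e \<in> eigenvalues N" using laplacian_eq_lap[of N \<phi>] by (auto simp: eigenvalues_def)
  thus ?thesis by auto
qed

text \<open>By adjointness the left-hand side pairs \<open>\<phi> zs\<close> with \<open>cb \<phi> (v # zs)\<close>: deleting \<open>v\<close> gives the degree
  term, and deleting any of the other vertices gives the same cross term.\<close>

lemma sum_cb_squared: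
  assumes s: "skew (Suc N) \<phi>"
  shows "(\<Sum>xs\<in>os (Suc (Suc N)). cb (Suc N) \<phi> xs * cb (Suc N) \<phi> xs) / real (Suc (Suc N))
    = (\<Sum>zs\<in>os (Suc N). real (card (link zs)) * (\<phi> zs)\<^sup>2)
      - real (Suc N) * (\<Sum>ws\<in>os N. \<Sum>u\<in>link ws. \<Sum>v\<in>link (u # ws). \<phi> (u # ws) * \<phi> (v # ws))"
proof -
  let ?c = "\<lambda>i zs v. \<phi> (zs ! i # omit i zs) * \<phi> (v # omit i zs)"
  define cross where "cross = (\<Sum>ws\<in>os N. \<Sum>u\<in>link ws. \<Sum>v\<in>link (u # ws). \<phi> (u # ws) * \<phi> (v # ws))"
  have cbv: "cb (Suc N) \<phi> (v # zs) = \<phi> zs - (\<Sum>i<Suc N. (-1) ^ i * \<phi> (v # omit i zs))"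
    if "v # zs \<in> os (Suc (Suc N))" for v zs
  proof -
    have "cb (Suc N) \<phi> (v # zs) = (\<Sum>i<Suc (Suc N). (-1) ^ i * \<phi> (omit i (v # zs)))"
      using that by (simp add: cb_def)
    also have "\<dots> = \<phi> zs + (\<Sum>i<Suc N. (-1) ^ Suc i * \<phi> (omit (Suc i) (v # zs)))"
      by (subst sum.lessThan_Suc_shift) simp
    finally show ?thesis by (simp add: sum_negf del: sum.lessThan_Suc)
  qed
  have main: "(\<Sum>zs\<in>os (Suc N). \<phi> zs * link_sum (Suc N) (cb (Suc N) \<phi>) zs)
      = (\<Sum>zs\<in>os (Suc N). real (card (link zs)) * (\<phi> zs)\<^sup>2)
       - (\<Sum>i<Suc N. \<Sum>zs\<in>os (Suc N). \<Sum>v\<in>link zs. ?c i zs v)"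
  proof -
    have "\<phi> zs * link_sum (Suc N) (cb (Suc N) \<phi>) zs = real (card (link zs)) * (\<phi> zs)\<^sup>2
        - (\<Sum>i<Suc N. \<Sum>v\<in>link zs. ?c i zs v)"
      if zs: "zs \<in> os (Suc N)" for zs
    proof -
      have "\<phi> zs * link_sum (Suc N) (cb (Suc N) \<phi>) zs
         = (\<Sum>v\<in>link zs. \<phi> zs * (\<phi> zs - (\<Sum>i<Suc N. (-1) ^ i * \<phi> (v # omit i zs))))"
        using zs by (simp add: link_sum_def sum_distrib_left link_os cbv del: sum.lessThan_Suc)
      also have "\<dots> = (\<Sum>v\<in>link zs. (\<phi> zs)\<^sup>2 - (\<Sum>i<Suc N. ?c i zs v))"
      proof (rule sum.cong[OF refl])
        fix v
        have *: "\<phi> zs * ((-1) ^ i * \<phi> (v # omit i zs)) = ?c i zs v"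
          if "i < Suc N" for i
        proof -
          have "(-1::real) ^ i * (-1) ^ i = 1" by (simp add: power_mult_distrib[symmetric])
          thus ?thesis using skew_nth_to_front[OF s zs that] by (simp add: mult_ac)
        qed
        have "(\<Sum>i<Suc N. \<phi> zs * ((-1) ^ i * \<phi> (v # omit i zs)))
          = (\<Sum>i<Suc N. ?c i zs v)"
          by (rule sum.cong[OF refl], rule *) simp
        thus "\<phi> zs * (\<phi> zs - (\<Sum>i<Suc N. (-1) ^ i * \<phi> (v # omit i zs)))
          = (\<phi> zs)\<^sup>2 - (\<Sum>i<Suc N. ?c i zs v)"
          by (simp only: right_diff_distrib sum_distrib_left power2_eq_square)
      qed
      also have "\<dots> = real (card (link zs)) * (\<phi> zs)\<^sup>2
        - (\<Sum>i<Suc N. \<Sum>v\<in>link zs. ?c i zs v)"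
        unfolding sum_subtractf by (subst sum.swap) simp
      finally show ?thesis .
    qed
    hence "(\<Sum>zs\<in>os (Suc N). \<phi> zs * link_sum (Suc N) (cb (Suc N) \<phi>) zs)
       = (\<Sum>zs\<in>os (Suc N). real (card (link zs)) * (\<phi> zs)\<^sup>2
        - (\<Sum>i<Suc N. \<Sum>v\<in>link zs. ?c i zs v))"
      by (rule sum.cong[OF refl])
    thus ?thesis unfolding sum_subtractf by (subst (asm) (2) sum.swap)
  qed
  have "(\<Sum>zs\<in>os (Suc N). \<Sum>v\<in>link zs. ?c i zs v) = cross"
    if i: "i < Suc N" for i
  proof -
    have lm: "link zs = link (zs ! i # omit i zs)" if "zs \<in> os (Suc N)" for zs
      by (rule link_mset[OF mset_omit, symmetric]) (use that i in \<open>simp add: os_iff\<close>)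
    have "(\<Sum>zs\<in>os (Suc N). \<Sum>v\<in>link zs. ?c i zs v)
      = (\<Sum>zs\<in>os (Suc N). \<Sum>v\<in>link (zs ! i # omit i zs). ?c i zs v)"
      using lm by (intro sum.cong) auto
    also have "\<dots> = (\<Sum>zs\<in>os (Suc N). \<Sum>v\<in>link (hd zs # tl zs). \<phi> (hd zs # tl zs) * \<phi> (v # tl zs))"
      by (rule sum_move_to_front[of _ "Suc N" _ "\<lambda>u ws. \<Sum>v\<in>link (u # ws). \<phi> (u # ws) * \<phi> (v # ws)"])
         (rule i | erule os_mset, assumption | simp add: os_iff)+
    also have "\<dots> = cross"
      unfolding cross_def by (rule sum_os_Suc[of "\<lambda>u ws. \<Sum>v\<in>link (u # ws). \<phi> (u # ws) * \<phi> (v # ws)"])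
    finally show ?thesis .
  qed
  hence "(\<Sum>i<Suc N. \<Sum>zs\<in>os (Suc N). \<Sum>v\<in>link zs. ?c i zs v)
    = real (Suc N) * cross" by simp
  with main have "(\<Sum>zs\<in>os (Suc N). \<phi> zs * link_sum (Suc N) (cb (Suc N) \<phi>) zs)
      = (\<Sum>zs\<in>os (Suc N). real (card (link zs)) * (\<phi> zs)\<^sup>2) - real (Suc N) * cross" by simp
  thus ?thesis unfolding sum_cb_mult[OF skew_cb[OF s]] cross_def by simp
qed

text \<open>The quadratic form at an eigencochain is the degree term plus a sum over faces
  \<open>ws\<close> of expressions in the values \<open>f u = \<phi> (u # ws)\<close> on the link of
  \<open>ws\<close>, and \<open>local_bound\<close> estimates each of them. The local square norms
  add up to that of \<open>\<phi>\<close>; the factor \<open>Suc N\<close> counts the positions of a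
  deleted vertex.\<close>

lemma min_eig_ge:
  assumes deg: "\<And>zs. zs \<in> os (Suc N) \<Longrightarrow> card (link zs) = m"
    and ne: "os (Suc N) \<noteq> {}"
    and local_bound: "\<And>ws f. ws \<in> os N \<Longrightarrow>
      - \<gamma> * (\<Sum>u\<in>link ws. (f u)\<^sup>2) \<le> (\<Sum>u\<in>link ws. f u)\<^sup>2 - (\<Sum>u\<in>link ws. \<Sum>v\<in>link (u # ws). f u * f v)"
  shows "min_eig X (int N) \<ge> real m - real (Suc N) * \<gamma>"
proof -
  have "real m - real (Suc N) * \<gamma> \<le> e" if e: "e \<in> eigenvalues N" for e
  proof -
    obtain \<phi> where s: "skew (Suc N) \<phi>" and ev: "lap N \<phi> = (\<lambda>xs. e * \<phi> xs)"
      and pos: "ip (Suc N) \<phi> \<phi> > 0" by (rule eigenvaluesE[OF e])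
    define Q where "Q = ip (Suc N) \<phi> \<phi>"
    have Q: "(\<Sum>ws\<in>os N. \<Sum>u\<in>link ws. (\<phi> (u # ws))\<^sup>2) = Q"
    proof -
      have "Q = (\<Sum>xs\<in>os (Suc N). (\<phi> (hd xs # tl xs))\<^sup>2)"
        unfolding Q_def by (intro sum.cong refl) (auto simp: os_iff power2_eq_square hd_Cons_tl[OF length_greater_0_conv[THEN iffD1]])
      thus ?thesis using sum_os_Suc[of "\<lambda>u ws. (\<phi> (u # ws))\<^sup>2" N] by simp
    qed
    have "e * Q = ip (Suc N) (lap N \<phi>) \<phi>"
      unfolding ev Q_def by (simp add: sum_distrib_left mult_ac)
    also have "\<dots> = real (Suc N) * (\<Sum>ws\<in>os N. (\<Sum>u\<in>link ws. \<phi> (u # ws))\<^sup>2)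
      + ((\<Sum>zs\<in>os (Suc N). real (card (link zs)) * (\<phi> zs)\<^sup>2)
      - real (Suc N) * (\<Sum>ws\<in>os N. \<Sum>u\<in>link ws. \<Sum>v\<in>link (u # ws). \<phi> (u # ws) * \<phi> (v # ws)))"
      unfolding sum_lap_mult[OF s s] sum_cb_squared[OF s] by (simp add: link_sum_def power2_eq_square)
    also have "(\<Sum>zs\<in>os (Suc N). real (card (link zs)) * (\<phi> zs)\<^sup>2) = m * Q"
      using deg by (simp add: Q_def sum_distrib_left power2_eq_square)
    finally have eQ: "e * Q = m * Q + real (Suc N) * (\<Sum>ws\<in>os N. (\<Sum>u\<in>link ws. \<phi> (u # ws))\<^sup>2
       - (\<Sum>u\<in>link ws. \<Sum>v\<in>link (u # ws). \<phi> (u # ws) * \<phi> (v # ws)))"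
      by (simp add: sum_subtractf right_diff_distrib del: of_nat_Suc)
    have "- \<gamma> * Q = (\<Sum>ws\<in>os N. - \<gamma> * (\<Sum>u\<in>link ws. (\<phi> (u # ws))\<^sup>2))"
      unfolding Q[symmetric] by (rule sum_distrib_left)
    also have "\<dots> \<le> (\<Sum>ws\<in>os N. (\<Sum>u\<in>link ws. \<phi> (u # ws))\<^sup>2
       - (\<Sum>u\<in>link ws. \<Sum>v\<in>link (u # ws). \<phi> (u # ws) * \<phi> (v # ws)))"
      by (rule sum_mono) (use local_bound[of _ "\<lambda>u. \<phi> (u # _)"] in blast)
    finally have "real (Suc N) * (- \<gamma> * Q) \<le> e * Q - m * Q"
      unfolding eQ by (simp only: add_diff_cancel_left') (rule mult_left_mono, simp_all)
    hence "(real m - real (Suc N) * \<gamma>) * Q \<le> e * Q" by (simp add: algebra_simps)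
    thus ?thesis using pos by (simp add: Q_def)
  qed
  moreover have "eigenvalues N \<noteq> {}" using ne eigenvalues_nonempty by auto
  ultimately show ?thesis
    unfolding min_eig_def eigenvalues_def[symmetric] using finite_eigenvalues by simp
qed

end

section \<open>The complexes of a subset of a group\<close>

context fin_group
begin

text \<open>With \<open>s = p \<otimes> x\<close> and
  \<open>w = inv (q \<otimes> y \<otimes> r)\<close> the condition reads
  \<open>s = c \<otimes> w\<close> for some \<open>c \<in> A\<close>, so the sum is a bilinear form
  of the shift operator of \<open>A\<close>. Splitting off the mean of \<open>\<alpha>\<close> gives
  an expander mixing estimate with weights.\<close>

lemma cross_sum_le:
  fixes \<alpha> \<beta> :: "'a \<Rightarrow> real"
  assumes A: "A \<subseteq> carrier G" and ne: "\<not> set_expanding A (\<gamma>\<^sup>2)" and \<gamma>: "\<gamma> \<ge> 0"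
    and pqr: "p \<in> carrier G" "q \<in> carrier G" "r \<in> carrier G"
  shows "(\<Sum>x\<in>carrier G. \<Sum>y\<in>carrier G. if p \<otimes> x \<otimes> q \<otimes> y \<otimes> r \<in> A then \<alpha> x * \<beta> y else 0)
    \<le> card A / n * ((\<Sum>x\<in>carrier G. \<alpha> x) * (\<Sum>y\<in>carrier G. \<beta> y)) + \<gamma> / 2 * (nrm2 \<alpha> + nrm2 \<beta>)"
  (is "?S \<le> _")
proof -
  define \<alpha>' where "\<alpha>' s = \<alpha> (inv p \<otimes> s)" for s
  define \<beta>' where "\<beta>' w = \<beta> (inv q \<otimes> inv w \<otimes> inv r)" for w
  define \<mu> where "\<mu> = (\<Sum>x\<in>carrier G. \<alpha> x) / n"
  define v where "v s = \<alpha>' s - \<mu>" for s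
  have n0: "real n > 0" using n_pos by simp
  have sum\<alpha>: "(\<Sum>s\<in>carrier G. \<alpha>' s) = (\<Sum>x\<in>carrier G. \<alpha> x)" "nrm2 \<alpha>' = nrm2 \<alpha>"
    unfolding \<alpha>'_def nrm2_def
    using sum_translate_left[of "inv p" \<alpha>] sum_translate_left[of "inv p" "\<lambda>x. (\<alpha> x)\<^sup>2"] pqr by auto
  have re\<beta>: "(\<Sum>y\<in>carrier G. F (inv (q \<otimes> y \<otimes> r)) y) = (\<Sum>w\<in>carrier G. F w (inv q \<otimes> inv w \<otimes> inv r))" for F :: "'a \<Rightarrow> 'a \<Rightarrow> real"
  proof (rule sum.reindex_bij_witness[of _ "\<lambda>w. inv q \<otimes> inv w \<otimes> inv r" "\<lambda>y. inv (q \<otimes> y \<otimes> r)"])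
    fix y assume y: "y \<in> carrier G"
    have "inv (inv (q \<otimes> y \<otimes> r)) = q \<otimes> y \<otimes> r" using y pqr by simp
    moreover have "inv q \<otimes> (q \<otimes> y \<otimes> r) \<otimes> inv r = (inv q \<otimes> q) \<otimes> y \<otimes> (r \<otimes> inv r)"
      using y pqr by (simp only: m_assoc m_closed inv_closed)
    ultimately have "inv q \<otimes> inv (inv (q \<otimes> y \<otimes> r)) \<otimes> inv r = (inv q \<otimes> q) \<otimes> y \<otimes> (r \<otimes> inv r)" by simp
    thus e: "inv q \<otimes> inv (inv (q \<otimes> y \<otimes> r)) \<otimes> inv r = y" using y pqr by simp
    show "F (inv (q \<otimes> y \<otimes> r)) (inv q \<otimes> inv (inv (q \<otimes> y \<otimes> r)) \<otimes> inv r) = F (inv (q \<otimes> y \<otimes> r)) y" unfolding e ..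
  next
    fix w assume w: "w \<in> carrier G"
    have "q \<otimes> (inv q \<otimes> inv w \<otimes> inv r) \<otimes> r = (q \<otimes> inv q) \<otimes> inv w \<otimes> (inv r \<otimes> r)"
      using w pqr by (simp only: m_assoc m_closed inv_closed)
    thus "inv (q \<otimes> (inv q \<otimes> inv w \<otimes> inv r) \<otimes> r) = w" using w pqr by simp
  qed (use pqr in auto)
  have sum\<beta>: "(\<Sum>w\<in>carrier G. \<beta>' w) = (\<Sum>y\<in>carrier G. \<beta> y)" "nrm2 \<beta>' = nrm2 \<beta>"
    unfolding \<beta>'_def nrm2_def using re\<beta>[of "\<lambda>_. \<beta>"] re\<beta>[of "\<lambda>_ y. (\<beta> y)\<^sup>2"] by auto
  have v0: "(\<Sum>s\<in>carrier G. v s) = 0" using n0 by (simp add: v_def sum_subtractf sum\<alpha> \<mu>_def)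
  have nv: "nrm2 v \<le> nrm2 \<alpha>"
  proof -
    have "nrm2 v = (\<Sum>s\<in>carrier G. (\<alpha>' s)\<^sup>2 - 2 * \<mu> * \<alpha>' s + \<mu>\<^sup>2)"
      unfolding nrm2_def v_def by (intro sum.cong refl) (simp add: power2_eq_square algebra_simps)
    also have "\<dots> = nrm2 \<alpha> - 2 * \<mu> * (n * \<mu>) + n * \<mu>\<^sup>2"
      unfolding sum.distrib sum_subtractf sum_distrib_left[symmetric] sum\<alpha>(1)
      using n0 sum\<alpha>(2) by (simp add: nrm2_def \<mu>_def)
    also have "\<dots> = nrm2 \<alpha> - n * \<mu>\<^sup>2" by (simp add: power2_eq_square)
    finally show ?thesis by simp
  qed
  define Z where "Z = (\<Sum>w\<in>carrier G. \<beta>' w * (\<Sum>c\<in>A. v (c \<otimes> w)))"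
  have inner: "(\<Sum>x\<in>carrier G. if p \<otimes> x \<otimes> inv w \<in> A then \<alpha> x else 0) = (\<Sum>c\<in>A. \<alpha>' (c \<otimes> w))"
    if w: "w \<in> carrier G" for w
  proof -
    have "(\<Sum>x\<in>carrier G. if p \<otimes> x \<otimes> inv w \<in> A then \<alpha> x else 0) = (\<Sum>x\<in>{x\<in>carrier G. p \<otimes> x \<otimes> inv w \<in> A}. \<alpha> x)"
      using fin by (simp add: sum.inter_filter)
    also have "\<dots> = (\<Sum>c\<in>A. \<alpha>' (c \<otimes> w))"
    proof (rule sum.reindex_bij_witness[of _ "\<lambda>c. inv p \<otimes> (c \<otimes> w)" "\<lambda>x. p \<otimes> x \<otimes> inv w"])
      fix x assume "x \<in> {x\<in>carrier G. p \<otimes> x \<otimes> inv w \<in> A}"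
      hence x: "x \<in> carrier G" "p \<otimes> x \<otimes> inv w \<in> A" by auto
      have "p \<otimes> x \<otimes> inv w \<otimes> w = p \<otimes> x" using x w pqr by (simp add: m_assoc)
      thus e: "inv p \<otimes> (p \<otimes> x \<otimes> inv w \<otimes> w) = x" using x pqr by (simp add: m_assoc[symmetric])
      show "\<alpha>' (p \<otimes> x \<otimes> inv w \<otimes> w) = \<alpha> x" unfolding \<alpha>'_def e ..
      show "p \<otimes> x \<otimes> inv w \<in> A" by (rule x(2))
    next
      fix c assume c: "c \<in> A"
      hence cG: "c \<in> carrier G" using A by auto
      have "p \<otimes> (inv p \<otimes> (c \<otimes> w)) = c \<otimes> w" using cG w pqr by (simp add: m_assoc[symmetric])
      thus e: "p \<otimes> (inv p \<otimes> (c \<otimes> w)) \<otimes> inv w = c" using cG w by (simp add: m_assoc)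
      show "inv p \<otimes> (c \<otimes> w) \<in> {x\<in>carrier G. p \<otimes> x \<otimes> inv w \<in> A}" using e c cG w pqr by simp
    qed
    finally show ?thesis .
  qed
  have "?S
     = (\<Sum>y\<in>carrier G. \<beta> y * (\<Sum>x\<in>carrier G. if p \<otimes> x \<otimes> inv (inv (q \<otimes> y \<otimes> r)) \<in> A then \<alpha> x else 0))"
    unfolding sum_distrib_left using pqr
    by (subst sum.swap) (auto simp: m_assoc intro!: sum.cong)
  also have "\<dots> = (\<Sum>w\<in>carrier G. \<beta>' w * (\<Sum>x\<in>carrier G. if p \<otimes> x \<otimes> inv w \<in> A then \<alpha> x else 0))"
    unfolding \<beta>'_def
    by (rule re\<beta>[of "\<lambda>w y. \<beta> y * (\<Sum>x\<in>carrier G. if p \<otimes> x \<otimes> inv w \<in> A then \<alpha> x else 0)"])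
  also have "\<dots> = (\<Sum>w\<in>carrier G. \<beta>' w * (\<Sum>c\<in>A. v (c \<otimes> w)) + \<beta>' w * (card A * \<mu>))"
    by (intro sum.cong refl) (simp add: inner v_def sum_subtractf algebra_simps)
  also have "\<dots> = Z + (\<Sum>y\<in>carrier G. \<beta> y) * (card A * \<mu>)"
    unfolding Z_def sum.distrib sum_distrib_right[symmetric] sum\<beta>(1) ..
  finally have total: "?S
     = Z + card A / n * ((\<Sum>x\<in>carrier G. \<alpha> x) * (\<Sum>y\<in>carrier G. \<beta> y))" by (simp add: \<mu>_def mult_ac)
  have "Z\<^sup>2 \<le> nrm2 \<beta>' * nrm2 (\<lambda>w. \<Sum>c\<in>A. v (c \<otimes> w))"
    unfolding Z_def nrm2_def by (rule Cauchy_Schwarz_ineq_sum)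
  also have "\<dots> \<le> nrm2 \<beta> * (\<gamma>\<^sup>2 * nrm2 \<alpha>)"
  proof (rule mult_mono)
    have "nrm2 (\<lambda>w. \<Sum>c\<in>A. v (c \<otimes> w)) \<le> \<gamma>\<^sup>2 * nrm2 v" using ne v0 unfolding set_expanding_def by (meson not_less)
    also have "\<dots> \<le> \<gamma>\<^sup>2 * nrm2 \<alpha>" using nv by (intro mult_left_mono) auto
    finally show "nrm2 (\<lambda>w. \<Sum>c\<in>A. v (c \<otimes> w)) \<le> \<gamma>\<^sup>2 * nrm2 \<alpha>" .
  qed (auto simp: sum\<beta> nrm2_nonneg)
  \<comment> \<open>The inequality of arithmetic and geometric means makes the error additive in the
    two square norms, as the local criterion requires.\<close>
  also have "\<dots> \<le> (\<gamma> / 2 * (nrm2 \<alpha> + nrm2 \<beta>))\<^sup>2"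
  proof -
    have "0 \<le> \<gamma>\<^sup>2 * (nrm2 \<alpha> - nrm2 \<beta>)\<^sup>2" by simp
    thus ?thesis by (simp add: power2_eq_square field_simps)
  qed
  finally have "Z\<^sup>2 \<le> (\<gamma> / 2 * (nrm2 \<alpha> + nrm2 \<beta>))\<^sup>2" .
  hence "Z \<le> \<gamma> / 2 * (nrm2 \<alpha> + nrm2 \<beta>)"
    by (rule power2_le_imp_le) (use \<gamma> nrm2_nonneg in simp)
  thus ?thesis using total by simp
qed

section \<open>Colours, products along simplices and links\<close>

abbreviation coord :: "(nat \<times> 'a) set \<Rightarrow> nat \<Rightarrow> 'a" where
  "coord S l \<equiv> (THE x. (l,x) \<in> S)"

definition fprod :: "(nat \<times> 'a) set \<Rightarrow> nat list \<Rightarrow> 'a" where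
  "fprod S ls = foldr (\<lambda>l acc. coord S l \<otimes> acc) ls \<one>"

lemma simp_prod_fprod: "simp_prod G k S = fprod S [1..<k+2]"
  by (simp add: simp_prod_def fprod_def)

lemma fprod_closed: "(\<And>l. l \<in> set ls \<Longrightarrow> coord S l \<in> carrier G) \<Longrightarrow> fprod S ls \<in> carrier G"
  by (induction ls) (auto simp: fprod_def)

lemma fprod_append:
  "(\<And>l. l \<in> set (ls @ ls') \<Longrightarrow> coord S l \<in> carrier G) \<Longrightarrow> fprod S (ls @ ls') = fprod S ls \<otimes> fprod S ls'"
proof (induction ls)
  case Nil
  thus ?case using fprod_closed[of ls' S] by (simp add: fprod_def)
next
  case (Cons l ls)
  hence "fprod S (ls @ ls') = fprod S ls \<otimes> fprod S ls'" by simp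
  thus ?case using Cons.prems fprod_closed[of ls S] fprod_closed[of ls' S] by (simp add: fprod_def m_assoc)
qed

lemma coord_insert_same: "i \<notin> fst ` T \<Longrightarrow> coord (insert (i,x) T) i = x"
  by (rule the_equality) (auto simp: image_iff)

lemma fprod_insert_other:
  "i \<notin> set ls \<Longrightarrow> fprod (insert (i,x) T) ls = fprod T ls"
  by (induction ls) (auto simp: fprod_def)

text \<open>This isolates the factor of one added colour. A colour absent from \<open>T\<close> has
  an unspecified coordinate, so the remaining colours of the interval must be known to have
  coordinates in the group.\<close>

lemma fprod_insert:
  assumes i: "a \<le> i" "i < b" "i \<notin> fst ` T" and x: "x \<in> carrier G"
    and T: "\<And>l. a \<le> l \<Longrightarrow> l < b \<Longrightarrow> l \<noteq> i \<Longrightarrow> coord T l \<in> carrier G"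
  shows "fprod (insert (i,x) T) [a..<b] = fprod T [a..<i] \<otimes> x \<otimes> fprod T [Suc i..<b]"
    "fprod T [a..<i] \<in> carrier G" "fprod T [Suc i..<b] \<in> carrier G"
proof -
  have d: "[a..<b] = [a..<i] @ i # [Suc i..<b]"
    using i by (metis le_add_diff_inverse less_imp_le upt_add_eq_append upt_conv_Cons)
  show c: "fprod T [a..<i] \<in> carrier G" "fprod T [Suc i..<b] \<in> carrier G"
    using i T by (auto intro!: fprod_closed)
  have "fprod (insert (i,x) T) [a..<b] = fprod (insert (i,x) T) [a..<i] \<otimes> fprod (insert (i,x) T) (i # [Suc i..<b])"
    unfolding d
  proof (rule fprod_append)
    fix l assume "l \<in> set ([a..<i] @ i # [Suc i..<b])"
    hence l: "a \<le> l" "l < b" using i by auto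
    show "coord (insert (i,x) T) l \<in> carrier G"
      using T[OF l] coord_insert_same[OF i(3)] x by (cases "l = i") auto
  qed
  also have "fprod (insert (i,x) T) (i # [Suc i..<b]) = x \<otimes> fprod (insert (i,x) T) [Suc i..<b]"
    using coord_insert_same[OF i(3)] by (simp add: fprod_def)
  finally show "fprod (insert (i,x) T) [a..<b] = fprod T [a..<i] \<otimes> x \<otimes> fprod T [Suc i..<b]"
    using c x by (simp add: fprod_insert_other m_assoc)
qed

lemma YG_coord:
  assumes "T \<in> YG G k" "l \<in> fst ` T"
  shows "coord T l \<in> carrier G"
proof -
  obtain x where x: "(l,x) \<in> T" using assms(2) by auto
  hence "coord T l = x" using assms(1) by (intro the_equality) (auto simp: YG_def)
  thus ?thesis using x assms(1) by (auto simp: YG_def)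
qed

lemma YG_insert:
  assumes "T \<in> YG G k" "i \<notin> fst ` T" "1 \<le> i" "i \<le> k + 1" "x \<in> carrier G"
  shows "insert (i,x) T \<in> YG G k"
  using assms unfolding YG_def by (force simp: image_iff)

lemma YG_finite: "T \<in> YG G k \<Longrightarrow> finite T"
  by (rule finite_subset[of _ "{1..k+1} \<times> carrier G"]) (auto simp: YG_def fin)

lemma YG_inj_fst: "T \<in> YG G k \<Longrightarrow> inj_on fst T"
  by (auto simp: YG_def inj_on_def)

lemma YG_card_fst: "T \<in> YG G k \<Longrightarrow> card (fst ` T) = card T"
  by (rule card_image) (rule YG_inj_fst)

lemma YG_colours: "T \<in> YG G k \<Longrightarrow> fst ` T \<subseteq> {1..k+1}"
  by (auto simp: YG_def)

text \<open>A proper subset of a simplex has at most \<open>k\<close> vertices, so it lies in the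
  full skeleton whatever \<open>A\<close> is.\<close>

lemma fin_complex_YA: "fin_complex (YA G k A)"
proof
  fix S T assume S: "S \<in> YA G k A" and T: "T \<subseteq> S"
  have SG: "S \<in> YG G k" using S by (simp add: YA_def)
  have TG: "T \<in> YG G k" using SG T unfolding YG_def by blast
  show "T \<in> YA G k A"
  proof (cases "T = S")
    case False
    hence "card T < card S" using T YG_finite[OF SG] by (simp add: psubset_card_mono psubset_eq)
    thus ?thesis using S TG by (auto simp: YA_def)
  qed (use S in simp)
next
  have "\<Union> (YA G k A) \<subseteq> {1..k+1} \<times> carrier G" by (auto simp: YA_def YG_def)
  thus "finite (\<Union> (YA G k A))" using fin finite_subset by blast
qed

context
  fixes k :: nat and A :: "'a set"
  assumes A: "A \<subseteq> carrier G"
begin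

interpretation Y: fin_complex "YA G k A" by (rule fin_complex_YA)

lemma missing_colours:
  assumes "zs \<in> Y.os N"
  shows "set zs \<in> YG G k" "card ({1..k+1} - fst ` set zs) = k + 1 - N" "fst ` set zs \<subseteq> {1..k+1}"
proof -
  show z: "set zs \<in> YG G k" using assms[unfolded Y.os_iff] by (simp add: YA_def)
  show sub: "fst ` set zs \<subseteq> {1..k+1}" by (rule YG_colours[OF z])
  have "card (fst ` set zs) = N" using YG_card_fst[OF z] assms by (simp add: Y.os_iff distinct_card)
  thus "card ({1..k+1} - fst ` set zs) = k + 1 - N" using sub by (subst card_Diff_subset) auto
qed

text \<open>Up to \<open>k\<close> vertices the skeleton is full, so \<open>A\<close> enters only
  when the new vertex completes the set of colours.\<close>

lemma link_insert_iff:
  assumes zs: "zs \<in> Y.os N" and N: "N \<le> k"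
  shows "(i,x) \<in> Y.link zs \<longleftrightarrow> i \<in> {1..k+1} - fst ` set zs \<and> x \<in> carrier G \<and>
    (N = k \<longrightarrow> simp_prod G k (insert (i,x) (set zs)) \<in> A)"
proof
  assume "(i,x) \<in> Y.link zs"
  hence o: "(i,x) # zs \<in> Y.os (Suc N)" using Y.link_os[OF zs] by simp
  have G: "insert (i,x) (set zs) \<in> YG G k" using o[unfolded Y.os_iff] by (simp add: YA_def)
  have "i \<notin> fst ` set zs"
  proof
    assume "i \<in> fst ` set zs"
    then obtain y where "(i,y) \<in> set zs" by auto
    moreover from this have "x = y" using G unfolding YG_def by blast
    ultimately show False using o by (auto simp: Y.os_iff)
  qed
  moreover have "i \<in> {1..k+1}" "x \<in> carrier G" using G unfolding YG_def by auto
  moreover have "simp_prod G k (insert (i,x) (set zs)) \<in> A" if "N = k"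
  proof -
    have "card (set ((i,x) # zs)) = k + 1" using o that by (subst distinct_card) (auto simp: Y.os_iff)
    thus ?thesis using o[unfolded Y.os_iff] by (simp add: YA_def)
  qed
  ultimately show "i \<in> {1..k+1} - fst ` set zs \<and> x \<in> carrier G \<and>
    (N = k \<longrightarrow> simp_prod G k (insert (i,x) (set zs)) \<in> A)" by simp
next
  assume h: "i \<in> {1..k+1} - fst ` set zs \<and> x \<in> carrier G \<and>
    (N = k \<longrightarrow> simp_prod G k (insert (i,x) (set zs)) \<in> A)"
  have G: "insert (i,x) (set zs) \<in> YG G k" using YG_insert[OF missing_colours(1)[OF zs]] h by auto
  have nin: "(i,x) \<notin> set zs" using h by (auto simp: image_iff)
  have "card (set ((i,x) # zs)) = Suc N" using nin zs by (subst distinct_card) (auto simp: Y.os_iff)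
  hence "insert (i,x) (set zs) \<in> YA G k A" using h G N by (auto simp: YA_def)
  hence "(i,x) # zs \<in> Y.os (Suc N)" using nin zs by (simp add: Y.os_iff)
  thus "(i,x) \<in> Y.link zs" using Y.link_os[OF zs] by simp
qed

text \<open>Such a simplex misses one colour, and the condition on the missing entry has the form
  \<open>p \<otimes> x \<otimes> q \<in> A\<close>, with exactly one solution for each element of
  \<open>A\<close>.\<close>

lemma card_link_facet:
  assumes zs: "zs \<in> Y.os k"
  shows "card (Y.link zs) = card A"
proof -
  note m = missing_colours[OF zs]
  obtain i where i: "{1..k+1} - fst ` set zs = {i}" using m(2) by (auto simp: card_1_singleton_iff)
  have "i \<in> {1..k+1} - fst ` set zs" using i by simp
  hence ii: "1 \<le> i" "i < k + 2" "i \<notin> fst ` set zs" by auto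
  have T: "coord (set zs) l \<in> carrier G" if "1 \<le> l" "l < k + 2" "l \<noteq> i" for l
  proof -
    have "l \<in> fst ` set zs" using that i by auto
    thus ?thesis by (rule YG_coord[OF m(1)])
  qed
  define p q where "p = fprod (set zs) [1..<i]" and "q = fprod (set zs) [Suc i..<k+2]"
  have pq: "p \<in> carrier G" "q \<in> carrier G" using fprod_insert(2,3)[OF ii one_closed T] by (auto simp: p_def q_def)
  have sp: "simp_prod G k (insert (i,x) (set zs)) = p \<otimes> x \<otimes> q" if "x \<in> carrier G" for x
    using fprod_insert(1)[OF ii that T] by (simp add: simp_prod_fprod p_def q_def)
  have link: "(l,x) \<in> Y.link zs \<longleftrightarrow> l = i \<and> x \<in> carrier G \<and> p \<otimes> x \<otimes> q \<in> A" for l x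
    using link_insert_iff[OF zs order_refl, of l x] sp[of x] unfolding i by auto
  have "bij_betw (\<lambda>a. (i, inv p \<otimes> a \<otimes> inv q)) A (Y.link zs)"
  proof (rule bij_betw_byWitness[where f' = "\<lambda>(l,x). p \<otimes> x \<otimes> q"])
    have e1: "p \<otimes> (inv p \<otimes> a \<otimes> inv q) \<otimes> q = a" if "a \<in> carrier G" for a
    proof -
      have "p \<otimes> (inv p \<otimes> a \<otimes> inv q) \<otimes> q = (p \<otimes> inv p) \<otimes> a \<otimes> (inv q \<otimes> q)"
        using that pq by (simp only: m_assoc m_closed inv_closed)
      thus ?thesis using that pq by simp
    qed
    have e2: "inv p \<otimes> (p \<otimes> x \<otimes> q) \<otimes> inv q = x" if "x \<in> carrier G" for x
    proof -
      have "inv p \<otimes> (p \<otimes> x \<otimes> q) \<otimes> inv q = (inv p \<otimes> p) \<otimes> x \<otimes> (q \<otimes> inv q)"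
        using that pq by (simp only: m_assoc m_closed inv_closed)
      thus ?thesis using that pq by simp
    qed
    show "\<forall>a\<in>A. (case (i, inv p \<otimes> a \<otimes> inv q) of (l,x) \<Rightarrow> p \<otimes> x \<otimes> q) = a" using A e1 by auto
    show "\<forall>u\<in>Y.link zs. (i, inv p \<otimes> (case u of (l,x) \<Rightarrow> p \<otimes> x \<otimes> q) \<otimes> inv q) = u" using e2 by (auto simp: link)
    show "(\<lambda>a. (i, inv p \<otimes> a \<otimes> inv q)) ` A \<subseteq> Y.link zs" using A e1 pq by (auto simp: link)
    show "(\<lambda>(l,x). p \<otimes> x \<otimes> q) ` Y.link zs \<subseteq> A" by (auto simp: link)
  qed
  thus ?thesis by (simp add: bij_betw_same_card)
qed

text \<open>The link of \<open>ws\<close> consists of two copies of the group, one for each missing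
  colour, and vertices from different copies are joined when
  \<open>p \<otimes> x \<otimes> q \<otimes> y \<otimes> r \<in> A\<close>. The double sum is
  therefore twice the sum in \<open>cross_sum_le\<close>.\<close>

lemma local_estimate:
  assumes k: "k = Suc N" and ws: "ws \<in> Y.os N"
    and ne: "\<not> set_expanding A (\<gamma>\<^sup>2)" and \<gamma>: "\<gamma> \<ge> 0"
  shows "- \<gamma> * (\<Sum>u\<in>Y.link ws. (f u)\<^sup>2)
    \<le> (\<Sum>u\<in>Y.link ws. f u)\<^sup>2 - (\<Sum>u\<in>Y.link ws. \<Sum>v\<in>Y.link (u # ws). f u * f v)"
proof -
  note m = missing_colours[OF ws]
  have "card ({1..k+1} - fst ` set ws) = 2" using m(2) k by simp
  then obtain i j where ij': "{1..k+1} - fst ` set ws = {i,j}" "i \<noteq> j" by (auto simp: card_2_iff)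
  \<comment> \<open>The factors of the product follow the order of the colours, so the missing
    colours are ordered too.\<close>
  obtain i j where ij: "{1..k+1} - fst ` set ws = {i,j}" "i < j"
  proof (cases "i < j")
    case True
    thus ?thesis using that ij' by blast
  next
    case False
    hence "j < i" using ij' by simp
    thus ?thesis using that[of j i] ij' by (simp add: insert_commute)
  qed
  have "i \<in> {1..k+1} - fst ` set ws" "j \<in> {1..k+1} - fst ` set ws" using ij(1) by auto
  hence ii: "1 \<le> i" "i < k + 2" "i \<notin> fst ` set ws" and jj: "Suc i \<le> j" "j < k + 2" "j \<notin> fst ` set ws"
    using ij(2) by auto
  have T: "coord (set ws) l \<in> carrier G" if "1 \<le> l" "l < k + 2" "l \<noteq> i" "l \<noteq> j" for l
  proof -
    have "l \<in> fst ` set ws" using that ij(1) by auto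
    thus ?thesis by (rule YG_coord[OF m(1)])
  qed
  define p q r where "p = fprod (set ws) [1..<i]" and "q = fprod (set ws) [Suc i..<j]"
    and "r = fprod (set ws) [Suc j..<k+2]"
  have pqr: "p \<in> carrier G" "q \<in> carrier G" "r \<in> carrier G"
    unfolding p_def q_def r_def using ij ii jj by (auto intro!: fprod_closed T)
  have sp: "simp_prod G k (insert (i,x) (insert (j,y) (set ws))) = p \<otimes> x \<otimes> q \<otimes> y \<otimes> r"
    if xy: "x \<in> carrier G" "y \<in> carrier G" for x y
  proof -
    have i2: "i \<notin> fst ` insert (j,y) (set ws)" using ii ij(2) by auto
    have c2: "coord (insert (j,y) (set ws)) l \<in> carrier G" if "1 \<le> l" "l < k + 2" "l \<noteq> i" for l
      using that T[of l] coord_insert_same[OF jj(3), of y] xy by (cases "l = j") auto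
    have "simp_prod G k (insert (i,x) (insert (j,y) (set ws)))
      = fprod (insert (j,y) (set ws)) [1..<i] \<otimes> x \<otimes> fprod (insert (j,y) (set ws)) [Suc i..<k+2]"
      unfolding simp_prod_fprod by (rule fprod_insert(1)[OF ii(1,2) i2 xy(1) c2])
    also have "fprod (insert (j,y) (set ws)) [1..<i] = p"
      unfolding p_def by (rule fprod_insert_other) (use ij(2) in auto)
    also have "fprod (insert (j,y) (set ws)) [Suc i..<k+2] = q \<otimes> y \<otimes> r"
      unfolding q_def r_def by (rule fprod_insert(1)[OF jj xy(2)]) (use T ii in auto)
    finally show ?thesis using xy pqr by (simp add: m_assoc)
  qed
  have L: "Y.link ws = (\<lambda>x. (i,x)) ` carrier G \<union> (\<lambda>x. (j,x)) ` carrier G"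
    using link_insert_iff[OF ws, unfolded ij(1)] k by auto
  have split: "(\<Sum>u\<in>Y.link ws. h u) = (\<Sum>x\<in>carrier G. h (i,x)) + (\<Sum>y\<in>carrier G. h (j,y))" for h :: "nat \<times> 'a \<Rightarrow> real"
    unfolding L using fin ij(2) by (subst sum.union_disjoint) (auto simp: sum.reindex inj_on_def)
  have memi: "(l,z) \<in> Y.link ((i,x) # ws) \<longleftrightarrow> l = j \<and> z \<in> carrier G \<and> p \<otimes> x \<otimes> q \<otimes> z \<otimes> r \<in> A"
    if x: "x \<in> carrier G" for x l z
  proof -
    have o: "(i,x) # ws \<in> Y.os k" using Y.link_os[OF ws, of "(i,x)"] L x k by auto
    have "{1..k+1} - fst ` set ((i,x) # ws) = {j}" using ij by auto
    thus ?thesis using link_insert_iff[OF o order_refl, of l z] sp[OF x, of z] by (auto simp: insert_commute)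
  qed
  have memj: "(l,z) \<in> Y.link ((j,y) # ws) \<longleftrightarrow> l = i \<and> z \<in> carrier G \<and> p \<otimes> z \<otimes> q \<otimes> y \<otimes> r \<in> A"
    if y: "y \<in> carrier G" for y l z
  proof -
    have o: "(j,y) # ws \<in> Y.os k" using Y.link_os[OF ws, of "(j,y)"] L y k by auto
    have "{1..k+1} - fst ` set ((j,y) # ws) = {i}" using ij by auto
    thus ?thesis using link_insert_iff[OF o order_refl, of l z] sp[OF _ y, of z] by auto
  qed
  define \<alpha> \<beta> where "\<alpha> x = f (i,x)" and "\<beta> y = f (j,y)" for x y
  define C where "C = (\<Sum>x\<in>carrier G. \<Sum>y\<in>carrier G. if p \<otimes> x \<otimes> q \<otimes> y \<otimes> r \<in> A then \<alpha> x * \<beta> y else 0)"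
  have si: "(\<Sum>v\<in>Y.link ((i,x) # ws). f (i,x) * f v) = (\<Sum>y\<in>carrier G. if p \<otimes> x \<otimes> q \<otimes> y \<otimes> r \<in> A then \<alpha> x * \<beta> y else 0)"
    if x: "x \<in> carrier G" for x
  proof -
    have "Y.link ((i,x) # ws) = (\<lambda>y. (j,y)) ` {y\<in>carrier G. p \<otimes> x \<otimes> q \<otimes> y \<otimes> r \<in> A}"
      using memi[OF x] by auto
    thus ?thesis unfolding \<alpha>_def \<beta>_def using fin by (simp add: sum.reindex inj_on_def sum.inter_filter)
  qed
  have sj: "(\<Sum>v\<in>Y.link ((j,y) # ws). f (j,y) * f v) = (\<Sum>x\<in>carrier G. if p \<otimes> x \<otimes> q \<otimes> y \<otimes> r \<in> A then \<alpha> x * \<beta> y else 0)"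
    if y: "y \<in> carrier G" for y
  proof -
    have "Y.link ((j,y) # ws) = (\<lambda>x. (i,x)) ` {x\<in>carrier G. p \<otimes> x \<otimes> q \<otimes> y \<otimes> r \<in> A}"
      using memj[OF y] by auto
    thus ?thesis unfolding \<alpha>_def \<beta>_def using fin by (simp add: sum.reindex inj_on_def sum.inter_filter mult.commute)
  qed
  have "(\<Sum>u\<in>Y.link ws. \<Sum>v\<in>Y.link (u # ws). f u * f v) = C + (\<Sum>y\<in>carrier G. \<Sum>x\<in>carrier G. if p \<otimes> x \<otimes> q \<otimes> y \<otimes> r \<in> A then \<alpha> x * \<beta> y else 0)"
    unfolding split C_def using si sj by simp
  also have "\<dots> = 2 * C" unfolding C_def by (subst (2) sum.swap) simp
  finally have cross: "(\<Sum>u\<in>Y.link ws. \<Sum>v\<in>Y.link (u # ws). f u * f v) = 2 * C" .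
  define a b c where "a = (\<Sum>x\<in>carrier G. \<alpha> x)" and "b = (\<Sum>y\<in>carrier G. \<beta> y)" and "c = real (card A) / n"
  have Cle: "C \<le> c * (a * b) + \<gamma> / 2 * (nrm2 \<alpha> + nrm2 \<beta>)"
    unfolding C_def a_def b_def c_def by (rule cross_sum_le[OF A ne \<gamma> pqr])
  have c01: "0 \<le> c" "c \<le> 1" using card_mono[OF fin A] n_pos by (auto simp: c_def)
  \<comment> \<open>A convex combination of two nonnegative quantities, as the density
    \<open>c\<close> of \<open>A\<close> lies in [0,1]. It shows that \<open>(a + b)\<^sup>2\<close>
    dominates the mean part of the cross term.\<close>
  have "0 \<le> c * (a\<^sup>2 + b\<^sup>2) + (1 - c) * (a + b)\<^sup>2" using c01 by simp
  also have "\<dots> = (a + b)\<^sup>2 - 2 * (c * (a * b))" by (simp add: power2_eq_square algebra_simps)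
  finally have "- \<gamma> * (nrm2 \<alpha> + nrm2 \<beta>) \<le> (a + b)\<^sup>2 - 2 * C" using Cle by (simp add: algebra_simps)
  thus ?thesis unfolding cross unfolding split by (simp add: nrm2_def \<alpha>_def \<beta>_def a_def b_def)
qed

lemma min_eig_YA_ge:
  assumes k: "k \<ge> 1" and ne: "\<not> set_expanding A (\<gamma>\<^sup>2)" and \<gamma>: "\<gamma> \<ge> 0"
  shows "min_eig (YA G k A) (int k - 1) \<ge> real (card A) - real k * \<gamma>"
proof -
  obtain N where N: "k = Suc N" using k by (cases k) auto
  \<comment> \<open>A simplex on the colours 1 to \<open>k\<close>, present by fullness of the
    skeleton; it keeps the set of eigenvalues from being empty.\<close>
  have "map (\<lambda>i. (i, \<one>)) [1..<k+1] \<in> Y.os (Suc N)"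
  proof -
    let ?S = "set (map (\<lambda>i. (i, \<one>)) [1..<k+1])"
    have "distinct (map (\<lambda>i. (i, \<one>)) [1..<k+1])" by (simp add: distinct_map inj_on_def del: upt_Suc)
    moreover have "card ?S \<le> length (map (\<lambda>i. (i, \<one>)) [1..<k+1])" by (rule card_length)
    hence "card ?S \<le> k" by (simp del: set_map set_upt upt_Suc)
    hence "?S \<in> YA G k A" by (auto simp: YA_def YG_def)
    ultimately show ?thesis unfolding Y.os_iff using N by (simp del: upt_Suc)
  qed
  hence "min_eig (YA G k A) (int N) \<ge> real (card A) - real (Suc N) * \<gamma>"
    using card_link_facet local_estimate[OF N _ ne \<gamma>] N by (intro Y.min_eig_ge) auto
  thus ?thesis using N by simp
qed

end

end

section \<open>The size of \<open>m\<close> and the final estimate\<close>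

text \<open>Let \<open>y\<close> be the eighth root of \<open>N\<close>. Then \<open>x\<close> is
  below \<open>5/28 * y\<close> and \<open>ln d \<le> 16 * ln y \<le> 8 * y\<close>, so the sample
  size is of order \<open>y ^ 3\<close>, while the square root of \<open>N\<close> is
  \<open>y ^ 4\<close>. This is where the eighth power in the hypothesis acts.\<close>

lemma sample_size_bound:
  fixes x N d :: real
  assumes x: "x \<ge> 1" and N: "N > 10^6 * x ^ 8" and d: "1 \<le> d" "d \<le> N\<^sup>2"
  shows "4 * (real (nat \<lceil>9 * x\<^sup>2 * ln d\<rceil>))\<^sup>2 \<le> N"
proof -
  define y where "y = root 8 N"
  have "x ^ 8 \<ge> 1" using x by simp
  hence "10^6 * 1 < N" by (intro order_le_less_trans[OF mult_left_mono N]) auto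
  hence N0: "N > 10^6" by simp
  have y8: "y ^ 8 = N" using N0 by (simp add: y_def)
  have y0: "y > 0" using N0 by (simp add: y_def)
  \<comment> \<open>The number 28/5 is a rational slightly below the eighth root of
    \<open>10^6\<close>.\<close>
  have xy: "28 / 5 * x < y"
  proof (rule power_less_imp_less_base)
    have "(28 / 5 * x) ^ 8 = (28 / 5) ^ 8 * x ^ 8" by (rule power_mult_distrib)
    also have "\<dots> \<le> 10^6 * x ^ 8" by (intro mult_right_mono) (auto simp: power_divide)
    also have "\<dots> < y ^ 8" using N y8 by simp
    finally show "(28 / 5 * x) ^ 8 < y ^ 8" .
  qed (use y0 in simp)
  have y5: "y \<ge> 28 / 5" using xy x by linarith
  have "ln d \<le> ln (N\<^sup>2)" using d N0 by (subst ln_le_cancel_iff) auto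
  also have "\<dots> = 16 * ln y" using y0 unfolding y8[symmetric] power_mult[symmetric] by (simp add: ln_realpow)
  also have "ln y \<le> y / 2"
  proof -
    \<comment> \<open>Halving the argument gives slope 1/2; the plain bound
      \<open>ln y \<le> y - 1\<close> would be too weak for \<open>y\<close> close to 28/5.\<close>
    have "ln (y / 2) \<le> y / 2 - 1" using y0 by (intro ln_le_minus_one) simp
    moreover have "ln (y / 2) = ln y - ln 2" using y0 by (simp add: ln_div)
    ultimately show ?thesis using ln_le_minus_one[of "2::real"] by simp
  qed
  finally have ln: "ln d \<le> 8 * y" by simp
  have ln0: "0 \<le> ln d" using d by simp
  have x2: "x\<^sup>2 \<le> (5 / 28 * y)\<^sup>2" using xy x by (intro power_mono) auto
  have "9 * x\<^sup>2 * ln d \<le> 9 * (5 / 28 * y)\<^sup>2 * (8 * y)"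
    using x2 ln ln0 by (intro mult_mono) auto
  also have "\<dots> = 225 / 98 * y ^ 3" by (simp add: power2_eq_square power3_eq_cube)
  finally have a: "9 * x\<^sup>2 * ln d \<le> 225 / 98 * y ^ 3" .
  have "real (nat \<lceil>9 * x\<^sup>2 * ln d\<rceil>) \<le> 9 * x\<^sup>2 * ln d + 1"
    using ln0 by (simp add: of_nat_nat)
  also have "\<dots> \<le> 225 / 98 * y ^ 3 + 1" using a by simp
  also have "\<dots> \<le> y ^ 4 / 2"
  proof -
    have "y ^ 3 \<ge> (28 / 5) ^ 3" using y5 by (intro power_mono) auto
    hence "y ^ 3 \<ge> 100" by (simp add: power_divide)
    moreover have "28 / 5 * y ^ 3 \<le> y * y ^ 3" using y5 \<open>y ^ 3 \<ge> 100\<close> by (intro mult_right_mono) auto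
    moreover have "y ^ 4 = y * y ^ 3" by (simp add: eval_nat_numeral)
    ultimately show ?thesis by linarith
  qed
  finally have "real (nat \<lceil>9 * x\<^sup>2 * ln d\<rceil>) \<le> y ^ 4 / 2" .
  hence "(real (nat \<lceil>9 * x\<^sup>2 * ln d\<rceil>))\<^sup>2 \<le> (y ^ 4 / 2)\<^sup>2" by (intro power_mono) auto
  also have "\<dots> = N / 4" unfolding y8[symmetric] by (simp add: power_divide power_mult[symmetric])
  finally show ?thesis by simp
qed

theorem theorem1p4:
  fixes G :: "('a, 'b) monoid_scheme" and k :: nat and \<epsilon> :: real
  assumes "group G" and "finite (carrier G)"
    and "k \<ge> 1" and "0 < \<epsilon>" and "\<epsilon> < 1"
    and "real (card (carrier G)) > 10^6 * (real k / \<epsilon>) ^ 8"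
  defines "m \<equiv> nat \<lceil>9 * (real k)^2 * ln (real (Dsum G)) / \<epsilon>^2\<rceil>"
  shows "real (card {A. A \<subseteq> carrier G \<and> card A = m \<and>
              min_eig (YA G k A) (int k - 1) < (1 - \<epsilon>) * real m})
         / real (card (carrier G) choose m)
         < 6 / real (card (carrier G))"
proof -
  interpret fin_group G
    using assms(1,2) by (simp add: fin_group_def fin_group_axioms_def)
  define \<delta> where "\<delta> = \<epsilon> / real k"
  have k0: "real k > 0" using assms(3) by simp
  have \<delta>: "0 < \<delta>" "\<delta> \<le> 1" using assms(3-5) by (auto simp: \<delta>_def field_simps)
  define x where "x = real k / \<epsilon>"
  have x: "x \<ge> 1" "\<delta> * x = 1" using assms(3-5) k0 by (auto simp: x_def \<delta>_def field_simps)
  have mx: "m = nat \<lceil>9 * x\<^sup>2 * ln (real (Dsum G))\<rceil>"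
    unfolding m_def x_def by (simp add: power_divide)
  have D1: "real n \<le> (real (Dsum G))\<^sup>2" using Dsum_ge by (metis of_nat_le_iff of_nat_power)
  have D2: "real (Dsum G) \<le> (real n)\<^sup>2" using Dsum_le by (metis of_nat_le_iff of_nat_power)
  have "Dsum G \<noteq> 0"
  proof
    assume "Dsum G = 0"
    thus False using D1 n_pos by simp
  qed
  hence D0: "real (Dsum G) \<ge> 1" by simp
  have m2: "4 * (real m)\<^sup>2 \<le> real n"
    unfolding mx by (rule sample_size_bound[OF x(1) _ D0 D2]) (use assms(6) in \<open>simp add: x_def\<close>)
  have m1: "(real n)\<^sup>2 \<le> exp (4 / 9 * \<delta>\<^sup>2 * m)"
  proof -
    have "9 * x\<^sup>2 * ln (real (Dsum G)) \<le> m" unfolding mx by (rule real_nat_ceiling_ge)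
    hence "4 / 9 * \<delta>\<^sup>2 * (9 * x\<^sup>2 * ln (real (Dsum G))) \<le> 4 / 9 * \<delta>\<^sup>2 * m" by (intro mult_left_mono) auto
    moreover have "4 / 9 * \<delta>\<^sup>2 * (9 * x\<^sup>2 * ln (real (Dsum G))) = 4 * (\<delta> * x)\<^sup>2 * ln (real (Dsum G))"
      by (simp add: power_mult_distrib)
    ultimately have "4 * ln (real (Dsum G)) \<le> 4 / 9 * \<delta>\<^sup>2 * m" by (simp only: x(2)) simp
    hence "exp (real 4 * ln (real (Dsum G))) \<le> exp (4 / 9 * \<delta>\<^sup>2 * m)" by simp
    have "(real n)\<^sup>2 \<le> ((real (Dsum G))\<^sup>2)\<^sup>2" using D1 by (intro power_mono) auto
    also have "\<dots> = real (Dsum G) ^ 4" by simp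
    also have "\<dots> = exp (real 4 * ln (real (Dsum G)))"
      unfolding exp_of_nat_mult using D0 by simp
    also have "\<dots> \<le> exp (4 / 9 * \<delta>\<^sup>2 * m)" by fact
    finally show ?thesis .
  qed
  have "{A. A \<subseteq> carrier G \<and> card A = m \<and> min_eig (YA G k A) (int k - 1) < (1 - \<epsilon>) * real m}
     \<subseteq> {A. A \<subseteq> carrier G \<and> card A = m \<and> set_expanding A ((\<delta> * m)\<^sup>2)}" (is "?L \<subseteq> ?R")
  proof
    fix A assume A: "A \<in> ?L"
    have "set_expanding A ((\<delta> * m)\<^sup>2)"
    proof (rule ccontr)
      assume "\<not> set_expanding A ((\<delta> * m)\<^sup>2)"
      hence "min_eig (YA G k A) (int k - 1) \<ge> real (card A) - real k * (\<delta> * m)"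
        using A \<delta> assms(3) by (intro min_eig_YA_ge) auto
      moreover have "real k * (\<delta> * m) = \<epsilon> * m" using k0 by (simp add: \<delta>_def)
      moreover have "min_eig (YA G k A) (int k - 1) < real (card A) - \<epsilon> * m"
        using A by (simp add: left_diff_distrib)
      ultimately show False by linarith
    qed
    thus "A \<in> ?R" using A by simp
  qed
  moreover have "finite ?R" by (rule finite_subset[of _ "Pow (carrier G)"]) (auto simp: fin)
  ultimately have "card ?L \<le> card ?R" by (rule card_mono[rotated])
  hence "real (card ?L) / real (n choose m) \<le> real (card ?R) / real (n choose m)"
    by (intro divide_right_mono) auto
  also have "\<dots> < 6 / n" by (rule set_expanding_probability[OF \<delta> m1 m2])
  finally show ?thesis .
qed

end
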